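(* Let $1\le k\le n$ and $F=s_k^{1/k}$. Let $X:M\to\mathbb{R}^{n,1}$ be a $k$-convex, co-compact, spacelike hypersurface which is a self-shrinker of the inverse curvature flow $\partial_tX=-\frac1F\nu$, i.e. $$F=-\frac{1}{\langle X,\nu\rangle}\quad\text{on } M.$$ Then $M$ must be a branch of the hyperboloid $\mathbb{H}^n=\{Y\in\mathbb{R}^{n,1}:\langle Y,Y\rangle=-1\}$.
   Context: Minkowski space $\mathbb{R}^{n,1}$ is $\mathbb{R}^{n+1}$ with $\langle X,Y\rangle=\sum_{i=1}^n x_iy_i-x_{n+1}y_{n+1}$; $E_{n+1}=(0,\dots,0,1)$. A vector $X$ is future directed if $\langle X,E_{n+1}\rangle<0$. A hypersurface is spacelike if its induced metric $g$ is Riemannian, and $\nu$ denotes its future directed unit normal ($\langle\nu,\nu\rangle=-1$). The second fundamental form is $h_{ij}=-\langle\nabla_i\nabla_jX,\nu\rangle$ (so $\partial_j\nu=g^{kl}h_{lj}\,\partial_kX$), and the principal curvatures $\kappa=(\kappa_1,\dots,\kappa_n)$ are the eigenvalues of $h$ with respect to $g$. $\sigma_m(\kappa)$ is the $m$-th elementary symmetric polynomial and $s_m=\sigma_m/\binom{n}{m}$; $F=s_k^{1/k}$ is evaluated at the principal curvatures. $M$ is $k$-convex if at every point $\kappa\in\Gamma_k=\{\lambda\in\mathbb{R}^n:\sigma_m(\lambda)>0,\ m=1,\dots,k\}$. $\mathrm{O}_+(\mathbb{R}^{n,1})$ is the group of linear maps $T$ of $\mathbb{R}^{n,1}$ preserving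 $\langle\cdot,\cdot\rangle$ with $\langle TE_{n+1},E_{n+1}\rangle<0$. Co-compact means standard co-compact: there is a discrete subgroup $G$ of $\mathrm{O}_+(\mathbb{R}^{n,1})$ acting freely and properly discontinuously on $M$ such that the quotient Riemannian manifold $M/G$ is compact.
   Formalization: The conclusion is proved up to a homothety: M (taken connected) is r times a branch of the hyperboloid for some r > 0, since the hyperboloid of any radius r satisfies F = -1/<X,ν> and all the other hypotheses. *)

theory Defs
  imports "HOL-Analysis.Analysis" "HOL-Algebra.Group_Action"
begin

section \<open>Minkowski space\<close>

text \<open>The index type \<open>'n\<close> has \<open>n\<close> elements; the second component of a pair is the coordinate
  with index \<open>n + 1\<close>.\<close>

type_synonym 'n minkowski = "(real ^ 'n) \<times> real"

definition mink :: "'n::finite minkowski \<Rightarrow> 'n minkowski \<Rightarrow> real" where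
  "mink Y Z = fst Y \<bullet> fst Z - snd Y * snd Z"

definition time_vec :: "'n::finite minkowski" where
  "time_vec = (0, 1)"

definition future_directed :: "'n::finite minkowski \<Rightarrow> bool" where
  "future_directed Y \<longleftrightarrow> mink Y time_vec < 0"

definition hyperboloid :: "'n::finite minkowski set" where
  "hyperboloid = {Y. mink Y Y = - 1}"

definition O_plus :: "('n::finite minkowski \<Rightarrow>\<^sub>L 'n minkowski) monoid" where
  "O_plus =
     \<lparr>carrier = {T. (\<forall>Y Z. mink (blinfun_apply T Y) (blinfun_apply T Z) = mink Y Z) \<and>
                    mink (blinfun_apply T time_vec) time_vec < 0},
      mult = (o\<^sub>L),
      one = id_blinfun\<rparr>"


section \<open>Smooth maps on open sets\<close>

definition partial_deriv ::
  "'n::finite \<Rightarrow> (real ^ 'n \<Rightarrow> 'b::real_normed_vector) \<Rightarrow> real ^ 'n \<Rightarrow> 'b" where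
  "partial_deriv i f v = frechet_derivative f (at v) (axis i 1)"

primrec Ck_on :: "nat \<Rightarrow> (real ^ 'n::finite) set \<Rightarrow> (real ^ 'n \<Rightarrow> 'b::real_normed_vector) \<Rightarrow> bool" where
  "Ck_on 0 V f \<longleftrightarrow> continuous_on V f"
| "Ck_on (Suc k) V f \<longleftrightarrow>
     (\<forall>v\<in>V. f differentiable (at v)) \<and> (\<forall>i. Ck_on k V (partial_deriv i f))"

definition smooth_on :: "(real ^ 'n::finite) set \<Rightarrow> (real ^ 'n \<Rightarrow> 'b::real_normed_vector) \<Rightarrow> bool" where
  "smooth_on V f \<longleftrightarrow> (\<forall>k. Ck_on k V f)"


section \<open>Immersed hypersurfaces\<close>

text \<open>A hypersurface is a connected manifold \<open>M\<close> of dimension \<open>n\<close> with an immersion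
  \<open>X\<close> into Minkowski space; \<open>M\<close> is a subset, with the subspace topology, of a type that is
  required to be Hausdorff and second countable where it matters. An embedded hypersurface is the
  case where \<open>X\<close> is the identity on \<open>M\<close>. No atlas has to be given: the smooth structure
  for which \<open>X\<close> is an immersion is unique, and its smooth parametrizations are exactly the
  \<open>local_param\<close>s below, because the transition between two of these is smooth by the
  implicit function theorem.\<close>

definition local_param ::
  "'m::topological_space set \<Rightarrow> ('m \<Rightarrow> 'n::finite minkowski) \<Rightarrow>
    (real ^ 'n) set \<Rightarrow> (real ^ 'n \<Rightarrow> 'm) \<Rightarrow> bool" where
  "local_param M X V \<phi> \<longleftrightarrow>
     open V \<and> openin (top_of_set M) (\<phi> ` V) \<and> (\<exists>\<psi>. homeomorphism V (\<phi> ` V) \<phi> \<psi>) \<and>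
     smooth_on V (X \<circ> \<phi>) \<and> (\<forall>v\<in>V. inj (frechet_derivative (X \<circ> \<phi>) (at v)))"

definition hypersurface :: "'m::topological_space set \<Rightarrow> ('m \<Rightarrow> 'n::finite minkowski) \<Rightarrow> bool" where
  "hypersurface M X \<longleftrightarrow>
     M \<noteq> {} \<and> connected M \<and> (\<forall>p\<in>M. \<exists>V \<phi>. local_param M X V \<phi> \<and> p \<in> \<phi> ` V)"

text \<open>Geometry of a parametrized piece \<open>Y = X \<circ> \<phi>\<close> at the parameter value \<open>v\<close>, in components.\<close>

definition first_form :: "(real ^ 'n::finite \<Rightarrow> 'n minkowski) \<Rightarrow> real ^ 'n \<Rightarrow> real ^ 'n ^ 'n" where
  "first_form Y v = (\<chi> i j. mink (partial_deriv i Y v) (partial_deriv j Y v))"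

definition spacelike :: "'m::topological_space set \<Rightarrow> ('m \<Rightarrow> 'n::finite minkowski) \<Rightarrow> bool" where
  "spacelike M X \<longleftrightarrow>
     (\<forall>V \<phi>. local_param M X V \<phi> \<longrightarrow>
       (\<forall>v\<in>V. \<forall>w. w \<noteq> 0 \<longrightarrow> w \<bullet> (first_form (X \<circ> \<phi>) v *v w) > 0))"

definition unit_normal :: "(real ^ 'n::finite \<Rightarrow> 'n minkowski) \<Rightarrow> real ^ 'n \<Rightarrow> 'n minkowski" where
  "unit_normal Y v =
     (THE N. mink N N = - 1 \<and> future_directed N \<and> (\<forall>i. mink N (partial_deriv i Y v) = 0))"

text \<open>The covariant Hessian of \<open>Y\<close> is the matrix of second partial derivatives minus
  Christoffel symbols times tangent vectors, and the latter are orthogonal to the normal.\<close>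

definition second_form :: "(real ^ 'n::finite \<Rightarrow> 'n minkowski) \<Rightarrow> real ^ 'n \<Rightarrow> real ^ 'n ^ 'n" where
  "second_form Y v = (\<chi> i j. - mink (partial_deriv i (partial_deriv j Y) v) (unit_normal Y v))"

text \<open>The eigenvalues of the second form with respect to the first, repeated according to
  multiplicity and listed in some order; they are only used in symmetric functions.\<close>

definition principal_curvatures :: "(real ^ 'n::finite \<Rightarrow> 'n minkowski) \<Rightarrow> real ^ 'n \<Rightarrow> real ^ 'n" where
  "principal_curvatures Y v =
     (SOME \<kappa>. \<exists>e :: 'n \<Rightarrow> real ^ 'n. inj e \<and> independent (range e) \<and>
        (\<forall>i. second_form Y v *v e i = (\<kappa> $ i) *\<^sub>R (first_form Y v *v e i)))"

definition esym :: "nat \<Rightarrow> real ^ 'n::finite \<Rightarrow> real" where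
  "esym m \<kappa> = (\<Sum>S | S \<subseteq> UNIV \<and> card S = m. \<Prod>i\<in>S. \<kappa> $ i)"

definition esym_mean :: "nat \<Rightarrow> real ^ 'n::finite \<Rightarrow> real" where
  "esym_mean m \<kappa> = esym m \<kappa> / real (CARD('n) choose m)"

definition Gamma_cone :: "nat \<Rightarrow> (real ^ 'n::finite) set" where
  "Gamma_cone k = {\<kappa>. \<forall>m\<in>{1..k}. esym m \<kappa> > 0}"

definition F_curv :: "nat \<Rightarrow> real ^ 'n::finite \<Rightarrow> real" where
  "F_curv k \<kappa> = root k (esym_mean k \<kappa>)"

text \<open>The next two conditions do not depend on the parametrization around a point, so
  quantifying over all of them just says that they hold at every point of \<open>M\<close>.\<close>

definition k_convex :: "nat \<Rightarrow> 'm::topological_space set \<Rightarrow> ('m \<Rightarrow> 'n::finite minkowski) \<Rightarrow> bool" where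
  "k_convex k M X \<longleftrightarrow>
     (\<forall>V \<phi>. local_param M X V \<phi> \<longrightarrow>
       (\<forall>v\<in>V. principal_curvatures (X \<circ> \<phi>) v \<in> Gamma_cone k))"

text \<open>Both sides of the self-shrinker equation have degree \<open>- 1\<close> under homotheties, so
  with \<open>X\<close> every \<open>r X\<close>, \<open>r > 0\<close>, is a self-shrinker too, and the equation can determine a
  hypersurface only up to a homothety.\<close>

definition self_shrinker :: "nat \<Rightarrow> 'm::topological_space set \<Rightarrow> ('m \<Rightarrow> 'n::finite minkowski) \<Rightarrow> bool" where
  "self_shrinker k M X \<longleftrightarrow>
     (\<forall>V \<phi>. local_param M X V \<phi> \<longrightarrow>
       (\<forall>v\<in>V. F_curv k (principal_curvatures (X \<circ> \<phi>) v) =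
               - 1 / mink (X (\<phi> v)) (unit_normal (X \<circ> \<phi>) v)))"


section \<open>Co-compactness\<close>

text \<open>The quotient topology on the set of orbits.\<close>

definition orbit_space ::
  "('g, 'c) monoid_scheme \<Rightarrow> 'm::topological_space set \<Rightarrow> ('g \<Rightarrow> 'm \<Rightarrow> 'm) \<Rightarrow> 'm set topology" where
  "orbit_space G M \<rho> = topology (\<lambda>W. W \<subseteq> orbits G M \<rho> \<and> openin (top_of_set M) (\<Union>W))"

lemma openin_orbit_space:
  assumes "group_action G M \<rho>"
  shows "openin (orbit_space G M \<rho>) W \<longleftrightarrow> W \<subseteq> orbits G M \<rho> \<and> openin (top_of_set M) (\<Union>W)"
proof -
  have disj: "A \<inter> B = {}" if "A \<in> orbits G M \<rho>" "B \<in> orbits G M \<rho>" "A \<noteq> B" for A B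
    using group_action.disjoint_union[OF assms that(1,2)] that(3) by blast
  have Un_Int: "\<Union>(S \<inter> T) = \<Union>S \<inter> \<Union>T"
    if "S \<subseteq> orbits G M \<rho>" "T \<subseteq> orbits G M \<rho>" for S T
    using that disj by blast
  have "istopology (\<lambda>W. W \<subseteq> orbits G M \<rho> \<and> openin (top_of_set M) (\<Union>W))"
    unfolding istopology_def
  proof (intro conjI allI impI; (elim conjE)?)
    fix S T
    assume "S \<subseteq> orbits G M \<rho>" "T \<subseteq> orbits G M \<rho>"
      and "openin (top_of_set M) (\<Union>S)" "openin (top_of_set M) (\<Union>T)"
    then show "openin (top_of_set M) (\<Union>(S \<inter> T))"
      by (simp add: Un_Int openin_Int)
  next
    fix K
    assume *: "\<forall>S\<in>K. S \<subseteq> orbits G M \<rho> \<and> openin (top_of_set M) (\<Union>S)"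
    have "\<Union>(\<Union>K) = (\<Union>S\<in>K. \<Union>S)"
      by blast
    then show "openin (top_of_set M) (\<Union>(\<Union>K))"
      using * by (metis (no_types, lifting) imageE openin_Union)
  qed auto
  then show ?thesis
    by (simp add: orbit_space_def)
qed

text \<open>The group acts on the hypersurface through its linear action on Minkowski space: \<open>X\<close> is
  equivariant (and then the action is by isometries of the induced metric). For an embedded
  hypersurface this is the action by restriction of the linear maps to \<open>M\<close>.\<close>

definition cocompact :: "'m::topological_space set \<Rightarrow> ('m \<Rightarrow> 'n::finite minkowski) \<Rightarrow> bool" where
  "cocompact M X \<longleftrightarrow>
     (\<exists>G \<rho>. subgroup G O_plus \<and> discrete G \<and>
        group_action (O_plus\<lparr>carrier := G\<rparr>) M \<rho> \<and>
        (\<forall>T\<in>G. continuous_on M (\<rho> T)) \<and>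
        (\<forall>T\<in>G. \<forall>p\<in>M. X (\<rho> T p) = blinfun_apply T (X p)) \<and>
        \<comment> \<open>the action is free\<close>
        (\<forall>T\<in>G. \<forall>p\<in>M. \<rho> T p = p \<longrightarrow> T = id_blinfun) \<and>
        \<comment> \<open>and properly discontinuous\<close>
        (\<forall>K. K \<subseteq> M \<and> compact K \<longrightarrow> finite {T \<in> G. \<rho> T ` K \<inter> K \<noteq> {}}) \<and>
        compact_space (orbit_space (O_plus\<lparr>carrier := G\<rparr>) M \<rho>))"

end

theory Submission
  imports Defs "HOL-Computational_Algebra.Fundamental_Theorem_Algebra"
begin

text \<open>Let \<open>f = mink X X / 2\<close> and \<open>u = - mink X \<nu> = 1 / F\<close>. Then \<open>\<Delta> f = n - u * \<Sum>\<kappa>\<^sub>i \<le> 0\<close>, because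
  Maclaurin's inequality bounds \<open>F\<close> by the mean of the principal curvatures. By co-compactness \<open>f\<close>
  attains its minimum, so the strong minimum principle makes it constant. Then the tangential part
  of \<open>X\<close>, which is the gradient of \<open>f\<close>, vanishes, so \<open>X = u *\<^sub>R \<nu>\<close> with \<open>u\<close> constant, and \<open>X\<close> is a
  local homeomorphism into a sheet of radius \<open>u\<close>. Co-compactness gives local inverses of \<open>X\<close>
  on hyperbolic balls of a uniform radius; hence the projection of \<open>X\<close> to \<open>\<real>\<^sup>n\<close>, along which the sheet is a graph,
  is a covering, and it is bijective since \<open>\<real>\<^sup>n\<close> is simply connected.\<close>

section \<open>Maclaurin's inequality\<close>

text \<open>No Laplace operator is formed on \<open>M\<close>. At each point the flat Hessian of the
  parameter space is traced over an orthonormal frame of principal directions, and its tangential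
  part turns into a first order term along a vector \<open>b\<close>. Neither the frame nor
  \<open>b\<close> is known to depend continuously on the point, so the minimum principle asks only
  for bounds on compact sets. The formula for \<Delta> f rests on the covariant Hessian of
  \<open>X\<close> being the second form times \<nu>.

  The obstacle in the global part is that \<open>O_plus\<close> does not preserve Euclidean
  distance, so compactness modulo the group yields no Euclidean radius directly. Balls on the sheet
  are therefore cut out by the invariant condition
  \<open>- mink (X p) Z < r\<^sup>2 + \<epsilon>\<close>. The way back to Euclidean balls is free of
  loss: the squared Minkowski length of a chord is at most the squared distance of the spatial
  parts, so the single radius \<open>sqrt (2 * \<epsilon>)\<close> serves at every point.\<close>

text \<open>Vieta's formula: expand the product over the set \<open>S\<close> of factors that
  contribute their constant term; the remaining factors give the power
  \<open>card A - card S\<close>.\<close>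

lemma coeff_prod_linear:
  fixes a :: "'i \<Rightarrow> 'a::comm_ring_1"
  assumes "finite A" "j \<le> card A"
  shows "poly.coeff (\<Prod>i\<in>A. [:a i, 1:]) j = (\<Sum>S | S \<subseteq> A \<and> card S = card A - j. \<Prod>i\<in>S. a i)"
proof -
  have "(\<Prod>i\<in>A. [:a i, 1:]) = (\<Prod>i\<in>A. [:a i:] + monom 1 1)"
    by (simp add: monom_altdef)
  also have "\<dots> = (\<Sum>S\<in>Pow A. (\<Prod>i\<in>S. [:a i:]) * (\<Prod>i\<in>A - S. monom 1 1))"
    by (rule prod_add[OF assms(1)])
  also have "\<dots> = (\<Sum>S\<in>Pow A. monom (\<Prod>i\<in>S. a i) (card A - card S))"
  proof (rule sum.cong[OF refl])
    fix S assume "S \<in> Pow A"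
    then have S: "S \<subseteq> A" "finite S" using assms(1) finite_subset by auto
    have 1: "(\<Prod>i\<in>S. [:a i:]) = [:\<Prod>i\<in>S. a i:]"
      using S(2) by (induction S rule: finite_induct) (auto simp: one_pCons mult.commute)
    have 2: "(\<Prod>i\<in>A - S. monom (1::'a) 1) = monom 1 (card A - card S)"
      using S by (simp add: monom_power card_Diff_subset)
    show "(\<Prod>i\<in>S. [:a i:]) * (\<Prod>i\<in>A - S. monom 1 1) = monom (\<Prod>i\<in>S. a i) (card A - card S)"
      unfolding 1 2 by (simp add: smult_monom)
  qed
  finally have "poly.coeff (\<Prod>i\<in>A. [:a i, 1:]) j
      = (\<Sum>S\<in>Pow A. if card A - card S = j then \<Prod>i\<in>S. a i else 0)"
    by (simp add: coeff_sum)
  also have "\<dots> = (\<Sum>S | S \<subseteq> A \<and> card S = card A - j. \<Prod>i\<in>S. a i)"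
  proof -
    have "{S \<in> Pow A. card A - card S = j} = {S. S \<subseteq> A \<and> card S = card A - j}"
      using assms card_mono[OF assms(1)] by force
    then show ?thesis using assms(1) by (simp only: sum.inter_filter[symmetric] finite_Pow_iff)
  qed
  finally show ?thesis .
qed

lemma sum_prod_singletons:
  fixes a :: "'i \<Rightarrow> 'a::comm_ring_1"
  shows "(\<Sum>S | S \<subseteq> A \<and> card S = 1. \<Prod>i\<in>S. a i) = (\<Sum>i\<in>A. a i)"
proof -
  have "{S. S \<subseteq> A \<and> card S = 1} = (\<lambda>i. {i}) ` A"
    by (auto simp: card_1_singleton_iff)
  then show ?thesis by (simp add: sum.reindex)
qed

text \<open>The real case of Gauss-Lucas. Off the real axis each term of \<open>p' / p\<close>, the
  sum of the \<open>1 / (z - root i)\<close>, has imaginary part of the sign opposite to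
  \<open>Im z\<close>, so the sum cannot vanish.\<close>

lemma real_rooted_pderiv:
  fixes p :: "complex poly"
  assumes "pderiv p \<noteq> 0" and real: "\<And>z. poly p z = 0 \<Longrightarrow> Im z = 0"
    and z: "poly (pderiv p) z = 0"
  shows "Im z = 0"
proof (rule ccontr)
  assume im: "Im z \<noteq> 0"
  have p0: "p \<noteq> 0" and deg: "degree p \<noteq> 0" using assms(1) by (auto simp: pderiv_eq_0_iff)
  define c d where "c = lead_coeff p" and "d = degree p"
  obtain root where "smult (lead_coeff p) (\<Prod>i<degree p. [:-root i, 1:]) = p"
    using complex_poly_decompose' .
  then have p: "p = smult c (\<Prod>i<d. [:-root i, 1:])" by (simp add: c_def d_def)
  have cd: "c \<noteq> 0" "d \<noteq> 0" using p0 deg by (auto simp: c_def d_def)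
  have im_root: "Im (root i) = 0" if "i < d" for i
  proof -
    have "poly p (root i) = 0" using that by (subst p) (auto simp: poly_prod)
    then show ?thesis by (rule real)
  qed
  then have root: "root i = of_real (Re (root i))" if "i < d" for i
    using im_root[OF that] by (simp add: complex_eq_iff)
  have nz: "z - root i \<noteq> 0" if "i < d" for i
    using im root[OF that] by (metis im_root[OF that] eq_iff_diff_eq_0)
  have "poly (pderiv p) z = c * (\<Sum>i<d. \<Prod>j\<in>{..<d} - {i}. z - root j)"
    by (subst p) (simp add: pderiv_smult pderiv_prod poly_sum poly_prod pderiv_pCons)
  also have "(\<Sum>i<d. \<Prod>j\<in>{..<d} - {i}. z - root j) = (\<Sum>i<d. (\<Prod>j<d. z - root j) * inverse (z - root i))"
  proof (rule sum.cong[OF refl])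
    fix i assume "i \<in> {..<d}"
    then show "(\<Prod>j\<in>{..<d} - {i}. z - root j) = (\<Prod>j<d. z - root j) * inverse (z - root i)"
      using nz by (subst prod.remove[of "{..<d}" i]) (auto simp: field_simps)
  qed
  finally have "c * (\<Prod>j<d. z - root j) * (\<Sum>i<d. inverse (z - root i)) = 0"
    using z by (simp add: sum_distrib_left mult.assoc)
  then have "(\<Sum>i<d. inverse (z - root i)) = 0" using cd nz by auto
  then have "(\<Sum>i<d. Im (inverse (z - root i))) = 0" by (metis Im_sum zero_complex.sel(2))
  moreover have "Im (inverse (z - root i)) = - Im z / (cmod (z - root i))\<^sup>2" if "i < d" for i
    by (subst (2) root[OF that]) (simp add: cmod_power2 im_root[OF that])
  ultimately have "Im z * (\<Sum>i<d. 1 / (cmod (z - root i))\<^sup>2) = 0"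
    by (simp add: sum_distrib_left sum_negf)
  moreover have "(\<Sum>i<d. 1 / (cmod (z - root i))\<^sup>2) > 0"
    using cd nz by (intro sum_pos) auto
  ultimately show False using im by auto
qed

lemma real_rooted_higher_pderiv:
  fixes p :: "complex poly"
  assumes "\<And>z. poly p z = 0 \<Longrightarrow> Im z = 0" and "(pderiv ^^ m) p \<noteq> 0"
    and "poly ((pderiv ^^ m) p) z = 0"
  shows "Im z = 0"
  using assms(2,3)
proof (induction m arbitrary: z)
  case 0
  then show ?case using assms(1) by simp
next
  case (Suc m)
  then have "(pderiv ^^ m) p \<noteq> 0" by auto
  with Suc show ?case using real_rooted_pderiv[of "(pderiv ^^ m) p" z] by simp
qed

text \<open>With \<open>a\<close> the mean, \<open>x i / a\<close> is at most
  \<open>exp (x i / a - 1)\<close>, and these exponents add up to zero.\<close>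

lemma prod_le_mean_power:
  fixes x :: "'i \<Rightarrow> real"
  assumes "finite A" "A \<noteq> {}" "\<And>i. i \<in> A \<Longrightarrow> x i > 0"
  shows "(\<Prod>i\<in>A. x i) \<le> ((\<Sum>i\<in>A. x i) / card A) ^ card A"
proof -
  define a where "a = (\<Sum>i\<in>A. x i) / card A"
  have a: "a > 0" unfolding a_def using assms by (intro divide_pos_pos sum_pos) (auto simp: card_gt_0_iff)
  have "(\<Prod>i\<in>A. x i / a) \<le> (\<Prod>i\<in>A. exp (x i / a - 1))"
    using assms a exp_ge_add_one_self[of "x i / a - 1" for i]
    by (intro prod_mono) (auto intro: order.trans[rotated] less_imp_le)
  also have "\<dots> = exp (\<Sum>i\<in>A. x i / a - 1)" by (simp add: exp_sum assms(1))
  also have "(\<Sum>i\<in>A. x i / a - 1) = (\<Sum>i\<in>A. x i) / a - card A"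
    by (simp add: sum_subtractf sum_divide_distrib)
  also have "\<dots> = 0" using a by (auto simp: a_def field_simps)
  finally have "(\<Prod>i\<in>A. x i) / a ^ card A \<le> 1" by (simp add: prod_dividef)
  then show ?thesis using a by (simp add: a_def)
qed

text \<open>Differentiating \<open>\<Prod>(x + \<kappa>\<^sub>i)\<close> down to degree \<open>k\<close> keeps the roots real and
  preserves the first \<open>k\<close> normalized symmetric means; in \<open>Gamma_cone k\<close> all
  coefficients are positive, so the roots are negative and the inequality of arithmetic and geometric means applies.\<close>

lemma maclaurin_Gamma_cone:
  fixes \<kappa> :: "real ^ 'n::finite"
  assumes "1 \<le> k" "k \<le> CARD('n)" and \<kappa>: "\<kappa> \<in> Gamma_cone k"
  shows "esym_mean k \<kappa> > 0" and "F_curv k \<kappa> \<le> (\<Sum>i\<in>UNIV. \<kappa> $ i) / CARD('n)"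
proof -
  let ?n = "CARD('n)"
  define p where "p = (\<Prod>i\<in>UNIV. [:complex_of_real (\<kappa> $ i), 1:])"
  define q where "q = (pderiv ^^ (?n - k)) p"
  have esym: "esym m \<kappa> > 0" if "m \<le> k" for m
  proof (cases "m = 0")
    case True
    have "{S :: 'n set. card S = 0} = {{}}" by auto
    with True show ?thesis by (simp add: esym_def)
  next
    case False
    with that \<kappa> show ?thesis by (auto simp: Gamma_cone_def)
  qed
  have deg_p: "degree p = ?n" unfolding p_def by (subst degree_prod_sum_eq) auto
  have coeff_p: "poly.coeff p j = of_real (esym (?n - j) \<kappa>)" if "j \<le> ?n" for j
    unfolding p_def using coeff_prod_linear[of UNIV j "\<lambda>i. complex_of_real (\<kappa> $ i)"] that
    by (simp add: esym_def)
  \<comment> \<open>Differentiating \<open>n - k\<close> times moves coefficient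
    \<open>j + (n - k)\<close> of \<open>p\<close>, which is \<open>esym (k - j) \<kappa>\<close>,
    to place \<open>j\<close> and multiplies it by a rising factorial.\<close>
  define c where "c j = pochhammer (real (Suc j)) (?n - k) * esym (k - j) \<kappa>" for j
  have c_pos: "c j > 0" if "j \<le> k" for j unfolding c_def using esym[of "k - j"]
    by (intro mult_pos_pos pochhammer_pos) auto
  have coeff_q: "poly.coeff q j = of_real (c j)" if "j \<le> k" for j
    unfolding q_def c_def using that assms coeff_p[of "j + (?n - k)"]
    by (simp add: coeff_higher_pderiv add.commute pochhammer_of_real[symmetric])
  have deg_q: "degree q = k" unfolding q_def using assms deg_p by (simp add: degree_higher_pderiv)
  have q0: "q \<noteq> 0" using coeff_q[of k] c_pos[of k] by auto
  obtain root where root: "smult (lead_coeff q) (\<Prod>i<k. [:-root i, 1:]) = q"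
    using complex_poly_decompose'[of q] deg_q by metis
  have lc: "lead_coeff q = of_real (c k)" using coeff_q[of k] deg_q by simp
  have neg: "\<exists>\<mu>>0. root i = - of_real \<mu>" if "i < k" for i
  proof -
    have pz: "poly q (root i) = 0"
      using that by (subst root[symmetric]) (auto simp: poly_prod intro!: bexI[of _ i])
    have "Im (root i) = 0"
    proof (rule real_rooted_higher_pderiv[of p "?n - k"])
      fix z assume "poly p z = 0"
      then obtain i where "of_real (\<kappa> $ i) + z = 0" by (auto simp: p_def poly_prod)
      then show "Im z = 0" by (metis Im_complex_of_real add_cancel_left_left plus_complex.sel(2) zero_complex.sel(2))
    qed (use q0 pz in \<open>auto simp: q_def\<close>)
    then obtain x where x: "root i = of_real x" by (metis complex_is_Real_iff Reals_cases)
    have "x < 0"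
    proof (rule ccontr)
      assume "\<not> x < 0"
      have "poly q (of_real x) = (\<Sum>j\<le>k. of_real (c j) * of_real x ^ j)"
        by (simp add: poly_altdef deg_q coeff_q)
      also have "\<dots> = of_real (\<Sum>j\<le>k. c j * x ^ j)" by simp
      finally have "(\<Sum>j\<le>k. c j * x ^ j) = 0" using pz x by (metis of_real_eq_0_iff)
      moreover have "(\<Sum>j\<le>k. c j * x ^ j) \<ge> (\<Sum>j\<in>{0}. c j * x ^ j)"
        using c_pos \<open>\<not> x < 0\<close> by (intro sum_mono2) (auto intro!: mult_nonneg_nonneg intro: less_imp_le)
      ultimately show False using c_pos[of 0] by simp
    qed
    then show ?thesis using x by (intro exI[of _ "-x"]) auto
  qed
  then obtain \<mu> where \<mu>: "\<And>i. i < k \<Longrightarrow> \<mu> i > 0 \<and> root i = - complex_of_real (\<mu> i)" by metis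
  define P where "P = (\<Prod>i<k. [:complex_of_real (\<mu> i), 1:])"
  have "P = (\<Prod>i<k. [:-root i, 1:])" unfolding P_def by (intro prod.cong) (auto simp: \<mu>)
  then have qP: "q = smult (of_real (c k)) P" using root lc by simp
  have "of_real (c 0) = of_real (c k) * poly.coeff P 0" using coeff_q[of 0] qP by simp
  also have "poly.coeff P 0 = of_real (\<Prod>i<k. \<mu> i)"
    by (simp add: P_def poly_0_coeff_0[symmetric] poly_prod)
  finally have c0: "c 0 = c k * (\<Prod>i<k. \<mu> i)" by (metis of_real_eq_iff of_real_mult)
  have "of_real (c (k - 1)) = of_real (c k) * poly.coeff P (k - 1)" using coeff_q[of "k - 1"] qP by simp
  also have "poly.coeff P (k - 1) = of_real (\<Sum>i<k. \<mu> i)"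
    using coeff_prod_linear[of "{..<k}" "k - 1" "\<lambda>i. complex_of_real (\<mu> i)"] assms
      sum_prod_singletons[where A = "{..<k}" and a = "\<lambda>i. complex_of_real (\<mu> i)"] by (simp add: P_def)
  finally have c1: "c (k - 1) = c k * (\<Sum>i<k. \<mu> i)" by (metis of_real_eq_iff of_real_mult)
  have esym0: "esym 0 \<kappa> = 1"
  proof -
    have "{S :: 'n set. card S = 0} = {{}}" by auto
    then show ?thesis by (simp add: esym_def)
  qed
  have esym1: "esym 1 \<kappa> = (\<Sum>i\<in>UNIV. \<kappa> $ i)"
    using sum_prod_singletons[where A = UNIV and a = "\<lambda>i. \<kappa> $ i"] by (simp add: esym_def)
  have poch: "pochhammer (real (Suc j)) m = fact (j + m) / fact j" for j m
    using pochhammer_fact[of "j + m", where 'a = real] pochhammer_product'[of "1::real" j m]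
    by (simp add: pochhammer_fact[symmetric] add.commute)
  have ck: "c k = fact ?n / fact k" unfolding c_def poch using assms by (simp add: esym0)
  have "c 0 = fact (?n - k) * esym k \<kappa>" unfolding c_def poch by simp
  \<comment> \<open>The product is \<open>c 0 / c k\<close>, and the factorials in it,
    \<open>(n - k)! k! / n!\<close>, are exactly the reciprocal of the binomial coefficient in
    \<open>esym_mean\<close>.\<close>
  then have prod: "(\<Prod>i<k. \<mu> i) = esym_mean k \<kappa>"
    using c0 ck assms by (simp add: esym_mean_def binomial_fact field_simps)
  have "c (k - 1) = fact (?n - 1) / fact (k - 1) * esym 1 \<kappa>"
    unfolding c_def poch using assms by simp
  moreover have "(fact ?n :: real) = ?n * fact (?n - 1)" by (simp add: fact_reduce)
  moreover have "(fact k :: real) = k * fact (k - 1)" using assms by (simp add: fact_reduce)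
  \<comment> \<open>Here \<open>c (k - 1) / c k\<close> is \<open>k / n\<close> times
    \<open>esym 1 \<kappa>\<close>: the roots and the curvatures have the same mean.\<close>
  ultimately have sum: "(\<Sum>i<k. \<mu> i) / k = (\<Sum>i\<in>UNIV. \<kappa> $ i) / ?n"
    using c1 ck assms by (simp add: esym1[unfolded One_nat_def] field_simps)
  show "esym_mean k \<kappa> > 0" unfolding prod[symmetric] using \<mu> by (intro prod_pos) auto
  have s0: "(\<Sum>i<k. \<mu> i) / k \<ge> 0" using \<mu> by (intro divide_nonneg_nonneg sum_nonneg) (auto intro: less_imp_le)
  have "esym_mean k \<kappa> \<le> ((\<Sum>i<k. \<mu> i) / k) ^ k"
    using prod_le_mean_power[of "{..<k}" \<mu>] assms \<mu> unfolding prod by (auto simp: lessThan_empty_iff)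
  then have "NthRoot.root k (esym_mean k \<kappa>) \<le> NthRoot.root k (((\<Sum>i<k. \<mu> i) / k) ^ k)"
    using assms by simp
  also have "\<dots> = (\<Sum>i<k. \<mu> i) / k" using assms s0 by (simp add: real_root_power_cancel)
  finally show "F_curv k \<kappa> \<le> (\<Sum>i\<in>UNIV. \<kappa> $ i) / ?n" by (simp add: F_curv_def sum)
qed

section \<open>Simultaneous diagonalization\<close>

text \<open>The first order condition at a maximum, in algebraic form. Instead of a limit, the
  single value \<open>t = a / (2 * D)\<close> already gives the contradiction.\<close>

lemma linear_term_zero_if_quadratic_bound:
  fixes a C :: real
  assumes "\<And>t. t * a \<le> t\<^sup>2 * C"
  shows "a = 0"
proof (rule ccontr)
  assume "a \<noteq> 0"
  define D where "D = \<bar>C\<bar> + 1"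
  define t where "t = a / (2 * D)"
  have D: "D > 0" "C \<le> D" by (auto simp: D_def)
  have a: "a = 2 * D * t" using D by (simp add: t_def)
  have "t * a \<le> t\<^sup>2 * C" by (rule assms)
  also have "\<dots> \<le> t\<^sup>2 * D" using D by (intro mult_left_mono) auto
  finally have "D * t\<^sup>2 \<le> 0" by (simp add: a power2_eq_square algebra_simps)
  then have "t = 0" using D by (simp add: mult_le_0_iff)
  then show False using a \<open>a \<noteq> 0\<close> by simp
qed

text \<open>The spectral theorem for \<open>h\<close> relative to the inner product
  \<open>g\<close>, by Rayleigh quotients: if a largest family of eigenvectors did not span, a
  maximizer of \<open>h\<close> among the \<open>g\<close>-unit vectors orthogonal to it would
  enlarge it.\<close>

lemma simultaneous_diagonalization:
  fixes g h :: "'a::euclidean_space \<Rightarrow> 'a \<Rightarrow> real"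
  assumes g: "bilinear g" and h: "bilinear h"
    and gsym: "\<And>x y. g x y = g y x" and hsym: "\<And>x y. h x y = h y x"
    and gpos: "\<And>x. x \<noteq> 0 \<Longrightarrow> g x x > 0"
  obtains B where "finite B" "card B = DIM('a)" "independent B"
    "\<And>b. b \<in> B \<Longrightarrow> g b b = 1"
    "\<And>b c. b \<in> B \<Longrightarrow> c \<in> B \<Longrightarrow> b \<noteq> c \<Longrightarrow> g b c = 0 \<and> h b c = 0"
proof -
  have gb: "bounded_bilinear g" and hb: "bounded_bilinear h"
    using g h bilinear_conv_bounded_bilinear by auto
  interpret G: bounded_bilinear g by fact
  interpret H: bounded_bilinear h by fact
  \<comment> \<open>The last clause is the eigenvector property in disguise: \<open>h b\<close>
    vanishes on the \<open>g\<close>-complement of \<open>B\<close>. It makes a vector found in that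
    complement \<open>h\<close>-orthogonal to the old ones.\<close>
  define good where "good B \<longleftrightarrow> finite B \<and> (\<forall>b\<in>B. g b b = 1) \<and>
      (\<forall>b\<in>B. \<forall>c\<in>B. b \<noteq> c \<longrightarrow> g b c = 0 \<and> h b c = 0) \<and>
      (\<forall>b\<in>B. \<forall>w. (\<forall>c\<in>B. g c w = 0) \<longrightarrow> h b w = 0)" for B
  have indep: "independent B" if "good B" for B
  proof -
    have "u b = 0" if u: "(\<Sum>v\<in>B. u v *\<^sub>R v) = 0" and b: "b \<in> B" for u b
    proof -
      have "0 = g (\<Sum>v\<in>B. u v *\<^sub>R v) b" using u by (simp add: G.zero_left)
      also have "\<dots> = (\<Sum>v\<in>B. u v * g v b)" by (simp add: G.sum_left G.scaleR_left)
      also have "\<dots> = (\<Sum>v\<in>{b}. u v * g v b)"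
        using \<open>good B\<close> b by (intro sum.mono_neutral_right) (auto simp: good_def)
      finally show "u b = 0" using \<open>good B\<close> b by (auto simp: good_def)
    qed
    then show ?thesis using \<open>good B\<close> by (intro independent_if_scalars_zero) (auto simp: good_def)
  qed
  have bound: "card B \<le> DIM('a)" if "good B" for B
    using independent_bound[OF indep[OF that]] by simp
  have "good {}" by (simp add: good_def)
  have "\<exists>B. good B \<and> (\<forall>B'. good B' \<longrightarrow> card B' \<le> card B)"
    using \<open>good {}\<close> bound by (intro Lattices_Big.ex_has_greatest_nat[where b = "DIM('a) + 1"]) (auto simp: less_Suc_eq_le)
  then obtain B where B: "good B" and max: "\<And>B'. good B' \<Longrightarrow> card B' \<le> card B" by blast
  have fin: "finite B" using B by (simp add: good_def)
  have spans: "w = 0" if w: "\<forall>c\<in>B. g c w = 0" for w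
  proof (rule ccontr)
    assume "w \<noteq> 0"
    define K where "K = {x. (\<forall>c\<in>B. g c x = 0) \<and> g x x = 1}"
    have cont: "continuous_on S (\<lambda>x. g x x)" "continuous_on S (\<lambda>x. h x x)" "continuous_on S (\<lambda>x. g c x)" for S c
      by (rule G.continuous_on[OF continuous_on_id continuous_on_id]
          H.continuous_on[OF continuous_on_id continuous_on_id]
          G.continuous_on[OF continuous_on_const continuous_on_id])+
    have "closed {x. g c x = 0}" "closed {x. g x x = 1}" for c
      by (intro closed_Collect_eq cont continuous_on_const)+
    moreover have "K = (\<Inter>c\<in>B. {x. g c x = 0}) \<inter> {x. g x x = 1}" by (auto simp: K_def)
    ultimately have "closed K" by auto
    \<comment> \<open>The minimum of \<open>g x x\<close> over the Euclidean unit sphere is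
      positive, so by homogeneity \<open>g\<close> dominates a multiple of the squared norm.\<close>
    moreover have "bounded K"
    proof -
      have "compact (sphere (0::'a) 1)" by simp
      moreover have "sphere (0::'a) 1 \<noteq> {}" by simp
      ultimately obtain s where s: "s \<in> sphere 0 1" and smin: "\<And>x. x \<in> sphere 0 1 \<Longrightarrow> g s s \<le> g x x"
        using continuous_attains_inf[OF _ _ cont(1), of "sphere 0 1"] by blast
      have gs: "g s s > 0" using s gpos[of s] by force
      have "norm x \<le> sqrt (1 / g s s)" if "x \<in> K" for x
      proof -
        have x: "g x x = 1" "x \<noteq> 0" using that by (auto simp: K_def G.zero_left)
        have "g s s \<le> g ((1 / norm x) *\<^sub>R x) ((1 / norm x) *\<^sub>R x)" using x by (intro smin) simp
        also have "\<dots> = 1 / (norm x)\<^sup>2"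
          using x by (simp add: G.scaleR_left G.scaleR_right power2_eq_square)
        finally have "(norm x)\<^sup>2 \<le> 1 / g s s" using gs x by (simp add: field_simps)
        then show ?thesis by (simp add: real_le_rsqrt)
      qed
      then show ?thesis by (auto simp: bounded_iff)
    qed
    ultimately have "compact K" by (simp add: compact_eq_bounded_closed)
    moreover have "(1 / sqrt (g w w)) *\<^sub>R w \<in> K"
      using w gpos[OF \<open>w \<noteq> 0\<close>] by (simp add: K_def G.scaleR_left G.scaleR_right)
    ultimately obtain e where e: "e \<in> K" and emax: "\<And>x. x \<in> K \<Longrightarrow> h x x \<le> h e e"
      using continuous_attains_sup[OF _ _ cont(2), of K] by blast
    have ee: "g e e = 1" and eB: "\<And>c. c \<in> B \<Longrightarrow> g c e = 0" using e by (auto simp: K_def)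
    have hmax: "h x x \<le> h e e * g x x" if x: "\<forall>c\<in>B. g c x = 0" for x
    proof (cases "x = 0")
      case False
      then have gx: "g x x > 0" by (rule gpos)
      have "(1 / sqrt (g x x)) *\<^sub>R x \<in> K" using x gx by (simp add: K_def G.scaleR_left G.scaleR_right)
      from emax[OF this] gx show ?thesis by (simp add: H.scaleR_left H.scaleR_right field_simps)
    qed (simp add: G.zero_left H.zero_left)
    \<comment> \<open>First variation: compare the maximizer \<open>e\<close> with
      \<open>e + t *\<^sub>R x\<close> and read off the coefficient of \<open>t\<close>.\<close>
    have he: "h e x = 0" if x: "\<forall>c\<in>B. g c x = 0" and xe: "g e x = 0" for x
    proof -
      have "t * (2 * h e x) \<le> t\<^sup>2 * (h e e * g x x - h x x)" for t
      proof -
        have "h (e + t *\<^sub>R x) (e + t *\<^sub>R x) \<le> h e e * g (e + t *\<^sub>R x) (e + t *\<^sub>R x)"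
          using x eB by (intro hmax) (simp add: G.add_right G.scaleR_right)
        then show ?thesis using xe ee gsym[of x e] hsym[of x e]
          by (simp add: G.add_left G.add_right G.scaleR_left G.scaleR_right H.add_left H.add_right
              H.scaleR_left H.scaleR_right algebra_simps power2_eq_square)
      qed
      from linear_term_zero_if_quadratic_bound[OF this] show ?thesis by simp
    qed
    have "good (insert e B)"
      unfolding good_def
    proof (intro conjI ballI impI allI)
      show "finite (insert e B)" using fin by simp
      show "g b b = 1" if "b \<in> insert e B" for b using that ee B by (auto simp: good_def)
      show "g b c = 0" if "b \<in> insert e B" "c \<in> insert e B" "b \<noteq> c" for b c
        using that B eB gsym[of e] by (auto simp: good_def)
      show "h b c = 0" if "b \<in> insert e B" "c \<in> insert e B" "b \<noteq> c" for b c
        using that B eB hsym[of e] by (auto simp: good_def)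
      show "h b x = 0" if "b \<in> insert e B" "\<forall>c\<in>insert e B. g c x = 0" for b x
        using that B he by (auto simp: good_def)
    qed
    then have "card (insert e B) \<le> card B" by (rule max)
    moreover have "e \<notin> B" using eB ee by force
    ultimately show False using fin by simp
  qed
  have "span B = UNIV"
  proof -
    have "w \<in> span B" for w
    proof -
      have "w - (\<Sum>b\<in>B. g b w *\<^sub>R b) = 0"
      proof (rule spans, rule ballI)
        fix c assume c: "c \<in> B"
        have "g c (\<Sum>b\<in>B. g b w *\<^sub>R b) = (\<Sum>b\<in>B. g b w * g c b)"
          by (simp add: G.sum_right G.scaleR_right)
        also have "\<dots> = (\<Sum>b\<in>{c}. g b w * g c b)"
          using B c by (intro sum.mono_neutral_right) (auto simp: good_def)
        also have "\<dots> = g c w" using B c by (simp add: good_def)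
        finally show "g c (w - (\<Sum>b\<in>B. g b w *\<^sub>R b)) = 0" by (simp add: G.diff_right)
      qed
      then have "w = (\<Sum>b\<in>B. g b w *\<^sub>R b)" by simp
      also have "\<dots> \<in> span B" by (intro span_sum span_scale span_base)
      finally show ?thesis .
    qed
    then show ?thesis by auto
  qed
  then have "card B = DIM('a)" using dim_eq_card_independent[OF indep[OF B]] by (metis dim_UNIV dim_span)
  then show ?thesis using that[of B] fin indep[OF B] B by (auto simp: good_def)
qed

lemma independent_family_sum_eq_zero:
  fixes e :: "'i::finite \<Rightarrow> 'a::real_vector"
  assumes "inj e" "independent (range e)" "(\<Sum>i\<in>UNIV. x i *\<^sub>R e i) = 0"
  shows "x i = 0"
proof -
  have "(\<Sum>b\<in>range e. x (inv_into UNIV e b) *\<^sub>R b) = 0"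
    using assms by (simp add: sum.reindex)
  then have "x (inv_into UNIV e (e i)) = 0"
    using independentD[OF assms(2), of "range e" "\<lambda>b. x (inv_into UNIV e b)" "e i"] by simp
  then show ?thesis using assms(1) by simp
qed

text \<open>If \<open>P\<close> has the eigenvectors as columns and \<open>D\<close> is diagonal
  with the eigenvalues, then \<open>H ** P = G ** P ** D\<close>, so \<open>G' ** H\<close> is
  conjugate to \<open>D\<close>. The trace does not mention the eigenbasis, which makes the sum
  independent of its choice.\<close>

lemma sum_generalized_eigenvalues:
  fixes G H G' :: "real ^ 'n ^ 'n::finite" and e :: "'n \<Rightarrow> real ^ 'n" and \<kappa> :: "real ^ 'n"
  assumes G: "G' ** G = mat 1" and e: "inj e" "independent (range e)"
    and eig: "\<And>i. H *v e i = (\<kappa> $ i) *\<^sub>R (G *v e i)"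
  shows "(\<Sum>i\<in>UNIV. \<kappa> $ i) = trace (G' ** H)"
proof -
  define P :: "real ^ 'n ^ 'n" where "P = (\<chi> i j. e j $ i)"
  define D :: "real ^ 'n ^ 'n" where "D = (\<chi> i j. if i = j then \<kappa> $ i else 0)"
  have mult: "P *v x = (\<Sum>i\<in>UNIV. (x $ i) *\<^sub>R e i)" for x
    by (simp add: vec_eq_iff P_def matrix_vector_mult_def mult.commute)
  have "inj ((*v) P)"
  proof (rule injI)
    fix x y assume "P *v x = P *v y"
    then have "(\<Sum>i\<in>UNIV. (x $ i - y $ i) *\<^sub>R e i) = 0"
      by (simp add: mult scaleR_left_diff_distrib sum_subtractf)
    from independent_family_sum_eq_zero[OF e this] show "x = y" by (simp add: vec_eq_iff)
  qed
  then obtain Q where QP: "Q ** P = mat 1" by (meson matrix_left_invertible_injective)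
  then have PQ: "P ** Q = mat 1" by (simp add: matrix_left_right_inverse)
  have "(H ** P) $ i $ j = (G ** (P ** D)) $ i $ j" for i j
  proof -
    have "(H ** P) $ i $ j = (H *v e j) $ i"
      by (simp add: matrix_matrix_mult_def matrix_vector_mult_def P_def)
    also have "\<dots> = (\<Sum>k\<in>UNIV. G $ i $ k * (e j $ k * \<kappa> $ j))"
      by (subst eig) (simp add: matrix_vector_mult_def sum_distrib_left algebra_simps)
    also have "\<dots> = (G ** (P ** D)) $ i $ j"
      by (simp add: matrix_matrix_mult_def P_def D_def if_distrib cong: if_cong)
    finally show ?thesis .
  qed
  then have HP: "H ** P = G ** (P ** D)" by (simp add: vec_eq_iff)
  have "H = (H ** P) ** Q" by (simp add: matrix_mul_assoc[symmetric] PQ)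
  also have "\<dots> = G ** (P ** D ** Q)" by (simp add: HP matrix_mul_assoc)
  finally have "G' ** H = (G' ** G) ** (P ** D ** Q)"
    by (simp add: matrix_mul_assoc)
  also have "\<dots> = P ** D ** Q" by (simp add: G)
  finally have "trace (G' ** H) = trace (Q ** (P ** D))" by (metis trace_mul_sym)
  also have "\<dots> = trace D" by (simp add: matrix_mul_assoc QP)
  also have "\<dots> = (\<Sum>i\<in>UNIV. \<kappa> $ i)" by (simp add: trace_def D_def)
  finally show ?thesis by simp
qed

text \<open>Vanishing off-diagonal entries become an eigenvector equation because
  \<open>H *v e i - (\<kappa> $ i) *\<^sub>R (G *v e i)\<close> is Euclidean orthogonal to every
  frame vector, hence to itself.\<close>

lemma orthonormal_eigenframe:
  fixes G H :: "real ^ 'n ^ 'n::finite"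
  assumes Gsym: "transpose G = G" and Hsym: "transpose H = H"
    and pos: "\<And>w. w \<noteq> 0 \<Longrightarrow> w \<bullet> (G *v w) > 0"
  obtains e :: "'n \<Rightarrow> real ^ 'n" and \<kappa> :: "real ^ 'n"
  where "inj e" "independent (range e)" "\<And>i j. e i \<bullet> (G *v e j) = (if i = j then 1 else 0)"
    "\<And>i. H *v e i = (\<kappa> $ i) *\<^sub>R (G *v e i)"
proof -
  have bil: "bilinear (\<lambda>x y. x \<bullet> (A *v y))" for A :: "real ^ 'n ^ 'n"
    unfolding bilinear_def
    by (auto intro!: linearI simp: inner_add_left inner_add_right matrix_vector_right_distrib matrix_vector_mult_scaleR)
  have sym: "x \<bullet> (A *v y) = y \<bullet> (A *v x)" if "transpose A = A" for A :: "real ^ 'n ^ 'n" and x y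
    using that by (metis dot_lmul_matrix inner_commute transpose_matrix_vector)
  obtain B where B: "finite B" "card B = DIM(real ^ 'n)" "independent B"
    "\<And>b. b \<in> B \<Longrightarrow> b \<bullet> (G *v b) = 1"
    "\<And>b c. b \<in> B \<Longrightarrow> c \<in> B \<Longrightarrow> b \<noteq> c \<Longrightarrow> b \<bullet> (G *v c) = 0 \<and> b \<bullet> (H *v c) = 0"
    by (rule simultaneous_diagonalization[OF bil[of G] bil[of H] sym[OF Gsym] sym[OF Hsym] pos]) (auto)
  have "card (UNIV :: 'n set) = card B" using B(2) by simp
  then obtain e where e: "bij_betw e (UNIV :: 'n set) B"
    using B(1) finite_same_card_bij[OF finite B(1)] by blast
  then have inj: "inj e" and range: "range e = B" by (auto simp: bij_betw_def)
  define \<kappa> :: "real ^ 'n" where "\<kappa> = (\<chi> i. e i \<bullet> (H *v e i))"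
  have on: "e i \<bullet> (G *v e j) = (if i = j then 1 else 0)" and off: "i \<noteq> j \<Longrightarrow> e i \<bullet> (H *v e j) = 0" for i j
    using B(4)[of "e i"] B(5)[of "e i" "e j"] range inj by (auto simp: inj_def)
  have span: "x \<in> span B" for x using card_ge_dim_independent[of B UNIV] B(2,3) by auto
  have "H *v e i = (\<kappa> $ i) *\<^sub>R (G *v e i)" for i
  proof -
    let ?z = "H *v e i - (\<kappa> $ i) *\<^sub>R (G *v e i)"
    have ez: "e j \<bullet> ?z = 0" for j
      using on[of j i] off[of j i] by (cases "i = j") (simp_all add: inner_diff_right \<kappa>_def)
    have "orthogonal ?z b" if "b \<in> B" for b
    proof -
      obtain j where "b = e j" using \<open>b \<in> B\<close> unfolding range[symmetric] by blast
      then show ?thesis unfolding orthogonal_def by (subst inner_commute) (simp only: ez)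
    qed
    then have "orthogonal ?z ?z" by (rule orthogonal_to_span[OF span])
    then have "?z \<bullet> ?z = 0" by (simp add: orthogonal_def)
    then show ?thesis by simp
  qed
  then show ?thesis using inj range B(3) on by (intro that[of e \<kappa>]) simp_all
qed

text \<open>The \<open>SOME\<close> in \<open>principal_curvatures\<close> picks an unknown
  eigenbasis; the trace formula allows its sum to be computed in a frame that is convenient.\<close>

lemma sum_principal_curvatures:
  fixes Y :: "real ^ 'n::finite \<Rightarrow> 'n minkowski" and e :: "'n \<Rightarrow> real ^ 'n" and \<kappa> :: "real ^ 'n"
  assumes pos: "\<And>w. w \<noteq> 0 \<Longrightarrow> w \<bullet> (first_form Y v *v w) > 0"
    and e: "inj e" "independent (range e)" "\<And>i. second_form Y v *v e i = (\<kappa> $ i) *\<^sub>R (first_form Y v *v e i)"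
  shows "(\<Sum>i\<in>UNIV. principal_curvatures Y v $ i) = (\<Sum>i\<in>UNIV. \<kappa> $ i)"
proof -
  let ?G = "first_form Y v"
  have "inj ((*v) ?G)"
  proof (rule injI)
    fix x y assume "?G *v x = ?G *v y"
    then have "(x - y) \<bullet> (?G *v (x - y)) = 0" by (simp add: matrix_vector_mult_diff_distrib)
    then show "x = y" using pos[of "x - y"] by force
  qed
  then obtain G' where G: "G' ** ?G = mat 1" by (meson matrix_left_invertible_injective)
  define R where "R \<kappa> \<longleftrightarrow> (\<exists>e :: 'n \<Rightarrow> real ^ 'n. inj e \<and> independent (range e) \<and>
      (\<forall>i. second_form Y v *v e i = (\<kappa> $ i) *\<^sub>R (?G *v e i)))" for \<kappa> :: "real ^ 'n"
  have "R (principal_curvatures Y v)"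
    unfolding principal_curvatures_def R_def[symmetric] by (rule someI[of R \<kappa>]) (use e in \<open>auto simp: R_def\<close>)
  then obtain e' :: "'n \<Rightarrow> real ^ 'n" where "inj e'" "independent (range e')"
    "\<And>i. second_form Y v *v e' i = (principal_curvatures Y v $ i) *\<^sub>R (?G *v e' i)"
    by (auto simp: R_def)
  from sum_generalized_eigenvalues[OF G this] sum_generalized_eigenvalues[OF G e]
  show ?thesis by simp
qed

section \<open>Symmetry of second derivatives\<close>

text \<open>The mean value theorem twice: along \<open>a\<close> for the difference
  \<open>\<phi>\<close> of two parallel lines, then along \<open>b\<close> for the resulting
  difference of \<open>fa\<close>.\<close>

lemma mixed_derivative_eq_second_difference:
  fixes f :: "'a::real_normed_vector \<Rightarrow> real"
  assumes "s > 0"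
    and V: "\<And>t r. 0 \<le> t \<Longrightarrow> t \<le> s \<Longrightarrow> 0 \<le> r \<Longrightarrow> r \<le> s \<Longrightarrow> v + t *\<^sub>R a + r *\<^sub>R b \<in> V"
    and fa: "\<And>x. x \<in> V \<Longrightarrow> ((\<lambda>t. f (x + t *\<^sub>R a)) has_real_derivative fa x) (at 0)"
    and fab: "\<And>x. x \<in> V \<Longrightarrow> ((\<lambda>t. fa (x + t *\<^sub>R b)) has_real_derivative fab x) (at 0)"
  obtains t r where "0 \<le> t" "t \<le> s" "0 \<le> r" "r \<le> s"
    "f (v + s *\<^sub>R a + s *\<^sub>R b) - f (v + s *\<^sub>R a) - f (v + s *\<^sub>R b) + f v = s\<^sup>2 * fab (v + t *\<^sub>R a + r *\<^sub>R b)"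
proof -
  have shift: "((\<lambda>t. k (x + t *\<^sub>R c)) has_real_derivative k') (at t)"
    if "((\<lambda>u. k ((x + t *\<^sub>R c) + u *\<^sub>R c)) has_real_derivative k') (at 0)" for k :: "'a \<Rightarrow> real" and x c k' t
  proof -
    have "((\<lambda>u. k (x + (u + t) *\<^sub>R c)) has_real_derivative k') (at 0)"
      using that by (simp add: scaleR_add_left add_ac)
    then show ?thesis
      using DERIV_shift[of "\<lambda>t. k (x + t *\<^sub>R c)" k' 0 t] by simp
  qed
  define \<phi> where "\<phi> t = f ((v + s *\<^sub>R b) + t *\<^sub>R a) - f (v + t *\<^sub>R a)" for t
  have d\<phi>: "(\<phi> has_real_derivative fa ((v + s *\<^sub>R b) + t *\<^sub>R a) - fa (v + t *\<^sub>R a)) (at t)"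
    if "0 \<le> t" "t \<le> s" for t
    unfolding \<phi>_def
  proof (intro DERIV_diff shift[OF fa])
    show "v + s *\<^sub>R b + t *\<^sub>R a \<in> V" using V[of t s] that \<open>s > 0\<close> by (simp add: algebra_simps)
    show "v + t *\<^sub>R a \<in> V" using V[of t 0] that \<open>s > 0\<close> by simp
  qed
  have "\<exists>t. 0 < t \<and> t < s \<and> \<phi> s - \<phi> 0 = (s - 0) * (fa ((v + s *\<^sub>R b) + t *\<^sub>R a) - fa (v + t *\<^sub>R a))"
    by (rule MVT2[OF \<open>s > 0\<close>]) (rule d\<phi>)
  then obtain t where t: "0 < t" "t < s"
    and 1: "\<phi> s - \<phi> 0 = (s - 0) * (fa ((v + s *\<^sub>R b) + t *\<^sub>R a) - fa (v + t *\<^sub>R a))" by blast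
  have dr: "((\<lambda>r. fa ((v + t *\<^sub>R a) + r *\<^sub>R b)) has_real_derivative fab ((v + t *\<^sub>R a) + r *\<^sub>R b)) (at r)"
    if "0 \<le> r" "r \<le> s" for r
    using V[of t r] t that by (intro shift[OF fab]) auto
  have "\<exists>r. 0 < r \<and> r < s \<and> fa ((v + t *\<^sub>R a) + s *\<^sub>R b) - fa ((v + t *\<^sub>R a) + 0 *\<^sub>R b)
      = (s - 0) * fab ((v + t *\<^sub>R a) + r *\<^sub>R b)"
    by (rule MVT2[OF \<open>s > 0\<close>]) (rule dr)
  then obtain r where r: "0 < r" "r < s"
    and 2: "fa ((v + t *\<^sub>R a) + s *\<^sub>R b) - fa ((v + t *\<^sub>R a) + 0 *\<^sub>R b) = (s - 0) * fab ((v + t *\<^sub>R a) + r *\<^sub>R b)"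
    by blast
  have "f (v + s *\<^sub>R a + s *\<^sub>R b) - f (v + s *\<^sub>R a) - f (v + s *\<^sub>R b) + f v = \<phi> s - \<phi> 0"
    by (simp add: \<phi>_def algebra_simps)
  also have "\<dots> = s * (fa ((v + t *\<^sub>R a) + s *\<^sub>R b) - fa (v + t *\<^sub>R a))"
    unfolding 1 by (simp add: algebra_simps)
  also have "\<dots> = s\<^sup>2 * fab (v + t *\<^sub>R a + r *\<^sub>R b)"
    using 2 by (simp add: power2_eq_square)
  finally show ?thesis by (intro that[of t r]) (use t r in simp_all)
qed

text \<open>The second difference is symmetric in \<open>a\<close> and \<open>b\<close>, so
  \<open>fab\<close> and \<open>fba\<close> take a common value at two points as close to
  \<open>v\<close> as desired; continuity at \<open>v\<close> does the rest.\<close>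

lemma mixed_derivatives_commute_real:
  fixes f :: "'a::real_normed_vector \<Rightarrow> real"
  assumes "open V" "v \<in> V"
    and fa: "\<And>x. x \<in> V \<Longrightarrow> ((\<lambda>t. f (x + t *\<^sub>R a)) has_real_derivative fa x) (at 0)"
    and fb: "\<And>x. x \<in> V \<Longrightarrow> ((\<lambda>t. f (x + t *\<^sub>R b)) has_real_derivative fb x) (at 0)"
    and fab: "\<And>x. x \<in> V \<Longrightarrow> ((\<lambda>t. fa (x + t *\<^sub>R b)) has_real_derivative fab x) (at 0)"
    and fba: "\<And>x. x \<in> V \<Longrightarrow> ((\<lambda>t. fb (x + t *\<^sub>R a)) has_real_derivative fba x) (at 0)"
    and "isCont fab v" "isCont fba v"
  shows "fab v = fba v"
proof (rule ccontr)
  assume ne: "fab v \<noteq> fba v"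
  define \<epsilon> where "\<epsilon> = \<bar>fab v - fba v\<bar> / 2"
  have "\<epsilon> > 0" using ne by (simp add: \<epsilon>_def)
  obtain d1 where d1: "d1 > 0" "\<And>x. dist x v < d1 \<Longrightarrow> \<bar>fab x - fab v\<bar> < \<epsilon>"
    using \<open>isCont fab v\<close> \<open>\<epsilon> > 0\<close> unfolding continuous_at_eps_delta by (auto simp: dist_real_def)
  obtain d2 where d2: "d2 > 0" "\<And>x. dist x v < d2 \<Longrightarrow> \<bar>fba x - fba v\<bar> < \<epsilon>"
    using \<open>isCont fba v\<close> \<open>\<epsilon> > 0\<close> unfolding continuous_at_eps_delta by (auto simp: dist_real_def)
  obtain d3 where d3: "d3 > 0" "ball v d3 \<subseteq> V" using assms(1,2) open_contains_ball by blast
  define d where "d = min d1 (min d2 d3)"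
  \<comment> \<open>Small enough that the whole parallelogram with sides
    \<open>s *\<^sub>R a\<close> and \<open>s *\<^sub>R b\<close> lies within distance
    \<open>d\<close> of \<open>v\<close>; the 1 avoids a zero denominator.\<close>
  define s where "s = d / (norm a + norm b + 1)"
  have N: "norm a + norm b + 1 > 0" by (simp add: add_nonneg_pos)
  have d: "d > 0" using d1 d2 d3 by (simp add: d_def)
  have s: "s > 0" using d N by (simp add: s_def)
  have near: "dist (v + t *\<^sub>R a + r *\<^sub>R b) v < d" if "0 \<le> t" "t \<le> s" "0 \<le> r" "r \<le> s" for t r
  proof -
    have "dist (v + t *\<^sub>R a + r *\<^sub>R b) v \<le> norm (t *\<^sub>R a) + norm (r *\<^sub>R b)"
      using norm_triangle_ineq[of "t *\<^sub>R a" "r *\<^sub>R b"] by (simp add: dist_norm)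
    also have "\<dots> \<le> s * norm a + s * norm b" using that by (auto intro!: add_mono mult_right_mono)
    also have "\<dots> < s * (norm a + norm b + 1)" using s by (simp add: algebra_simps)
    also have "\<dots> = d" using N by (simp add: s_def)
    finally show ?thesis .
  qed
  have inV: "v + t *\<^sub>R a + r *\<^sub>R b \<in> V" if "0 \<le> t" "t \<le> s" "0 \<le> r" "r \<le> s" for t r
    using near[OF that] d3 by (auto simp: d_def dist_commute)
  obtain t r where tr: "0 \<le> t" "t \<le> s" "0 \<le> r" "r \<le> s" and
    1: "f (v + s *\<^sub>R a + s *\<^sub>R b) - f (v + s *\<^sub>R a) - f (v + s *\<^sub>R b) + f v = s\<^sup>2 * fab (v + t *\<^sub>R a + r *\<^sub>R b)"
    by (rule mixed_derivative_eq_second_difference[OF s, of v a b V f fa fab]) (use inV fa fab in blast)+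
  have inV': "v + t *\<^sub>R b + r *\<^sub>R a \<in> V" if "0 \<le> t" "t \<le> s" "0 \<le> r" "r \<le> s" for t r
    using inV[of r t] that by (simp add: algebra_simps)
  obtain t' r' where tr': "0 \<le> t'" "t' \<le> s" "0 \<le> r'" "r' \<le> s" and
    2: "f (v + s *\<^sub>R b + s *\<^sub>R a) - f (v + s *\<^sub>R b) - f (v + s *\<^sub>R a) + f v = s\<^sup>2 * fba (v + t' *\<^sub>R b + r' *\<^sub>R a)"
    by (rule mixed_derivative_eq_second_difference[OF s, of v b a V f fb fba]) (use inV' fb fba in blast)+
  have "s\<^sup>2 * fab (v + t *\<^sub>R a + r *\<^sub>R b) = s\<^sup>2 * fba (v + r' *\<^sub>R a + t' *\<^sub>R b)"
    using 1 2 by (simp add: algebra_simps)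
  then have "fab (v + t *\<^sub>R a + r *\<^sub>R b) = fba (v + r' *\<^sub>R a + t' *\<^sub>R b)" using s by simp
  moreover have "\<bar>fab (v + t *\<^sub>R a + r *\<^sub>R b) - fab v\<bar> < \<epsilon>" using near[OF tr] d1(2) by (simp add: d_def)
  moreover have "\<bar>fba (v + r' *\<^sub>R a + t' *\<^sub>R b) - fba v\<bar> < \<epsilon>"
    using near[OF tr'(3,4,1,2)] d2(2) by (simp add: d_def)
  ultimately show False unfolding \<epsilon>_def by (simp add: abs_if split: if_splits)
qed

lemma partial_deriv_line:
  assumes "f differentiable (at x)"
  shows "((\<lambda>t. f (x + t *\<^sub>R axis i 1)) has_vector_derivative partial_deriv i f x) (at 0)"
proof -
  have f: "(f has_derivative frechet_derivative f (at x)) (at x)"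
    using assms by (simp add: frechet_derivative_works)
  have "((\<lambda>t. x + t *\<^sub>R axis i 1) has_vector_derivative axis i 1) (at (0::real))"
    by (auto intro!: derivative_eq_intros)
  from vector_derivative_diff_chain_within[OF this, of f "frechet_derivative f (at x)"] f
  show ?thesis by (simp add: o_def partial_deriv_def has_derivative_at_withinI)
qed

lemma partial_derivs_commute:
  fixes f :: "real ^ 'n::finite \<Rightarrow> 'b::euclidean_space"
  assumes "open V" "v \<in> V" "Ck_on 2 V f"
  shows "partial_deriv i (partial_deriv j f) v = partial_deriv j (partial_deriv i f) v"
proof (rule euclidean_eqI)
  fix c :: 'b assume "c \<in> Basis"
  have C: "x \<in> V \<Longrightarrow> f differentiable (at x)" "x \<in> V \<Longrightarrow> partial_deriv i f differentiable (at x)"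
    "continuous_on V (partial_deriv i (partial_deriv j f))" for x i j
    using assms(3) by (auto simp: numeral_2_eq_2)
  have line: "((\<lambda>t. g (x + t *\<^sub>R axis i 1) \<bullet> c) has_real_derivative partial_deriv i g x \<bullet> c) (at 0)"
    if "g differentiable (at x)" for g :: "real ^ 'n \<Rightarrow> 'b" and x i
    using bounded_linear.has_vector_derivative[OF bounded_linear_inner_left[of c] partial_deriv_line[OF that]]
    by (simp add: has_real_derivative_iff_has_vector_derivative)
  have cont: "isCont (\<lambda>x. partial_deriv i (partial_deriv j f) x \<bullet> c) v" for i j
    using C(3)[of i j] assms(1,2) by (auto simp: continuous_on_eq_continuous_at intro!: continuous_intros)
  show "partial_deriv i (partial_deriv j f) v \<bullet> c = partial_deriv j (partial_deriv i f) v \<bullet> c"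
    using mixed_derivatives_commute_real[OF assms(1,2), where f = "\<lambda>x. f x \<bullet> c"
        and fa = "\<lambda>x. partial_deriv j f x \<bullet> c" and a = "axis j 1"
        and fb = "\<lambda>x. partial_deriv i f x \<bullet> c" and b = "axis i 1"
        and fab = "\<lambda>x. partial_deriv i (partial_deriv j f) x \<bullet> c"
        and fba = "\<lambda>x. partial_deriv j (partial_deriv i f) x \<bullet> c"]
      line C(1,2) cont by blast
qed

section \<open>The strong minimum principle\<close>

text \<open>A negative \<open>s\<close> would make \<open>p'\<close> negative just to the right of
  0, and the mean value theorem would push \<open>p\<close> below \<open>p 0\<close>.\<close>

lemma derivs_at_local_min:
  fixes p p' :: "real \<Rightarrow> real"
  assumes "\<eta> > 0" and p: "\<And>t. \<bar>t\<bar> < \<eta> \<Longrightarrow> (p has_real_derivative p' t) (at t)"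
    and p2: "(p' has_real_derivative s) (at 0)"
    and min: "\<And>t. \<bar>t\<bar> < \<eta> \<Longrightarrow> p 0 \<le> p t"
  shows "p' 0 = 0" "s \<ge> 0"
proof -
  show 0: "p' 0 = 0" using DERIV_local_min[OF p[of 0] \<open>\<eta> > 0\<close>] min \<open>\<eta> > 0\<close> by auto
  show "s \<ge> 0"
  proof (rule ccontr)
    assume "\<not> s \<ge> 0"
    then obtain d where d: "d > 0" "\<And>h. 0 < h \<Longrightarrow> h < d \<Longrightarrow> p' (0 + h) < p' 0"
      using DERIV_neg_dec_right[OF p2] by auto
    define t where "t = min d \<eta> / 2"
    have t: "t > 0" "t < d" "t < \<eta>" using d \<open>\<eta> > 0\<close> by (auto simp: t_def)
    obtain z where z: "0 < z" "z < t" "p t - p 0 = (t - 0) * p' z"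
      using MVT2[OF t(1), of p p'] p t by auto
    have "p' z < 0" using d(2)[of z] z t 0 by simp
    then have "t * p' z < 0" using t by (simp add: mult_pos_neg)
    then have "p t < p 0" using z(3) by simp
    then show False using min[of t] t by simp
  qed
qed

text \<open>Hopf's strong minimum principle: near a boundary point of the set where \<open>f\<close> exceeds
  its minimum, \<open>f\<close> is compared with the function \<open>exp (- \<alpha> (dist x y0)\<^sup>2)\<close> centred in an interior ball.\<close>

lemma strong_minimum_principle:
  fixes f :: "'a::euclidean_space \<Rightarrow> real" and Df D2f :: "'a \<Rightarrow> 'a \<Rightarrow> real"
  assumes "open V" "v \<in> V"
    and Df: "\<And>x. x \<in> V \<Longrightarrow> (f has_derivative Df x) (at x)"
    and D2f: "\<And>x e. x \<in> V \<Longrightarrow> ((\<lambda>t. Df (x + t *\<^sub>R e) e) has_real_derivative D2f x e) (at 0)"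
    and ell: "\<And>K. compact K \<Longrightarrow> K \<subseteq> V \<Longrightarrow> \<exists>c>0. \<exists>C. \<forall>x\<in>K. \<exists>(e :: 'i::finite \<Rightarrow> 'a) b.
        (\<Sum>i\<in>UNIV. (norm (e i))\<^sup>2) \<le> C \<and> norm b \<le> C \<and>
        (\<forall>w. c * (norm w)\<^sup>2 \<le> (\<Sum>i\<in>UNIV. (w \<bullet> e i)\<^sup>2)) \<and> (\<Sum>i\<in>UNIV. D2f x (e i)) \<le> Df x b"
    and min: "\<And>x. x \<in> V \<Longrightarrow> f v \<le> f x"
  shows "\<exists>\<epsilon>>0. ball v \<epsilon> \<subseteq> V \<and> (\<forall>x\<in>ball v \<epsilon>. f x = f v)"
proof -
  obtain R where R: "R > 0" "cball v R \<subseteq> V" using assms(1,2) open_contains_cball by blast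
  have contf: "continuous_on S f" if "S \<subseteq> V" for S
    using Df that by (intro has_derivative_continuous_on[where f' = Df]) (auto intro: has_derivative_at_withinI)
  \<comment> \<open>The third of \<open>R\<close> leaves room: the point \<open>w\<close> of
    \<open>S\<close> nearest to \<open>y\<close> is less than \<open>R / 3\<close> away from
    \<open>y\<close>, so the ball about \<open>y\<close> through \<open>w\<close> and a small ball
    about \<open>w\<close> stay inside \<open>cball v R\<close>.\<close>
  have key: False if y: "y \<in> ball v (R / 3)" "f y \<noteq> f v" for y
  proof -
    define S where "S = {x \<in> cball v R. f x = f v}"
    have "closed S" unfolding S_def using contf[OF R(2)]
      by (intro continuous_closed_preimage_constant) auto
    moreover have "v \<in> S" using R by (simp add: S_def)
    ultimately obtain w where w: "w \<in> S" "\<And>x. x \<in> S \<Longrightarrow> dist y w \<le> dist y x"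
      using distance_attains_inf[of S y] by auto
    define d where "d = dist y w"
    have "y \<noteq> w" using y w by (auto simp: S_def)
    then have d: "d > 0" by (simp add: d_def)
    have dR: "d < R / 3" using w(2)[OF \<open>v \<in> S\<close>] y by (simp add: d_def dist_commute)
    have wv: "dist v w < 2 * R / 3" using dist_triangle[of v w y] y dR by (simp add: d_def dist_commute)
    have inside: "f x > f v" if "dist x y < d" for x
    proof -
      have "dist v x < R" using dist_triangle[of v x y] y dR that R by (simp add: dist_commute)
      then have "x \<in> cball v R" by simp
      moreover from this have "f x \<ge> f v" using R min by blast
      moreover have "x \<notin> S" using w(2)[of x] that by (auto simp: d_def dist_commute)
      ultimately show ?thesis by (auto simp: S_def)
    qed
    \<comment> \<open>The ball of radius \<open>d / 2\<close> about the midpoint touches the sphere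
      of radius \<open>d\<close> about \<open>y\<close> at \<open>w\<close> alone. The parallelogram
      identity \<open>par\<close> shows this: a point of it other than \<open>w\<close> is closer to
      \<open>y\<close> than \<open>d\<close>.\<close>
    define y0 where "y0 = (1/2) *\<^sub>R (y + w)"
    have par: "(norm (x - y))\<^sup>2 + (norm (x - w))\<^sup>2 = 2 * (norm (x - y0))\<^sup>2 + d\<^sup>2 / 2" for x
      by (simp add: y0_def d_def dist_norm power2_norm_eq_inner inner_diff_left inner_diff_right
          inner_add_left inner_add_right inner_commute field_simps)
    have wy0: "norm (w - y0) = d / 2"
    proof -
      have "w - y0 = (1/2) *\<^sub>R (w - y)" by (simp add: y0_def algebra_simps scaleR_2 flip: scaleR_add_left)
      then show ?thesis by (simp add: d_def dist_norm norm_minus_commute)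
    qed
    \<comment> \<open>Radius \<open>d / 4\<close> keeps \<open>K\<close> at distance at least
      \<open>d / 4\<close> from \<open>y0\<close>, where the gradient of the comparison function
      would vanish.\<close>
    define K where "K = cball w (d / 4)"
    have "K \<subseteq> cball v R"
    proof
      fix x assume "x \<in> K"
      then show "x \<in> cball v R" using dist_triangle[of v x w] wv dR R by (simp add: K_def)
    qed
    then have KV: "K \<subseteq> V" using R by blast
    have Ky0: "norm (x - y0) \<ge> d / 4" "norm (x - y0) \<le> d" if "x \<in> K" for x
    proof -
      have "norm (x - w) \<le> d / 4" using that by (simp add: K_def dist_norm norm_minus_commute)
      then show "norm (x - y0) \<ge> d / 4" "norm (x - y0) \<le> d"
        using norm_triangle_ineq2[of "w - y0" "w - x"] norm_triangle_ineq[of "x - w" "w - y0"] wy0 d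
        by (auto simp: norm_minus_commute)
    qed
    obtain c C where c: "c > 0" and ellK: "\<And>x. x \<in> K \<Longrightarrow> \<exists>(e :: 'i \<Rightarrow> 'a) b.
        (\<Sum>i\<in>UNIV. (norm (e i))\<^sup>2) \<le> C \<and> norm b \<le> C \<and>
        (\<forall>w. c * (norm w)\<^sup>2 \<le> (\<Sum>i\<in>UNIV. (w \<bullet> e i)\<^sup>2)) \<and> (\<Sum>i\<in>UNIV. D2f x (e i)) \<le> Df x b"
      using ell[OF _ KV] compact_cball[of w "d / 4"] unfolding K_def[symmetric] by blast
    have "w \<in> K" using d by (simp add: K_def)
    have "C \<ge> 0" using ellK[OF \<open>w \<in> K\<close>] by (meson norm_ge_zero order_trans)
    \<comment> \<open>Chosen for the inequality \<open>\<alpha>C\<close>: its left side bounds the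
      part of the traced Hessian quadratic in \<alpha> from below, its right side bounds the linear
      part and the first order term. The 1 in \<open>C + 1\<close> keeps it strict when
      \<open>C\<close> is 0.\<close>
    define \<alpha> where "\<alpha> = 8 * (C + 1) * (1 + d) / (c * d\<^sup>2)"
    have \<alpha>: "\<alpha> > 0" using \<open>C \<ge> 0\<close> c d by (simp add: \<alpha>_def)
    have \<alpha>C: "4 * \<alpha>\<^sup>2 * (c * (d / 4)\<^sup>2) > 2 * \<alpha> * C + 2 * \<alpha> * d * C"
    proof -
      have "\<alpha> * (c * d\<^sup>2) = 8 * (C + 1) * (1 + d)" using c d by (simp add: \<alpha>_def)
      then have "4 * \<alpha>\<^sup>2 * (c * (d / 4)\<^sup>2) = \<alpha> / 4 * (8 * (C + 1) * (1 + d))"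
        by (simp add: power2_eq_square)
      also have "\<dots> = 2 * \<alpha> * C * (1 + d) + 2 * \<alpha> * (1 + d)" by (simp add: algebra_simps)
      finally show ?thesis using \<alpha> d by (simp add: algebra_simps add_pos_pos)
    qed
    define E where "E x = exp (- \<alpha> * (norm (x - y0))\<^sup>2)" for x
    define h where "h x = E x - exp (- \<alpha> * (d / 2)\<^sup>2)" for x
    have hw: "h w = 0" by (simp add: h_def E_def wy0)
    have h1: "h x \<le> 1" for x
    proof -
      have "E x \<le> 1" using \<alpha> by (simp add: E_def)
      then show ?thesis using exp_gt_zero[of "- \<alpha> * (d / 2)\<^sup>2"] unfolding h_def by linarith
    qed
    have hneg: "h x < 0" if "norm (x - y0) > d / 2" for x
      using that \<alpha> d by (simp add: h_def E_def power_strict_mono)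
    \<comment> \<open>The part of the boundary of \<open>K\<close> on which the comparison function
      \<open>h\<close> may be nonnegative. There \<open>f\<close> exceeds \<open>f v\<close>, by
      compactness with a fixed gap.\<close>
    define Q where "Q = sphere w (d / 4) \<inter> cball y0 (d / 2)"
    have Qpos: "f x > f v" if "x \<in> Q" for x
    proof -
      have "norm (x - y0) \<le> d / 2" "norm (x - w) = d / 4"
        using that by (auto simp: Q_def dist_norm norm_minus_commute)
      moreover from this(1) have "(norm (x - y0))\<^sup>2 \<le> (d / 2)\<^sup>2" by (intro power_mono) auto
      ultimately have "(norm (x - y0))\<^sup>2 \<le> d\<^sup>2 / 4" "(norm (x - w))\<^sup>2 > 0"
        using d by (auto simp: power_divide)
      then have "(norm (x - y))\<^sup>2 < d\<^sup>2" using par[of x] by linarith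
      then have "norm (x - y) < d" using d by (simp add: power_less_imp_less_base)
      then show ?thesis by (intro inside) (simp add: dist_norm)
    qed
    have QK: "Q \<subseteq> K" by (auto simp: Q_def K_def)
    have "\<exists>\<delta>>0. \<forall>x\<in>Q. f x - f v \<ge> \<delta>"
    proof (cases "Q = {}")
      case False
      have "compact Q" by (auto simp: Q_def intro: compact_Int_closed)
      then obtain q where "q \<in> Q" "\<And>x. x \<in> Q \<Longrightarrow> f q \<le> f x"
        using continuous_attains_inf[OF _ False contf] QK KV by blast
      then show ?thesis using Qpos[of q] by (intro exI[of _ "f q - f v"]) auto
    qed (auto intro: exI[of _ 1])
    then obtain \<delta> where \<delta>: "\<delta> > 0" "\<And>x. x \<in> Q \<Longrightarrow> f x - f v \<ge> \<delta>" by blast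
    \<comment> \<open>Since \<open>h\<close> is at most 1, half the gap keeps \<open>\<psi>\<close>
      above \<open>f v\<close> on \<open>Q\<close>; off \<open>Q\<close> the sign of
      \<open>h\<close> does so. As \<open>\<psi> w = f v\<close>, the minimum of
      \<open>\<psi>\<close> over \<open>K\<close> is attained in the interior.\<close>
    define \<epsilon> where "\<epsilon> = \<delta> / 2"
    have \<epsilon>: "\<epsilon> > 0" using \<delta> by (simp add: \<epsilon>_def)
    define \<psi> where "\<psi> x = f x - \<epsilon> * h x" for x
    have bd: "\<psi> x > f v" if x: "x \<in> sphere w (d / 4)" for x
    proof (cases "x \<in> Q")
      case True
      have "\<epsilon> * h x \<le> \<epsilon>" using h1[of x] \<epsilon> by simp
      moreover have "f x - f v \<ge> 2 * \<epsilon>" using \<delta>(2)[OF True] by (simp add: \<epsilon>_def)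
      ultimately show ?thesis using \<epsilon> unfolding \<psi>_def by linarith
    next
      case False
      then have "\<epsilon> * h x < 0" using x \<epsilon> by (intro mult_pos_neg hneg) (auto simp: Q_def dist_norm norm_minus_commute)
      moreover have "f x \<ge> f v" using min KV x by (auto simp: K_def)
      ultimately show ?thesis by (simp add: \<psi>_def)
    qed
    have "continuous_on K \<psi>" unfolding \<psi>_def h_def E_def
      by (intro continuous_intros contf KV)
    then obtain x where xK: "x \<in> K" and xmin: "\<And>z. z \<in> K \<Longrightarrow> \<psi> x \<le> \<psi> z"
      using continuous_attains_inf[of K \<psi>] \<open>w \<in> K\<close> by (auto simp: K_def)
    have "\<psi> x \<le> f v" using xmin[OF \<open>w \<in> K\<close>] hw w(1) by (simp add: \<psi>_def S_def)
    then have "x \<in> ball w (d / 4)" using bd[of x] xK by (force simp: K_def)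
    then obtain \<rho> where \<rho>: "\<rho> > 0" "ball x \<rho> \<subseteq> ball w (d / 4)"
      using openE[OF open_ball] by blast
    have dE: "((\<lambda>t. E (x + t *\<^sub>R e)) has_real_derivative - 2 * \<alpha> * ((x + t *\<^sub>R e - y0) \<bullet> e) * E (x + t *\<^sub>R e)) (at t)" for t e
    proof -
      have "((\<lambda>t. (norm (x - y0))\<^sup>2 + 2 * t * ((x - y0) \<bullet> e) + t\<^sup>2 * (e \<bullet> e)) has_real_derivative
          2 * ((x - y0) \<bullet> e) + 2 * t * (e \<bullet> e)) (at t)"
        by (auto intro!: derivative_eq_intros)
      moreover have "(norm (x + t *\<^sub>R e - y0))\<^sup>2 = (norm (x - y0))\<^sup>2 + 2 * t * ((x - y0) \<bullet> e) + t\<^sup>2 * (e \<bullet> e)" for t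
        by (simp only: power2_norm_eq_inner) (simp add: inner_add_left inner_add_right inner_diff_left
            inner_diff_right inner_commute power2_eq_square algebra_simps)
      moreover have "2 * ((x + t *\<^sub>R e - y0) \<bullet> e) = 2 * ((x - y0) \<bullet> e) + 2 * t * (e \<bullet> e)"
        by (simp add: inner_add_left inner_diff_left algebra_simps)
      ultimately have q: "((\<lambda>t. (norm (x + t *\<^sub>R e - y0))\<^sup>2) has_real_derivative 2 * ((x + t *\<^sub>R e - y0) \<bullet> e)) (at t)"
        by presburger
      show ?thesis using DERIV_fun_exp[OF DERIV_cmult[OF q, of "- \<alpha>"]]
        by (simp add: E_def algebra_simps)
    qed
    \<comment> \<open>The first and second order conditions at the interior minimum of
      \<open>\<psi>\<close>, taken along every line through \<open>x\<close>; the right sides are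
      the derivatives of \<open>\<epsilon> * E\<close>.\<close>
    have crit: "Df x e = - 2 * \<epsilon> * \<alpha> * ((x - y0) \<bullet> e) * E x"
      and hess: "D2f x e \<ge> \<epsilon> * E x * (4 * \<alpha>\<^sup>2 * ((x - y0) \<bullet> e)\<^sup>2 - 2 * \<alpha> * (norm e)\<^sup>2)" for e
    proof -
      define \<eta> where "\<eta> = \<rho> / (norm e + 1)"
      have ne: "norm e + 1 > 0" by (simp add: add_nonneg_pos)
      have \<eta>: "\<eta> > 0" using \<rho> ne by (simp add: \<eta>_def)
      have inK: "x + t *\<^sub>R e \<in> K" if "\<bar>t\<bar> < \<eta>" for t
      proof -
        have "\<bar>t\<bar> * norm e \<le> \<eta> * norm e" using that by (intro mult_right_mono) auto
        also have "\<dots> < \<eta> * (norm e + 1)" using \<eta> by simp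
        also have "\<dots> = \<rho>" using ne by (simp add: \<eta>_def)
        finally have "x + t *\<^sub>R e \<in> ball x \<rho>" by (simp add: dist_norm)
        then show ?thesis using \<rho> by (auto simp: K_def)
      qed
      define p' where "p' t = Df (x + t *\<^sub>R e) e + \<epsilon> * (2 * \<alpha> * ((x + t *\<^sub>R e - y0) \<bullet> e) * E (x + t *\<^sub>R e))" for t
      have 1: "((\<lambda>t. \<psi> (x + t *\<^sub>R e)) has_real_derivative p' t) (at t)" if "\<bar>t\<bar> < \<eta>" for t
      proof -
        have f: "(f has_derivative Df (x + t *\<^sub>R e)) (at (x + t *\<^sub>R e))"
          using inK[OF that] KV Df by blast
        have "((\<lambda>t. x + t *\<^sub>R e) has_vector_derivative e) (at t)"
          by (auto intro!: derivative_eq_intros)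
        from vector_derivative_diff_chain_within[OF this, of f] f
        have "((\<lambda>t. f (x + t *\<^sub>R e)) has_real_derivative Df (x + t *\<^sub>R e) e) (at t)"
          by (simp add: o_def has_real_derivative_iff_has_vector_derivative has_derivative_at_withinI)
        then show ?thesis unfolding \<psi>_def h_def p'_def
          by (auto intro!: derivative_eq_intros dE)
      qed
      have "((\<lambda>t. (x + t *\<^sub>R e - y0) \<bullet> e) has_real_derivative e \<bullet> e) (at 0)"
        by (simp add: inner_add_left inner_diff_left) (auto intro!: derivative_eq_intros)
      then have 2: "(p' has_real_derivative D2f x e +
          \<epsilon> * (2 * \<alpha> * ((e \<bullet> e) * E x + ((x - y0) \<bullet> e) * (- 2 * \<alpha> * ((x - y0) \<bullet> e) * E x)))) (at 0)"
        unfolding p'_def using D2f[of x e] xK KV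
        by (auto intro!: derivative_eq_intros dE[of e 0, simplified] simp: algebra_simps)
      have 3: "\<psi> (x + 0 *\<^sub>R e) \<le> \<psi> (x + t *\<^sub>R e)" if "\<bar>t\<bar> < \<eta>" for t
        using xmin[OF inK[OF that]] by simp
      note min = derivs_at_local_min[OF \<eta> 1 2 3]
      show "Df x e = - 2 * \<epsilon> * \<alpha> * ((x - y0) \<bullet> e) * E x" using min(1) by (simp add: p'_def algebra_simps)
      show "D2f x e \<ge> \<epsilon> * E x * (4 * \<alpha>\<^sup>2 * ((x - y0) \<bullet> e)\<^sup>2 - 2 * \<alpha> * (norm e)\<^sup>2)"
        using min(2) by (simp add: dot_square_norm power2_eq_square algebra_simps)
    qed
    obtain e :: "'i \<Rightarrow> 'a" and b where e: "(\<Sum>i\<in>UNIV. (norm (e i))\<^sup>2) \<le> C" "norm b \<le> C"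
        "\<And>w. c * (norm w)\<^sup>2 \<le> (\<Sum>i\<in>UNIV. (w \<bullet> e i)\<^sup>2)" "(\<Sum>i\<in>UNIV. D2f x (e i)) \<le> Df x b"
      using ellK[OF xK] by blast
    have Epos: "E x > 0" by (simp add: E_def)
    have low: "(\<Sum>i\<in>UNIV. ((x - y0) \<bullet> e i)\<^sup>2) \<ge> c * (d / 4)\<^sup>2"
    proof -
      have "c * (d / 4)\<^sup>2 \<le> c * (norm (x - y0))\<^sup>2" using c d Ky0[OF xK] by (intro mult_left_mono power_mono) auto
      then show ?thesis using e(3)[of "x - y0"] by linarith
    qed
    have "4 * \<alpha>\<^sup>2 * (c * (d / 4)\<^sup>2) \<le> 4 * \<alpha>\<^sup>2 * (\<Sum>i\<in>UNIV. ((x - y0) \<bullet> e i)\<^sup>2)"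
      using low by (intro mult_left_mono) auto
    moreover have "2 * \<alpha> * (\<Sum>i\<in>UNIV. (norm (e i))\<^sup>2) \<le> 2 * \<alpha> * C"
      using \<alpha> e(1) by (intro mult_left_mono) auto
    \<comment> \<open>The Hessian of \<open>\<epsilon> * E\<close> traced over the frame now exceeds
      any value that the first order term can take, while \<open>D2f\<close> traced over it is at
      most \<open>Df x b\<close>.\<close>
    ultimately have "2 * \<alpha> * d * C < 4 * \<alpha>\<^sup>2 * (\<Sum>i\<in>UNIV. ((x - y0) \<bullet> e i)\<^sup>2) - 2 * \<alpha> * (\<Sum>i\<in>UNIV. (norm (e i))\<^sup>2)"
      using \<alpha>C by linarith
    then have "\<epsilon> * E x * (2 * \<alpha> * d * C) < \<epsilon> * E x * (4 * \<alpha>\<^sup>2 * (\<Sum>i\<in>UNIV. ((x - y0) \<bullet> e i)\<^sup>2) - 2 * \<alpha> * (\<Sum>i\<in>UNIV. (norm (e i))\<^sup>2))"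
      using \<epsilon> Epos by (intro mult_strict_left_mono) auto
    also have "\<dots> = (\<Sum>i\<in>UNIV. \<epsilon> * E x * (4 * \<alpha>\<^sup>2 * ((x - y0) \<bullet> e i)\<^sup>2 - 2 * \<alpha> * (norm (e i))\<^sup>2))"
      by (simp add: sum_subtractf sum_distrib_left right_diff_distrib mult.assoc)
    also have "\<dots> \<le> (\<Sum>i\<in>UNIV. D2f x (e i))" by (intro sum_mono hess)
    also have "\<dots> \<le> Df x b" by (rule e(4))
    also have "\<dots> = \<epsilon> * E x * (2 * \<alpha> * (- ((x - y0) \<bullet> b)))" by (simp add: crit)
    also have "\<dots> \<le> \<epsilon> * E x * (2 * \<alpha> * (d * C))"
    proof -
      have "\<bar>(x - y0) \<bullet> b\<bar> \<le> norm (x - y0) * norm b" by (rule Cauchy_Schwarz_ineq2)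
      also have "\<dots> \<le> d * C" using Ky0[OF xK] e(2) d by (intro mult_mono) auto
      finally have "- ((x - y0) \<bullet> b) \<le> d * C" by linarith
      then show ?thesis using \<epsilon> Epos \<alpha> by (intro mult_left_mono) auto
    qed
    finally show False by (simp add: mult.assoc)
  qed
  show ?thesis
  proof (intro exI[of _ "R / 3"] conjI ballI)
    show "ball v (R / 3) \<subseteq> V" using R by (force simp: subset_eq)
    show "f x = f v" if "x \<in> ball v (R / 3)" for x using key[OF that] by blast
  qed (use R in simp)
qed

section \<open>Geometry of spacelike hypersurfaces\<close>

lemma mink_commute: "mink Y Z = mink Z Y"
  by (simp add: mink_def inner_commute mult.commute)

lemma bounded_bilinear_mink: "bounded_bilinear mink"
proof -
  have "bilinear (mink :: 'n::finite minkowski \<Rightarrow> _)"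
    unfolding bilinear_def mink_def
    by (auto intro!: linearI simp: inner_add_left inner_add_right algebra_simps)
  then show ?thesis by (simp add: bilinear_conv_bounded_bilinear)
qed

interpretation mink: bounded_bilinear mink
  by (rule bounded_bilinear_mink)

lemma abs_mink_le: "\<bar>mink Y Z\<bar> \<le> norm Y * norm Z"
proof -
  have "mink Y Z = Y \<bullet> (fst Z, - snd Z)" by (simp add: mink_def inner_prod_def)
  moreover have "norm (fst Z, - snd Z) = norm Z" by (simp add: norm_prod_def)
  ultimately show ?thesis by (metis Cauchy_Schwarz_ineq2)
qed

lemma future_directed_iff: "future_directed Y \<longleftrightarrow> snd Y > 0"
  by (simp add: future_directed_def mink_def time_vec_def)

text \<open>The coefficients of a combination of the \<open>n + 1\<close> vectors can be read off
  with \<open>mink\<close>, so the coordinate map \<open>L\<close> is injective and, by dimension,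
  onto. The minus sign comes from \<open>mink N N = - 1\<close>.\<close>

lemma orthonormal_frame_expansion:
  fixes E :: "'n::finite \<Rightarrow> 'n minkowski"
  assumes E: "\<And>i j. mink (E i) (E j) = (if i = j then 1 else 0)"
    and N: "mink N N = - 1" "\<And>i. mink N (E i) = 0"
  shows "Z = (\<Sum>i\<in>UNIV. mink Z (E i) *\<^sub>R E i) - mink Z N *\<^sub>R N"
proof -
  define L :: "'n minkowski \<Rightarrow> 'n minkowski" where "L W = (\<Sum>i\<in>UNIV. (fst W $ i) *\<^sub>R E i) + snd W *\<^sub>R N" for W
  have lin: "linear L"
    by (auto intro!: linearI simp: L_def scaleR_add_left sum.distrib scaleR_right.sum scaleR_add_right)
  have LE: "mink (L W) (E j) = fst W $ j" for W j
    by (simp add: L_def mink.add_left mink.sum_left mink.scaleR_left E N if_distrib cong: if_cong)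
  have LN: "mink (L W) N = - snd W" for W
  proof -
    have "mink (E i) N = 0" for i using N(2)[of i] by (simp add: mink_commute)
    then show ?thesis using N(1) by (simp add: L_def mink.add_left mink.sum_left mink.scaleR_left)
  qed
  have "inj L"
  proof (rule injI)
    fix W W' assume eq: "L W = L W'"
    have "fst W $ j = fst W' $ j" for j using LE[of W j] LE[of W' j] eq by simp
    moreover have "snd W = snd W'" using LN[of W] LN[of W'] eq by simp
    ultimately show "W = W'" by (simp add: prod_eq_iff vec_eq_iff)
  qed
  then have "surj L" using lin linear_injective_imp_surjective by blast
  then obtain W where W: "Z = L W" by blast
  show ?thesis unfolding W LE LN by (simp add: L_def)
qed

text \<open>Existence is Gram-Schmidt applied to \<open>time_vec\<close>. By the frame expansion any
  other unit normal is a multiple whose factor has square 1, and the time direction excludes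
  -1.\<close>

lemma orthonormal_frame_normal:
  fixes E :: "'n::finite \<Rightarrow> 'n minkowski"
  assumes E: "\<And>i j. mink (E i) (E j) = (if i = j then 1 else 0)"
  shows "\<exists>!N. mink N N = - 1 \<and> future_directed N \<and> (\<forall>i. mink N (E i) = 0)"
proof -
  \<comment> \<open>This will be \<open>- mink N0 N0\<close>; the summand 1 is
    \<open>- mink time_vec time_vec\<close> and makes \<open>N0\<close> timelike.\<close>
  define q where "q = 1 + (\<Sum>i\<in>UNIV. (mink time_vec (E i))\<^sup>2)"
  have q: "q > 0" unfolding q_def by (intro add_pos_nonneg sum_nonneg) auto
  define N0 where "N0 = time_vec - (\<Sum>i\<in>UNIV. mink time_vec (E i) *\<^sub>R E i)"
  have N0E: "mink N0 (E i) = 0" for i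
    by (simp add: N0_def mink.diff_left mink.sum_left mink.scaleR_left E if_distrib cong: if_cong)
  have N0t: "mink N0 time_vec = - q"
    by (simp add: N0_def mink.diff_left mink.sum_left mink.scaleR_left q_def power2_eq_square mink_commute[of "E _" time_vec])
      (simp add: mink_def time_vec_def)
  have "mink N0 N0 = mink N0 time_vec - (\<Sum>i\<in>UNIV. mink time_vec (E i) * mink N0 (E i))"
    by (subst (2) N0_def) (simp add: mink.diff_right mink.sum_right mink.scaleR_right)
  then have N0: "mink N0 N0 = - q" by (simp add: N0E N0t)
  let ?N = "(1 / sqrt q) *\<^sub>R N0"
  have ex: "mink ?N ?N = - 1 \<and> future_directed ?N \<and> (\<forall>i. mink ?N (E i) = 0)"
    using q by (simp add: mink.scaleR_left mink.scaleR_right N0 N0E N0t future_directed_def)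
  show ?thesis
  proof (rule ex1I, rule ex)
    fix N assume N: "mink N N = - 1 \<and> future_directed N \<and> (\<forall>i. mink N (E i) = 0)"
    define c where "c = - mink N ?N"
    have Nc: "N = c *\<^sub>R ?N"
      using orthonormal_frame_expansion[OF E, of ?N N] ex N by (simp add: c_def)
    have "mink N N = c\<^sup>2 * mink ?N ?N"
      by (subst (1 2) Nc) (simp only: mink.scaleR_left mink.scaleR_right power2_eq_square real_scaleR_def mult.assoc mult.left_commute)
    then have "c\<^sup>2 = 1" using N ex by simp
    moreover have "snd N = c * snd ?N" by (subst Nc) simp
    then have "c > 0" using N ex zero_less_mult_pos2[of c "snd ?N"] unfolding future_directed_iff by presburger
    ultimately have "c = 1" by (simp add: power2_eq_1_iff)
    then show "N = ?N" using Nc by simp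
  qed
qed

section \<open>Derivatives, normal and Laplacian of a parametrized piece\<close>

text \<open>The differential, spelled out in partial derivatives so that linearity in
  \<open>w\<close> needs no differentiability and continuity in \<open>v\<close> is inherited from
  the partial derivatives.\<close>

definition tangent_map :: "(real ^ 'n::finite \<Rightarrow> 'b::real_normed_vector) \<Rightarrow> real ^ 'n \<Rightarrow> real ^ 'n \<Rightarrow> 'b" where
  "tangent_map Y v w = (\<Sum>i\<in>UNIV. (w $ i) *\<^sub>R partial_deriv i Y v)"

text \<open>For smooth \<open>Y\<close>, the second derivative along the straight line through
  \<open>v\<close> in direction \<open>w\<close>: the flat Hessian of the parameter space, without
  Christoffel symbols.\<close>

definition second_deriv :: "(real ^ 'n::finite \<Rightarrow> 'b::real_normed_vector) \<Rightarrow> real ^ 'n \<Rightarrow> real ^ 'n \<Rightarrow> 'b" where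
  "second_deriv Y v w = (\<Sum>j\<in>UNIV. (w $ j) *\<^sub>R tangent_map (partial_deriv j Y) v w)"

lemma linear_tangent_map: "linear (tangent_map Y v)"
  by (auto intro!: linearI simp: tangent_map_def scaleR_add_left sum.distrib scaleR_right.sum)

lemma frechet_derivative_eq_tangent_map:
  fixes Y :: "real ^ 'n::finite \<Rightarrow> 'b::real_normed_vector"
  assumes "Y differentiable (at v)"
  shows "frechet_derivative Y (at v) = tangent_map Y v"
proof
  fix w :: "real ^ 'n"
  have lin: "linear (frechet_derivative Y (at v))" using assms by (rule linear_frechet_derivative)
  have "w = (\<Sum>i\<in>UNIV. (w $ i) *\<^sub>R axis i 1)"
    using basis_expansion[of w] by (simp add: scalar_mult_eq_scaleR)
  then have "frechet_derivative Y (at v) w = frechet_derivative Y (at v) (\<Sum>i\<in>UNIV. (w $ i) *\<^sub>R axis i 1)"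
    by simp
  also have "\<dots> = tangent_map Y v w"
    by (simp add: linear_sum[OF lin] linear_cmul[OF lin] tangent_map_def partial_deriv_def)
  finally show "frechet_derivative Y (at v) w = tangent_map Y v w" .
qed

lemma has_derivative_tangent_map:
  assumes "Y differentiable (at v)"
  shows "(Y has_derivative tangent_map Y v) (at v)"
  using assms unfolding frechet_derivative_works frechet_derivative_eq_tangent_map[OF assms] .

lemma has_vector_derivative_line:
  assumes "Y differentiable (at v)"
  shows "((\<lambda>t. Y (v + t *\<^sub>R w)) has_vector_derivative tangent_map Y v w) (at 0)"
proof -
  have "((\<lambda>t. v + t *\<^sub>R w) has_vector_derivative w) (at (0::real))"
    by (auto intro!: derivative_eq_intros)
  from vector_derivative_diff_chain_within[OF this, of Y "tangent_map Y v"]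
  show ?thesis using has_derivative_tangent_map[OF assms] by (simp add: o_def has_derivative_at_withinI)
qed

lemma first_form_quadratic:
  "w \<bullet> (first_form Y v *v w') = mink (tangent_map Y v w) (tangent_map Y v w')"
  by (simp add: tangent_map_def mink.sum_left mink.sum_right mink.scaleR_left mink.scaleR_right
      inner_vec_def matrix_vector_mult_def first_form_def sum_distrib_left algebra_simps)
    (rule sum.swap)

lemma second_form_quadratic:
  "w \<bullet> (second_form Y v *v w) = - mink (second_deriv Y v w) (unit_normal Y v)"
proof -
  have "w \<bullet> (second_form Y v *v w) = (\<Sum>i\<in>UNIV. \<Sum>j\<in>UNIV. - (w $ i * w $ j * mink (partial_deriv i (partial_deriv j Y) v) (unit_normal Y v)))"
    by (simp add: inner_vec_def matrix_vector_mult_def second_form_def sum_distrib_left algebra_simps)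
  also have "\<dots> = (\<Sum>j\<in>UNIV. \<Sum>i\<in>UNIV. - (w $ i * w $ j * mink (partial_deriv i (partial_deriv j Y) v) (unit_normal Y v)))"
    by (rule sum.swap)
  also have "\<dots> = - mink (second_deriv Y v w) (unit_normal Y v)"
    by (simp add: second_deriv_def tangent_map_def mink.sum_left mink.scaleR_left sum_distrib_left sum_negf algebra_simps)
  finally show ?thesis .
qed

text \<open>\<open>unit_normal\<close> is a description in terms of coordinate vectors. The frame
  spans the same tangent space, so unique existence carries over from orthonormal frames.\<close>

lemma unit_normal_properties:
  fixes e :: "'n::finite \<Rightarrow> real ^ 'n"
  assumes e: "inj e" "independent (range e)"
    and on: "\<And>i j. mink (tangent_map Y v (e i)) (tangent_map Y v (e j)) = (if i = j then 1 else 0)"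
  shows "mink (unit_normal Y v) (unit_normal Y v) = - 1" "future_directed (unit_normal Y v)"
    "mink (unit_normal Y v) (tangent_map Y v w) = 0"
proof -
  have span: "w \<in> span (range e)" for w
    using card_ge_dim_independent[of "range e" UNIV] e by (auto simp: card_image)
  have iff: "(\<forall>i. mink N (partial_deriv i Y v) = 0) \<longleftrightarrow> (\<forall>i. mink N (tangent_map Y v (e i)) = 0)" for N
  proof
    assume *: "\<forall>i. mink N (tangent_map Y v (e i)) = 0"
    have "mink N (tangent_map Y v w) = 0" for w
      using span[of w]
    proof (induction rule: span_induct_alt)
      case base
      then show ?case by (simp add: linear_0[OF linear_tangent_map] mink.zero_right)
    next
      case (step c x y)
      then show ?case using *
        by (auto simp: linear_add[OF linear_tangent_map] linear_cmul[OF linear_tangent_map] mink.add_right mink.scaleR_right)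
    qed
    moreover have "tangent_map Y v (axis i 1) = partial_deriv i Y v" for i
      by (simp add: tangent_map_def axis_def if_distrib[of "\<lambda>x. x *\<^sub>R _"] cong: if_cong)
    ultimately show "\<forall>i. mink N (partial_deriv i Y v) = 0" by metis
  qed (simp add: tangent_map_def mink.sum_right mink.scaleR_right)
  have "\<exists>!N. mink N N = - 1 \<and> future_directed N \<and> (\<forall>i. mink N (partial_deriv i Y v) = 0)"
    unfolding iff by (rule orthonormal_frame_normal[OF on])
  from theI'[OF this] have N: "mink (unit_normal Y v) (unit_normal Y v) = - 1 \<and> future_directed (unit_normal Y v) \<and>
     (\<forall>i. mink (unit_normal Y v) (partial_deriv i Y v) = 0)"
    unfolding unit_normal_def .
  then show "mink (unit_normal Y v) (unit_normal Y v) = - 1" "future_directed (unit_normal Y v)"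
    "mink (unit_normal Y v) (tangent_map Y v w) = 0"
    by (auto simp: tangent_map_def mink.sum_right mink.scaleR_right)
qed

text \<open>An upper bound on the metric is a lower bound on its inverse, which is the ellipticity
  constant. If \<open>u i\<close> are the coordinates of \<open>w\<close> in the frame,
  Cauchy-Schwarz for \<open>u i\<close> and \<open>w \<bullet> e i\<close> bounds the fourth power
  of the norm, since the squares of the \<open>u i\<close> add up to
  \<open>w \<bullet> (G *v w)\<close>.\<close>

lemma orthonormal_frame_lower_bound:
  fixes G :: "real ^ 'n ^ 'n::finite" and e :: "'n \<Rightarrow> real ^ 'n"
  assumes e: "inj e" "independent (range e)"
    and on: "\<And>i j. e i \<bullet> (G *v e j) = (if i = j then 1 else 0)"
    and up: "w \<bullet> (G *v w) \<le> \<Lambda> * (norm w)\<^sup>2"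
  shows "(norm w)\<^sup>2 \<le> \<Lambda> * (\<Sum>i\<in>UNIV. (w \<bullet> e i)\<^sup>2)"
proof (cases "w = 0")
  case False
  have "w \<in> span (range e)"
    using card_ge_dim_independent[of "range e" UNIV] e by (auto simp: card_image)
  then obtain u' where "w = (\<Sum>b\<in>range e. u' b *\<^sub>R b)" by (auto simp: span_finite)
  then obtain u where w: "w = (\<Sum>i\<in>UNIV. u i *\<^sub>R e i)" using e(1) by (auto simp: sum.reindex)
  define U :: "real ^ 'n" where "U = (\<chi> i. u i)"
  define S :: "real ^ 'n" where "S = (\<chi> i. w \<bullet> e i)"
  have "U \<bullet> S = (\<Sum>i\<in>UNIV. u i * (w \<bullet> e i))" unfolding inner_vec_def[of U S] by (simp add: U_def S_def)
  also have "\<dots> = w \<bullet> (\<Sum>i\<in>UNIV. u i *\<^sub>R e i)" by (simp add: inner_sum_right)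
  finally have US: "U \<bullet> S = (norm w)\<^sup>2" by (simp only: w[symmetric] power2_norm_eq_inner)
  have "e i \<bullet> (G *v w) = u i" for i
  proof -
    have "e i \<bullet> (G *v w) = (\<Sum>j\<in>UNIV. u j * (e i \<bullet> (G *v e j)))"
      by (subst w) (simp add: linear_sum[OF matrix_vector_mul_linear] matrix_vector_mult_scaleR inner_sum_right)
    then show ?thesis by (simp add: on if_distrib cong: if_cong)
  qed
  then have "U \<bullet> U = (\<Sum>i\<in>UNIV. u i * (e i \<bullet> (G *v w)))" unfolding inner_vec_def[of U U] by (simp add: U_def)
  also have "\<dots> = (\<Sum>i\<in>UNIV. u i *\<^sub>R e i) \<bullet> (G *v w)" by (simp add: inner_sum_left)
  finally have UU: "U \<bullet> U = w \<bullet> (G *v w)" by (simp only: w[symmetric])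
  have SS: "S \<bullet> S = (\<Sum>i\<in>UNIV. (w \<bullet> e i)\<^sup>2)"
    unfolding inner_vec_def[of S S] by (simp add: S_def power2_eq_square)
  have "((norm w)\<^sup>2)\<^sup>2 \<le> (w \<bullet> (G *v w)) * (S \<bullet> S)"
    using Cauchy_Schwarz_ineq[of U S] by (simp add: US UU)
  also have "\<dots> \<le> \<Lambda> * (norm w)\<^sup>2 * (S \<bullet> S)" using up by (intro mult_right_mono) auto
  finally have "(norm w)\<^sup>2 * (norm w)\<^sup>2 \<le> (norm w)\<^sup>2 * (\<Lambda> * (S \<bullet> S))"
    unfolding power2_eq_square[of "(norm w)\<^sup>2"] by (simp only: mult_ac)
  moreover have "(norm w)\<^sup>2 > 0" using False by simp
  ultimately show ?thesis unfolding SS by (rule mult_left_le_imp_le)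
qed (simp add: sum_nonneg)

text \<open>With respect to an orthonormal frame of principal directions the Laplacian of
  \<open>mink Y Y / 2\<close> is \<open>n - u * \<Sum>\<kappa>\<^sub>i\<close>, up to first order terms, where \<open>u = - mink Y \<nu> = 1 / F\<close>;
  it is nonpositive because \<open>F\<close> is at most the mean of the \<open>\<kappa>\<^sub>i\<close>.\<close>

lemma laplacian_half_norm_le:
  fixes Y :: "real ^ 'n::finite \<Rightarrow> 'n minkowski"
  assumes k: "1 \<le> k" "k \<le> CARD('n)"
    and pos: "\<And>w. w \<noteq> 0 \<Longrightarrow> w \<bullet> (first_form Y v *v w) > 0"
    and sym: "\<And>i j. partial_deriv i (partial_deriv j Y) v = partial_deriv j (partial_deriv i Y) v"
    and conv: "principal_curvatures Y v \<in> Gamma_cone k"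
    and shr: "F_curv k (principal_curvatures Y v) = - 1 / mink (Y v) (unit_normal Y v)"
  obtains e :: "'n \<Rightarrow> real ^ 'n" where "inj e" "independent (range e)"
    "\<And>i j. e i \<bullet> (first_form Y v *v e j) = (if i = j then 1 else 0)"
    "(\<Sum>i\<in>UNIV. mink (tangent_map Y v (e i)) (tangent_map Y v (e i)) + mink (Y v) (second_deriv Y v (e i)))
      \<le> mink (Y v) (tangent_map Y v (\<Sum>i\<in>UNIV. \<Sum>j\<in>UNIV. mink (second_deriv Y v (e i)) (tangent_map Y v (e j)) *\<^sub>R e j))"
proof -
  let ?T = "tangent_map Y v" and ?A = "second_deriv Y v" and ?N = "unit_normal Y v"
  have "transpose (first_form Y v) = first_form Y v" "transpose (second_form Y v) = second_form Y v"
    by (simp_all add: transpose_def first_form_def second_form_def vec_eq_iff mink_commute sym)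
  from orthonormal_eigenframe[OF this pos]
  obtain e :: "'n \<Rightarrow> real ^ 'n" and \<kappa> :: "real ^ 'n" where e: "inj e" "independent (range e)"
    and on: "\<And>i j. e i \<bullet> (first_form Y v *v e j) = (if i = j then 1 else 0)"
    and eig: "\<And>i. second_form Y v *v e i = (\<kappa> $ i) *\<^sub>R (first_form Y v *v e i)" by blast
  have onT: "mink (?T (e i)) (?T (e j)) = (if i = j then 1 else 0)" for i j
    using on[of i j] by (simp add: first_form_quadratic)
  note N = unit_normal_properties[OF e onT]
  have u: "mink (Y v) ?N < 0" "- mink (Y v) ?N * (\<Sum>i\<in>UNIV. \<kappa> $ i) \<ge> CARD('n)"
  proof -
    \<comment> \<open>Since \<open>- 1 / 0 = 0\<close>, a positive \<open>F\<close> also excludes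
      the value 0 of \<open>mink (Y v) ?N\<close>.\<close>
    have F: "F_curv k (principal_curvatures Y v) > 0"
      using maclaurin_Gamma_cone(1)[OF k conv] k by (simp add: F_curv_def)
    then show neg: "mink (Y v) ?N < 0" by (simp add: shr zero_less_divide_iff)
    have "F_curv k (principal_curvatures Y v) \<le> (\<Sum>i\<in>UNIV. \<kappa> $ i) / CARD('n)"
      using maclaurin_Gamma_cone(2)[OF k conv] sum_principal_curvatures[OF pos e eig] by simp
    then have "- 1 / mink (Y v) ?N * CARD('n) \<le> (\<Sum>i\<in>UNIV. \<kappa> $ i)" by (simp add: shr field_simps)
    then have "- mink (Y v) ?N * (- 1 / mink (Y v) ?N * CARD('n)) \<le> - mink (Y v) ?N * (\<Sum>i\<in>UNIV. \<kappa> $ i)"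
      using neg by (intro mult_left_mono) auto
    then show "- mink (Y v) ?N * (\<Sum>i\<in>UNIV. \<kappa> $ i) \<ge> CARD('n)" using neg by simp
  qed
  \<comment> \<open>The frame expansion splits the flat second derivative: the tangential part, a
    Christoffel term, goes into the first order vector, and the normal part carries the second
    form.\<close>
  have YA: "mink (Y v) (?A w) = mink (Y v) (?T (\<Sum>j\<in>UNIV. mink (?A w) (?T (e j)) *\<^sub>R e j))
      + (w \<bullet> (second_form Y v *v w)) * mink (Y v) ?N" for w
  proof -
    have "?A w = (\<Sum>i\<in>UNIV. mink (?A w) (?T (e i)) *\<^sub>R ?T (e i)) - mink (?A w) ?N *\<^sub>R ?N"
      by (rule orthonormal_frame_expansion) (use onT N in auto)
    also have "(\<Sum>i\<in>UNIV. mink (?A w) (?T (e i)) *\<^sub>R ?T (e i)) = ?T (\<Sum>j\<in>UNIV. mink (?A w) (?T (e j)) *\<^sub>R e j)"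
      by (simp add: linear_sum[OF linear_tangent_map] linear_cmul[OF linear_tangent_map])
    finally have "mink (Y v) (?A w) = mink (Y v) (?T (\<Sum>j\<in>UNIV. mink (?A w) (?T (e j)) *\<^sub>R e j) - mink (?A w) ?N *\<^sub>R ?N)"
      by (rule arg_cong)
    then show ?thesis by (simp add: mink.diff_right mink.scaleR_right second_form_quadratic)
  qed
  have "e i \<bullet> (second_form Y v *v e i) = \<kappa> $ i" for i by (simp add: eig on)
  then have "(\<Sum>i\<in>UNIV. mink (?T (e i)) (?T (e i)) + mink (Y v) (?A (e i)))
      = CARD('n) + (\<Sum>i\<in>UNIV. mink (Y v) (?T (\<Sum>j\<in>UNIV. mink (?A (e i)) (?T (e j)) *\<^sub>R e j)))
        + (\<Sum>i\<in>UNIV. \<kappa> $ i) * mink (Y v) ?N"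
    by (simp add: YA onT sum.distrib sum_distrib_right)
  also have "\<dots> \<le> (\<Sum>i\<in>UNIV. mink (Y v) (?T (\<Sum>j\<in>UNIV. mink (?A (e i)) (?T (e j)) *\<^sub>R e j)))"
    using u by (simp add: mult.commute)
  also have "\<dots> = mink (Y v) (?T (\<Sum>i\<in>UNIV. \<Sum>j\<in>UNIV. mink (?A (e i)) (?T (e j)) *\<^sub>R e j))"
    by (simp add: linear_sum[OF linear_tangent_map] mink.sum_right)
  finally show ?thesis using that e on by blast
qed

lemma smooth_onD:
  assumes "smooth_on V Y"
  shows "\<And>x. x \<in> V \<Longrightarrow> Y differentiable (at x)" "\<And>x i. x \<in> V \<Longrightarrow> partial_deriv i Y differentiable (at x)"
    "continuous_on V Y" "\<And>i. continuous_on V (partial_deriv i Y)"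
    "\<And>i j. continuous_on V (partial_deriv i (partial_deriv j Y))" "Ck_on 2 V Y"
proof -
  have C: "Ck_on k V Y" for k using assms by (simp add: smooth_on_def)
  show "\<And>x. x \<in> V \<Longrightarrow> Y differentiable (at x)" "\<And>x i. x \<in> V \<Longrightarrow> partial_deriv i Y differentiable (at x)"
    "continuous_on V Y" "\<And>i. continuous_on V (partial_deriv i Y)"
    "\<And>i j. continuous_on V (partial_deriv i (partial_deriv j Y))" "Ck_on 2 V Y"
    using C[of 0] C[of 1] C[of 2] by (auto simp: numeral_2_eq_2)
qed

text \<open>Everything is compactness: the partial derivatives up to order two are bounded on
  \<open>K\<close>, and the metric attains a positive minimum on \<open>K\<close> times the unit
  sphere, extended to all \<open>w\<close> by homogeneity.\<close>

lemma elliptic_bounds: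
  fixes Y :: "real ^ 'n::finite \<Rightarrow> 'n minkowski"
  assumes Y: "smooth_on V Y" and K: "compact K" "K \<subseteq> V"
    and pos: "\<And>x w. x \<in> V \<Longrightarrow> w \<noteq> 0 \<Longrightarrow> w \<bullet> (first_form Y x *v w) > 0"
  obtains \<mu> C where "\<mu> > 0" "C \<ge> 0" "\<And>x w. x \<in> K \<Longrightarrow> w \<bullet> (first_form Y x *v w) \<ge> \<mu> * (norm w)\<^sup>2"
    "\<And>x w. x \<in> K \<Longrightarrow> norm (tangent_map Y x w) \<le> C * norm w"
    "\<And>x w. x \<in> K \<Longrightarrow> norm (second_deriv Y x w) \<le> C * (norm w)\<^sup>2"
proof (cases "K = {}")
  case False
  note C = smooth_onD[OF Y]
  have bd: "\<exists>B\<ge>0. \<forall>x\<in>K. norm (f x) \<le> B" if "continuous_on V f" for f :: "real ^ 'n \<Rightarrow> 'n minkowski"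
  proof -
    have "bounded (f ` K)"
      using compact_continuous_image[OF continuous_on_subset[OF that K(2)] K(1)] by (rule compact_imp_bounded)
    then obtain B where "\<forall>x\<in>K. norm (f x) \<le> B" by (auto simp: bounded_iff)
    then show ?thesis by (intro exI[of _ "max B 0"]) auto
  qed
  have "\<exists>P. \<forall>i. P i \<ge> 0 \<and> (\<forall>x\<in>K. norm (partial_deriv i Y x) \<le> P i)" using bd[OF C(4)] by metis
  then obtain P where P: "\<And>i. P i \<ge> 0" "\<And>i x. x \<in> K \<Longrightarrow> norm (partial_deriv i Y x) \<le> P i" by blast
  have "\<exists>Q. \<forall>i j. Q i j \<ge> 0 \<and> (\<forall>x\<in>K. norm (partial_deriv i (partial_deriv j Y) x) \<le> Q i j)"
    using bd[OF C(5)] by metis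
  then obtain Q where Q: "\<And>i j. Q i j \<ge> 0" "\<And>i j x. x \<in> K \<Longrightarrow> norm (partial_deriv i (partial_deriv j Y) x) \<le> Q i j" by blast
  define C1 where "C1 = (\<Sum>i\<in>UNIV. P i)"
  define C2 where "C2 = (\<Sum>j\<in>UNIV. \<Sum>i\<in>UNIV. Q i j)"
  have C12: "C1 \<ge> 0" "C2 \<ge> 0" using P Q by (auto simp: C1_def C2_def sum_nonneg)
  have tm: "norm (tangent_map f x w) \<le> (\<Sum>i\<in>UNIV. B i) * norm w"
    if "\<And>i. norm (partial_deriv i f x) \<le> B i" for f :: "real ^ 'n \<Rightarrow> 'n minkowski" and x w B
  proof -
    have "norm (tangent_map f x w) \<le> (\<Sum>i\<in>UNIV. \<bar>w $ i\<bar> * norm (partial_deriv i f x))"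
      unfolding tangent_map_def by (rule order_trans[OF norm_sum]) simp
    also have "\<dots> \<le> (\<Sum>i\<in>UNIV. norm w * B i)"
      using that by (intro sum_mono mult_mono) (auto simp: component_le_norm_cart)
    also have "\<dots> = norm w * (\<Sum>i\<in>UNIV. B i)" by (simp add: sum_distrib_left)
    finally show ?thesis by (simp only: mult.commute)
  qed
  have T: "norm (tangent_map Y x w) \<le> C1 * norm w" if "x \<in> K" for x w
    unfolding C1_def using P(2)[OF that] by (rule tm)
  have A: "norm (second_deriv Y x w) \<le> C2 * (norm w)\<^sup>2" if "x \<in> K" for x w
  proof -
    have "norm (second_deriv Y x w) \<le> (\<Sum>j\<in>UNIV. \<bar>w $ j\<bar> * norm (tangent_map (partial_deriv j Y) x w))"
      unfolding second_deriv_def by (rule order_trans[OF norm_sum]) simp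
    also have "\<dots> \<le> (\<Sum>j\<in>UNIV. norm w * ((\<Sum>i\<in>UNIV. Q i j) * norm w))"
      using Q(2)[OF that] by (intro sum_mono mult_mono tm) (auto simp: component_le_norm_cart)
    also have "\<dots> = C2 * (norm w)\<^sup>2"
      by (simp add: C2_def sum_distrib_left sum_distrib_right power2_eq_square algebra_simps)
    finally show ?thesis .
  qed
  have cont: "continuous_on (K \<times> sphere 0 1) (\<lambda>z. snd z \<bullet> (first_form Y (fst z) *v snd z))"
  proof -
    have "continuous_on (K \<times> sphere 0 1) (\<lambda>z. partial_deriv i Y (fst z))" for i
      by (rule continuous_on_compose2[OF C(4)[of i] continuous_on_fst[OF continuous_on_id]]) (use K in auto)
    then have "continuous_on (K \<times> sphere 0 1) (\<lambda>z. tangent_map Y (fst z) (snd z))"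
      unfolding tangent_map_def by (intro continuous_intros)
    then show ?thesis unfolding first_form_quadratic by (intro mink.continuous_on)
  qed
  have "compact (K \<times> sphere (0::real ^ 'n) 1)" using K(1) by (intro compact_Times) auto
  moreover have "K \<times> sphere (0::real ^ 'n) 1 \<noteq> {}" using False by auto
  ultimately obtain z where z: "z \<in> K \<times> sphere 0 1"
    and zmin: "\<And>y. y \<in> K \<times> sphere 0 1 \<Longrightarrow> snd z \<bullet> (first_form Y (fst z) *v snd z) \<le> snd y \<bullet> (first_form Y (fst y) *v snd y)"
    using continuous_attains_inf[OF _ _ cont] by blast
  define \<mu> where "\<mu> = snd z \<bullet> (first_form Y (fst z) *v snd z)"
  have "\<mu> > 0" unfolding \<mu>_def using z K by (intro pos) auto
  have low: "w \<bullet> (first_form Y x *v w) \<ge> \<mu> * (norm w)\<^sup>2" if "x \<in> K" for x w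
  proof (cases "w = 0")
    case w: False
    have "\<mu> \<le> ((1 / norm w) *\<^sub>R w) \<bullet> (first_form Y x *v ((1 / norm w) *\<^sub>R w))"
      unfolding \<mu>_def using zmin[of "(x, (1 / norm w) *\<^sub>R w)"] that w by auto
    also have "\<dots> = (w \<bullet> (first_form Y x *v w)) / (norm w)\<^sup>2"
      by (simp add: matrix_vector_mult_scaleR power2_eq_square)
    finally show ?thesis using w by (simp add: field_simps)
  qed simp
  show ?thesis
  proof (rule that[of \<mu> "max C1 C2"])
    show "norm (tangent_map Y x w) \<le> max C1 C2 * norm w" if "x \<in> K" for x w
      using T[OF that, of w] by (rule order_trans) (auto intro: mult_right_mono)
    show "norm (second_deriv Y x w) \<le> max C1 C2 * (norm w)\<^sup>2" if "x \<in> K" for x w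
      using A[OF that, of w] by (rule order_trans) (auto intro: mult_right_mono)
  qed (use \<open>\<mu> > 0\<close> C12 low in auto)
qed (auto intro: that[of 1 0])

text \<open>The minimum principle in a chart. Its frames are the orthonormal ones for the metric,
  whose Euclidean size is controlled by the lower bound \<mu> of the metric.\<close>

lemma half_norm_strong_minimum:
  fixes X :: "'m::topological_space \<Rightarrow> 'n::finite minkowski"
  assumes k: "1 \<le> k" "k \<le> CARD('n)"
    and "spacelike M X" "k_convex k M X" "self_shrinker k M X"
    and lp: "local_param M X V \<phi>" and "v \<in> V"
    and min: "\<And>x. x \<in> V \<Longrightarrow> mink (X (\<phi> v)) (X (\<phi> v)) \<le> mink (X (\<phi> x)) (X (\<phi> x))"
  shows "\<exists>\<epsilon>>0. ball v \<epsilon> \<subseteq> V \<and> (\<forall>x\<in>ball v \<epsilon>. mink (X (\<phi> x)) (X (\<phi> x)) = mink (X (\<phi> v)) (X (\<phi> v)))"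
proof -
  define Y where "Y = X \<circ> \<phi>"
  have V: "open V" and Y: "smooth_on V Y" using lp by (auto simp: local_param_def Y_def)
  note C = smooth_onD[OF Y]
  have pos: "w \<bullet> (first_form Y x *v w) > 0" if "x \<in> V" "w \<noteq> 0" for x w
    using assms(3) lp that by (auto simp: spacelike_def Y_def)
  have conv: "principal_curvatures Y x \<in> Gamma_cone k" if "x \<in> V" for x
    using assms(4) lp that by (auto simp: k_convex_def Y_def)
  have shr: "F_curv k (principal_curvatures Y x) = - 1 / mink (Y x) (unit_normal Y x)" if "x \<in> V" for x
    using assms(5) lp that by (auto simp: self_shrinker_def Y_def)
  define f where "f x = mink (Y x) (Y x) / 2" for x
  have "\<exists>\<epsilon>>0. ball v \<epsilon> \<subseteq> V \<and> (\<forall>x\<in>ball v \<epsilon>. f x = f v)"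
  proof (rule strong_minimum_principle[where Df = "\<lambda>x e. mink (Y x) (tangent_map Y x e)"
        and ?D2f = "\<lambda>x e. mink (tangent_map Y x e) (tangent_map Y x e) + mink (Y x) (second_deriv Y x e)"
        and 'i = 'n, OF V \<open>v \<in> V\<close>])
    show "(f has_derivative (\<lambda>e. mink (Y x) (tangent_map Y x e))) (at x)" if "x \<in> V" for x
    proof -
      have d: "(Y has_derivative tangent_map Y x) (at x)" using C(1)[OF that] by (rule has_derivative_tangent_map)
      show ?thesis unfolding f_def
        by (rule has_derivative_eq_rhs, rule derivative_intros, rule mink.FDERIV[OF d d]) (auto simp: mink_commute)
    qed
    show "((\<lambda>t. mink (Y (x + t *\<^sub>R e)) (tangent_map Y (x + t *\<^sub>R e) e)) has_real_derivative
        mink (tangent_map Y x e) (tangent_map Y x e) + mink (Y x) (second_deriv Y x e)) (at 0)" if "x \<in> V" for x e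
    proof -
      have 1: "((\<lambda>t. Y (x + t *\<^sub>R e)) has_vector_derivative tangent_map Y x e) (at 0)"
        using C(1)[OF that] by (rule has_vector_derivative_line)
      have 2: "((\<lambda>t. tangent_map Y (x + t *\<^sub>R e) e) has_vector_derivative second_deriv Y x e) (at 0)"
        unfolding tangent_map_def[of Y] second_deriv_def
        by (rule has_vector_derivative_sum)
          (rule bounded_linear.has_vector_derivative[OF bounded_linear_scaleR_right has_vector_derivative_line[OF C(2)[OF that]]])
      show ?thesis using mink.has_vector_derivative[OF 1 2]
        by (simp add: has_real_derivative_iff_has_vector_derivative add.commute)
    qed
    show "f v \<le> f x" if "x \<in> V" for x using min[OF that] by (simp add: f_def Y_def)
    fix K :: "(real ^ 'n) set" assume K: "compact K" "K \<subseteq> V"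
    obtain \<mu> B where B: "\<mu> > 0" "B \<ge> 0" "\<And>x w. x \<in> K \<Longrightarrow> w \<bullet> (first_form Y x *v w) \<ge> \<mu> * (norm w)\<^sup>2"
      "\<And>x w. x \<in> K \<Longrightarrow> norm (tangent_map Y x w) \<le> B * norm w"
      "\<And>x w. x \<in> K \<Longrightarrow> norm (second_deriv Y x w) \<le> B * (norm w)\<^sup>2"
      using elliptic_bounds[OF Y K pos] by blast
    define n where "n = real CARD('n)"
    \<comment> \<open>An upper bound for the metric on \<open>K\<close>; the 1 keeps it positive
      when \<open>B\<close> is 0.\<close>
    define \<Lambda> where "\<Lambda> = B\<^sup>2 + 1"
    \<comment> \<open>Each frame vector has squared norm at most \<open>1 / \<mu>\<close>, which
      gives the first entry. Each of the \<open>n * n\<close> summands of \<open>b\<close> has norm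
      at most \<open>(B / \<mu>)\<^sup>2\<close>, which gives the second.\<close>
    define D where "D = max (n / \<mu>) (n * n * (B / \<mu> * (B / \<mu>)))"
    have \<Lambda>: "\<Lambda> > 0" by (simp add: \<Lambda>_def add_nonneg_pos)
    show "\<exists>c>0. \<exists>C. \<forall>x\<in>K. \<exists>(e :: 'n \<Rightarrow> real ^ 'n) b. (\<Sum>i\<in>UNIV. (norm (e i))\<^sup>2) \<le> C \<and> norm b \<le> C \<and>
        (\<forall>w. c * (norm w)\<^sup>2 \<le> (\<Sum>i\<in>UNIV. (w \<bullet> e i)\<^sup>2)) \<and>
        (\<Sum>i\<in>UNIV. mink (tangent_map Y x (e i)) (tangent_map Y x (e i)) + mink (Y x) (second_deriv Y x (e i)))
         \<le> mink (Y x) (tangent_map Y x b)"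
    proof (rule exI[of _ "1 / \<Lambda>"], rule conjI, goal_cases)
      case 2
      show ?case
      proof (rule exI[of _ D], rule ballI)
        fix x assume x: "x \<in> K"
        then have xV: "x \<in> V" using K by blast
        obtain e :: "'n \<Rightarrow> real ^ 'n" where e: "inj e" "independent (range e)"
          and on: "\<And>i j. e i \<bullet> (first_form Y x *v e j) = (if i = j then 1 else 0)"
          and le: "(\<Sum>i\<in>UNIV. mink (tangent_map Y x (e i)) (tangent_map Y x (e i)) + mink (Y x) (second_deriv Y x (e i)))
        \<le> mink (Y x) (tangent_map Y x (\<Sum>i\<in>UNIV. \<Sum>j\<in>UNIV. mink (second_deriv Y x (e i)) (tangent_map Y x (e j)) *\<^sub>R e j))"
          by (rule laplacian_half_norm_le[OF k pos[OF xV] partial_derivs_commute[OF V xV C(6)] conv[OF xV] shr[OF xV]]) blast+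
        let ?b = "\<Sum>i\<in>UNIV. \<Sum>j\<in>UNIV. mink (second_deriv Y x (e i)) (tangent_map Y x (e j)) *\<^sub>R e j"
        have ne: "(norm (e i))\<^sup>2 \<le> 1 / \<mu>" for i
          using B(3)[OF x, of "e i"] B(1) by (simp add: on field_simps)
        have "(\<Sum>i\<in>UNIV. (norm (e i))\<^sup>2) \<le> (\<Sum>i\<in>(UNIV::'n set). 1 / \<mu>)" by (intro sum_mono ne)
        also have "\<dots> = n / \<mu>" by (simp add: n_def)
        finally have 1: "(\<Sum>i\<in>UNIV. (norm (e i))\<^sup>2) \<le> D" by (simp add: D_def)
        have "norm (mink (second_deriv Y x (e i)) (tangent_map Y x (e j)) *\<^sub>R e j) \<le> B / \<mu> * (B / \<mu>)" for i j
        proof -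
          have "norm (mink (second_deriv Y x (e i)) (tangent_map Y x (e j)) *\<^sub>R e j)
              \<le> (norm (second_deriv Y x (e i)) * norm (tangent_map Y x (e j))) * norm (e j)"
            using mult_right_mono[OF abs_mink_le norm_ge_zero] by simp
          also have "\<dots> \<le> (B * (1 / \<mu>)) * (B * norm (e j)) * norm (e j)"
          proof -
            have "B * (norm (e i))\<^sup>2 \<le> B * (1 / \<mu>)" using ne B(2) by (intro mult_left_mono)
            then show ?thesis using B(5)[OF x, of "e i"] B(4)[OF x, of "e j"] B(1,2)
              by (intro mult_right_mono mult_mono) (auto intro: order_trans)
          qed
          also have "\<dots> = (B * (1 / \<mu>)) * (B * (norm (e j))\<^sup>2)" by (simp add: power2_eq_square)
          also have "\<dots> \<le> (B * (1 / \<mu>)) * (B * (1 / \<mu>))" using ne B(1,2) by (intro mult_left_mono) auto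
          finally show ?thesis by simp
        qed
        then have "norm ?b \<le> (\<Sum>i\<in>(UNIV::'n set). \<Sum>j\<in>(UNIV::'n set). B / \<mu> * (B / \<mu>))"
          by (intro order_trans[OF norm_sum] sum_mono)
        then have 2: "norm ?b \<le> D" by (simp add: D_def n_def)
        have 3: "1 / \<Lambda> * (norm w)\<^sup>2 \<le> (\<Sum>i\<in>UNIV. (w \<bullet> e i)\<^sup>2)" for w
        proof -
          have "w \<bullet> (first_form Y x *v w) \<le> norm (tangent_map Y x w) * norm (tangent_map Y x w)"
            using abs_mink_le[of "tangent_map Y x w" "tangent_map Y x w"] by (simp add: first_form_quadratic)
          also have "\<dots> \<le> (B * norm w) * (B * norm w)" using B(2,4) x by (intro mult_mono) auto
          also have "\<dots> \<le> \<Lambda> * (norm w)\<^sup>2" by (simp add: \<Lambda>_def power2_eq_square algebra_simps)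
          finally have "(norm w)\<^sup>2 \<le> \<Lambda> * (\<Sum>i\<in>UNIV. (w \<bullet> e i)\<^sup>2)" by (rule orthonormal_frame_lower_bound[OF e on])
          then show ?thesis using \<Lambda> by (simp add: field_simps)
        qed
        show "\<exists>(e :: 'n \<Rightarrow> real ^ 'n) b. (\<Sum>i\<in>UNIV. (norm (e i))\<^sup>2) \<le> D \<and> norm b \<le> D \<and>
          (\<forall>w. 1 / \<Lambda> * (norm w)\<^sup>2 \<le> (\<Sum>i\<in>UNIV. (w \<bullet> e i)\<^sup>2)) \<and>
          (\<Sum>i\<in>UNIV. mink (tangent_map Y x (e i)) (tangent_map Y x (e i)) + mink (Y x) (second_deriv Y x (e i)))
           \<le> mink (Y x) (tangent_map Y x b)"
          by (intro exI[of _ e] exI[of _ ?b] conjI allI 1 2 3 le)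
      qed
    qed (use \<Lambda> in simp)
  qed
  then show ?thesis by (simp add: f_def Y_def)
qed

section \<open>Covering maps onto Euclidean space\<close>

text \<open>The set of agreement is closed because \<open>M\<close> is Hausdorff and open because
  \<pi> is locally injective.\<close>

lemma lift_unique:
  fixes M :: "'m::t2_space set" and S :: "'b::topological_space set"
  assumes "connected S" and s: "continuous_on S s" "s ` S \<subseteq> M" and s': "continuous_on S s'" "s' ` S \<subseteq> M"
    and locinj: "\<And>p. p \<in> M \<Longrightarrow> \<exists>U. openin (top_of_set M) U \<and> p \<in> U \<and> inj_on \<pi> U"
    and eq: "\<And>x. x \<in> S \<Longrightarrow> \<pi> (s x) = \<pi> (s' x)"
    and z: "z \<in> S" "s z = s' z" and x: "x \<in> S"
  shows "s x = s' x"
proof -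
  let ?A = "{x \<in> S. s x = s' x}"
  have "closedin (top_of_set S) (S \<inter> (\<lambda>x. (s x, s' x)) -` {y. \<exists>x. y = (x, x)})"
    by (intro continuous_closedin_preimage continuous_on_Pair s s' closed_diagonal)
  moreover have "S \<inter> (\<lambda>x. (s x, s' x)) -` {y. \<exists>x. y = (x, x)} = ?A" by auto
  ultimately have "closedin (top_of_set S) ?A" by simp
  moreover have "openin (top_of_set S) ?A"
  proof (subst openin_subopen, rule ballI)
    fix y assume y: "y \<in> ?A"
    then obtain U where U: "openin (top_of_set M) U" "s y \<in> U" "inj_on \<pi> U"
      using locinj[of "s y"] s(2) by blast
    have "openin (top_of_set S) (S \<inter> s -` U)" "openin (top_of_set S) (S \<inter> s' -` U)"
      using s s' by (auto intro!: continuous_openin_preimage[OF _ _ U(1)] simp: image_subset_iff_funcset[symmetric])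
    then have "openin (top_of_set S) ((S \<inter> s -` U) \<inter> (S \<inter> s' -` U))" by (rule openin_Int)
    moreover have "(S \<inter> s -` U) \<inter> (S \<inter> s' -` U) \<subseteq> ?A"
      using U(3) eq by (auto simp: inj_on_def)
    moreover have "y \<in> (S \<inter> s -` U) \<inter> (S \<inter> s' -` U)" using y U by auto
    ultimately show "\<exists>T. openin (top_of_set S) T \<and> y \<in> T \<and> T \<subseteq> ?A" by blast
  qed
  ultimately have "?A = {} \<or> ?A = S" using \<open>connected S\<close> by (auto simp: connected_clopen)
  then show ?thesis using z x by auto
qed

text \<open>A uniform radius allows lifting along the segments issuing from one base point in
  finitely many steps. The resulting sections over balls agree by uniqueness of lifts and form a
  global section, which inverts \<pi>.\<close>

lemma bij_betw_if_uniform_local_sections: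
  fixes M :: "'m::t2_space set" and \<pi> :: "'m \<Rightarrow> 'a::euclidean_space"
  assumes "connected M" "M \<noteq> {}" and cont: "continuous_on M \<pi>"
    and locinj: "\<And>p. p \<in> M \<Longrightarrow> \<exists>U. openin (top_of_set M) U \<and> p \<in> U \<and> inj_on \<pi> U"
    and "\<delta> > 0"
    and sec: "\<And>p. p \<in> M \<Longrightarrow> \<exists>\<tau>. continuous_on (ball (\<pi> p) \<delta>) \<tau> \<and> \<tau> ` ball (\<pi> p) \<delta> \<subseteq> M \<and>
        (\<forall>x\<in>ball (\<pi> p) \<delta>. \<pi> (\<tau> x) = x) \<and> \<tau> (\<pi> p) = p"
  shows "bij_betw \<pi> M UNIV"
proof -
  obtain \<sigma> where \<sigma>: "\<And>p. p \<in> M \<Longrightarrow> continuous_on (ball (\<pi> p) \<delta>) (\<sigma> p)"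
      "\<And>p. p \<in> M \<Longrightarrow> \<sigma> p ` ball (\<pi> p) \<delta> \<subseteq> M"
      "\<And>p x. p \<in> M \<Longrightarrow> x \<in> ball (\<pi> p) \<delta> \<Longrightarrow> \<pi> (\<sigma> p x) = x"
      "\<And>p. p \<in> M \<Longrightarrow> \<sigma> p (\<pi> p) = p"
    using sec by metis
  \<comment> \<open>The sections \<open>\<sigma> p\<close> are chosen independently for different
    \<open>p\<close>, so continuity in the index is the issue. Near \<open>x1\<close> every
    \<open>\<sigma> (s x)\<close> agrees with the one section \<open>\<sigma> p\<close> on the
    overlap of their balls, which is convex and hence connected.\<close>
  have step: "continuous_on B (\<lambda>x. \<sigma> (s x) (y x))"
    if s: "continuous_on B s" "s ` B \<subseteq> M" and y: "continuous_on B y"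
      and d: "\<And>x. x \<in> B \<Longrightarrow> y x \<in> ball (\<pi> (s x)) \<delta>" for B :: "'a set" and s y
    unfolding continuous_on_eq_continuous_within
  proof
    fix x1 assume x1: "x1 \<in> B"
    define p where "p = s x1"
    define D where "D = ball (\<pi> p) \<delta>"
    have p: "p \<in> M" using x1 s by (auto simp: p_def)
    have \<pi>s: "continuous_on B (\<lambda>x. \<pi> (s x))"
      using continuous_on_compose2[OF cont s(1)] s(2) by blast
    define N1 where "N1 = (B \<inter> (\<lambda>x. \<pi> (s x)) -` D) \<inter> (B \<inter> y -` D)"
    have N1: "openin (top_of_set B) N1" unfolding N1_def D_def
      by (intro openin_Int continuous_openin_preimage_gen \<pi>s y open_ball)
    have x1N1: "x1 \<in> N1" using x1 d[OF x1] \<open>\<delta> > 0\<close> by (auto simp: N1_def D_def p_def)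
    obtain U where U: "openin (top_of_set M) U" "p \<in> U" "inj_on \<pi> U" using locinj[OF p] by blast
    have "continuous_on N1 (\<lambda>x. \<sigma> p (\<pi> (s x)))"
    proof (rule continuous_on_compose2[OF \<sigma>(1)[OF p], of N1])
      show "continuous_on N1 (\<lambda>x. \<pi> (s x))" using \<pi>s by (rule continuous_on_subset) (auto simp: N1_def)
    qed (auto simp: N1_def D_def)
    moreover have "(\<lambda>x. \<sigma> p (\<pi> (s x))) ` N1 \<subseteq> M"
      using \<sigma>(2)[OF p] unfolding N1_def D_def by blast
    ultimately have o2: "openin (top_of_set N1) (N1 \<inter> (\<lambda>x. \<sigma> p (\<pi> (s x))) -` U)"
      by (intro continuous_openin_preimage[OF _ _ U(1)]) (auto simp: image_subset_iff_funcset[symmetric])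
    have "openin (top_of_set N1) (N1 \<inter> s -` U)"
      by (rule continuous_openin_preimage[OF _ _ U(1)])
        (use s in \<open>auto simp: N1_def intro: continuous_on_subset\<close>)
    then have "openin (top_of_set N1) ((N1 \<inter> (\<lambda>x. \<sigma> p (\<pi> (s x))) -` U) \<inter> (N1 \<inter> s -` U))"
      by (intro openin_Int[OF o2])
    then have o3: "openin (top_of_set B) ((N1 \<inter> (\<lambda>x. \<sigma> p (\<pi> (s x))) -` U) \<inter> (N1 \<inter> s -` U))"
      (is "openin _ ?N") using N1 openin_trans by blast
    have x1N: "x1 \<in> ?N" using x1N1 U \<sigma>(4)[OF p] by (simp add: p_def)
    have eqN: "\<sigma> (s x) (y x) = \<sigma> p (y x)" if x: "x \<in> ?N" for x
    proof -
      have xB: "x \<in> B" "s x \<in> M" using x s by (auto simp: N1_def)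
      have in_D: "\<pi> (s x) \<in> D" "y x \<in> D" using x by (auto simp: N1_def)
      have "\<pi> (\<sigma> p (\<pi> (s x))) = \<pi> (s x)" using \<sigma>(3)[OF p] in_D by (simp add: D_def)
      \<comment> \<open>Both points lie in \<open>U\<close>, on which \<pi> is injective; this is
        the common starting value for \<open>lift_unique\<close>.\<close>
      then have agree: "\<sigma> p (\<pi> (s x)) = s x" using U(3) x by (auto simp: inj_on_def)
      let ?S = "D \<inter> ball (\<pi> (s x)) \<delta>"
      show ?thesis
      proof (rule lift_unique[where s = "\<sigma> (s x)" and s' = "\<sigma> p" and S = ?S and M = M and \<pi> = \<pi> and z = "\<pi> (s x)"])
        show "connected ?S" unfolding D_def by (intro convex_connected convex_Int convex_ball)
        show "continuous_on ?S (\<sigma> (s x))" "continuous_on ?S (\<sigma> p)"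
          using \<sigma>(1)[OF p] \<sigma>(1)[OF xB(2)] by (auto simp: D_def intro: continuous_on_subset)
        show "\<sigma> (s x) ` ?S \<subseteq> M" "\<sigma> p ` ?S \<subseteq> M"
          using \<sigma>(2)[OF p] \<sigma>(2)[OF xB(2)] by (auto simp: D_def)
        show "\<pi> (\<sigma> (s x) z) = \<pi> (\<sigma> p z)" if "z \<in> ?S" for z
          using \<sigma>(3)[OF p, of z] \<sigma>(3)[OF xB(2), of z] that by (simp add: D_def)
        show "\<pi> (s x) \<in> ?S" "y x \<in> ?S" using in_D d[OF xB(1)] \<open>\<delta> > 0\<close> by auto
        show "\<sigma> (s x) (\<pi> (s x)) = \<sigma> p (\<pi> (s x))" using agree \<sigma>(4)[OF xB(2)] by simp
      qed (rule locinj)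
    qed
    have "continuous_on ?N (\<lambda>x. \<sigma> p (y x))"
    proof (rule continuous_on_compose2[OF \<sigma>(1)[OF p], of ?N])
      show "continuous_on ?N y" using y by (rule continuous_on_subset) (auto simp: N1_def)
    qed (auto simp: N1_def D_def)
    then have "continuous_on ?N (\<lambda>x. \<sigma> (s x) (y x))"
      by (subst continuous_on_cong[OF refl eqN])
    then have "continuous (at x1 within ?N) (\<lambda>x. \<sigma> (s x) (y x))"
      using x1N by (simp add: continuous_on_eq_continuous_within)
    moreover have "at x1 within ?N = at x1 within B"
    proof -
      obtain T where T: "open T" "?N = B \<inter> T" using o3 by (auto simp: openin_open)
      then show ?thesis using x1N by (intro at_within_nhd[of x1 T]) auto
    qed
    ultimately show "continuous (at x1 within B) (\<lambda>x. \<sigma> (s x) (y x))" by simp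
  qed
  obtain p0 where p0: "p0 \<in> M" using \<open>M \<noteq> {}\<close> by blast
  define x0 where "x0 = \<pi> p0"
  have sect: "\<exists>s. continuous_on (ball x0 R) s \<and> s ` ball x0 R \<subseteq> M \<and> (\<forall>x\<in>ball x0 R. \<pi> (s x) = x) \<and> s x0 = p0"
    if "R > 0" for R
  proof -
    obtain N :: nat where N: "N > 0" "R / N < \<delta>"
    proof -
      obtain N :: nat where "real N > R / \<delta>" using reals_Archimedean2 by blast
      moreover have "R / \<delta> > 0" using \<open>R > 0\<close> \<open>\<delta> > 0\<close> by simp
      ultimately have N: "real N > 0" "R / \<delta> < real N" by linarith+
      then have "R / N < \<delta>" using \<open>\<delta> > 0\<close> by (simp add: field_simps)
      with N(1) show ?thesis by (intro that) auto
    qed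
    \<comment> \<open>The point at fraction \<open>k / N\<close> of the segment from
      \<open>x0\<close> to \<open>x\<close>. Successive points are closer than \<delta>, and for
      \<open>k = N\<close> a lift of \<open>y k\<close> is a section.\<close>
    define y where "y k x = x0 + (real k / N) *\<^sub>R (x - x0)" for k and x :: 'a
    have "\<exists>s. continuous_on (ball x0 R) s \<and> s ` ball x0 R \<subseteq> M \<and> (\<forall>x\<in>ball x0 R. \<pi> (s x) = y k x) \<and> s x0 = p0" for k
    proof (induction k)
      case 0
      show ?case using p0 by (intro exI[of _ "\<lambda>_. p0"]) (auto simp: y_def x0_def)
    next
      case (Suc k)
      then obtain s where s: "continuous_on (ball x0 R) s" "s ` ball x0 R \<subseteq> M"
        "\<And>x. x \<in> ball x0 R \<Longrightarrow> \<pi> (s x) = y k x" "s x0 = p0" by blast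
      have d: "y (Suc k) x \<in> ball (\<pi> (s x)) \<delta>" if x: "x \<in> ball x0 R" for x
      proof -
        have "y k x - y (Suc k) x = - ((1 / real N) *\<^sub>R (x - x0))"
          by (simp add: y_def add_divide_distrib scaleR_add_left)
        then have "dist (y k x) (y (Suc k) x) = norm (x - x0) / N" by (simp add: dist_norm)
        also have "\<dots> \<le> R / N" using x N by (intro divide_right_mono) (auto simp: dist_norm norm_minus_commute)
        finally show ?thesis using N s(3)[OF x] by simp
      qed
      have y0: "y j x0 = \<pi> p0" for j by (simp add: y_def x0_def)
      show ?case
      proof (intro exI[of _ "\<lambda>x. \<sigma> (s x) (y (Suc k) x)"] conjI ballI)
        have "continuous_on (ball x0 R) (y (Suc k))" unfolding y_def by (intro continuous_intros)
        then show "continuous_on (ball x0 R) (\<lambda>x. \<sigma> (s x) (y (Suc k) x))"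
          by (rule step[OF s(1,2) _ d])
        show "(\<lambda>x. \<sigma> (s x) (y (Suc k) x)) ` ball x0 R \<subseteq> M" using \<sigma>(2) s(2) d by blast
        show "\<pi> (\<sigma> (s x) (y (Suc k) x)) = y (Suc k) x" if "x \<in> ball x0 R" for x
          using \<sigma>(3) s(2) d[OF that] that by blast
        show "\<sigma> (s x0) (y (Suc k) x0) = p0" using y0 s(4) \<sigma>(4) p0 by simp
      qed
    qed
    from this[of N] show ?thesis using N by (simp add: y_def)
  qed
  then obtain S where S: "\<And>R. R > 0 \<Longrightarrow> continuous_on (ball x0 R) (S R)" "\<And>R. R > 0 \<Longrightarrow> S R ` ball x0 R \<subseteq> M"
    "\<And>R x. R > 0 \<Longrightarrow> x \<in> ball x0 R \<Longrightarrow> \<pi> (S R x) = x" "\<And>R. R > 0 \<Longrightarrow> S R x0 = p0"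
    by metis
  \<comment> \<open>The radius only has to put \<open>x\<close> inside the ball; \<open>s_eq\<close>
    shows that any other radius gives the same value.\<close>
  define s where "s x = S (dist x0 x + 1) x" for x
  have s_eq: "s x = S R x" if x: "x \<in> ball x0 R" for x R
  proof -
    define R' where "R' = dist x0 x + 1"
    have R: "R > 0" "R' > 0" "x \<in> ball x0 R'"
      using x zero_le_dist[of x0 x] unfolding R'_def mem_ball by linarith+
    have sub: "ball x0 (min R R') \<subseteq> ball x0 R" "ball x0 (min R R') \<subseteq> ball x0 R'" by auto
    have "S R' x = S R x"
    proof (rule lift_unique[where s = "S R'" and s' = "S R" and S = "ball x0 (min R R')" and M = M and \<pi> = \<pi> and z = x0])
      show "continuous_on (ball x0 (min R R')) (S R')" "continuous_on (ball x0 (min R R')) (S R)"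
        using S(1) R sub continuous_on_subset by blast+
      show "S R' ` ball x0 (min R R') \<subseteq> M" "S R ` ball x0 (min R R') \<subseteq> M"
        using S(2) R sub by blast+
      show "\<pi> (S R' z) = \<pi> (S R z)" if "z \<in> ball x0 (min R R')" for z
        using S(3) R that by simp
      show "S R' x0 = S R x0" using S(4) R by simp
    qed (use R x locinj in auto)
    then show ?thesis by (simp add: s_def R'_def)
  qed
  have s_M: "s x \<in> M" and s_\<pi>: "\<pi> (s x) = x" for x
    using S(2,3)[of "dist x0 x + 1"] zero_le_dist[of x0 x] unfolding s_def
    by (auto simp: add_nonneg_pos image_subset_iff)
  have "isCont s x" for x
  proof -
    have "continuous_on (ball x0 (dist x0 x + 1)) s"
      using S(1)[of "dist x0 x + 1"] by (subst continuous_on_cong[OF refl s_eq]) (auto simp: add_nonneg_pos)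
    then show ?thesis by (simp add: continuous_on_eq_continuous_at)
  qed
  then have s_cont: "continuous_on UNIV s" by (simp add: continuous_on_eq_continuous_at)
  \<comment> \<open>On the connected set \<open>M\<close> this composition and the identity have the
    same image under \<pi> and agree at \<open>p0\<close>.\<close>
  have "s (\<pi> p) = p" if p: "p \<in> M" for p
  proof (rule lift_unique[where s = "\<lambda>p. s (\<pi> p)" and S = M and M = M and \<pi> = \<pi> and z = p0 and s' = "\<lambda>p. p"])
    show "continuous_on M (\<lambda>p. s (\<pi> p))" using continuous_on_compose2[OF s_cont cont] by simp
    have "s x0 = S 1 x0" by (rule s_eq) simp
    then show "s (\<pi> p0) = p0" using S(4)[of 1] by (simp add: x0_def)
  qed (use assms s_M s_\<pi> p p0 locinj in \<open>auto simp: continuous_on_id\<close>)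
  then show ?thesis
    by (intro bij_betwI[where g = s]) (auto simp: s_M s_\<pi>)
qed

section \<open>Co-compact actions and the hyperboloid\<close>

text \<open>An invariant open set is the union of the orbits it contains, so it corresponds to an
  open set of the orbit space. This transfers compactness of the quotient to invariant covers of
  \<open>M\<close>.\<close>

lemma finite_subcover_if_compact_orbit_space:
  assumes act: "group_action G M \<rho>" and comp: "compact_space (orbit_space G M \<rho>)"
    and op: "\<And>U. U \<in> \<U> \<Longrightarrow> openin (top_of_set M) U"
    and inv: "\<And>U T p. U \<in> \<U> \<Longrightarrow> T \<in> carrier G \<Longrightarrow> p \<in> U \<Longrightarrow> \<rho> T p \<in> U"
    and cover: "M \<subseteq> \<Union>\<U>"
  obtains \<F> where "finite \<F>" "\<F> \<subseteq> \<U>" "M \<subseteq> \<Union>\<F>"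
proof -
  define W where "W U = {Q \<in> orbits G M \<rho>. Q \<subseteq> U}" for U
  have orb: "orbit G \<rho> p \<in> orbits G M \<rho>" "p \<in> orbit G \<rho> p" if "p \<in> M" for p
    using group_action.orbit_refl[OF act that] that by (auto simp: orbits_def)
  have orbM: "Q \<subseteq> M" if "Q \<in> orbits G M \<rho>" for Q
    using that group_action.element_image[OF act] by (auto simp: orbits_def orbit_def)
  have inW: "orbit G \<rho> p \<in> W U" if "p \<in> U" "p \<in> M" "U \<in> \<U>" for p U
    using orb(1)[OF that(2)] inv[OF that(3) _ that(1)] by (auto simp: W_def orbit_def)
  have UW: "\<Union>(W U) = U" if "U \<in> \<U>" for U
  proof
    show "\<Union>(W U) \<subseteq> U" by (auto simp: W_def)
    show "U \<subseteq> \<Union>(W U)"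
    proof
      fix p assume p: "p \<in> U"
      then have "p \<in> M" using op[OF that] openin_imp_subset by blast
      then show "p \<in> \<Union>(W U)" using inW[OF p _ that] orb(2) by blast
    qed
  qed
  have "openin (orbit_space G M \<rho>) (W U)" if "U \<in> \<U>" for U
    using op[OF that] UW[OF that] by (subst openin_orbit_space[OF act]) (auto simp: W_def)
  moreover have "topspace (orbit_space G M \<rho>) \<subseteq> \<Union>(W ` \<U>)"
  proof
    fix Q assume "Q \<in> topspace (orbit_space G M \<rho>)"
    then have "Q \<in> orbits G M \<rho>"
      using openin_topspace[of "orbit_space G M \<rho>"] by (simp only: openin_orbit_space[OF act]) blast
    then obtain p where p: "p \<in> M" "Q = orbit G \<rho> p" by (auto simp: orbits_def)
    then obtain U where "U \<in> \<U>" "p \<in> U" using cover by blast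
    then show "Q \<in> \<Union>(W ` \<U>)" using inW p by blast
  qed
  ultimately obtain \<G> where \<G>: "finite \<G>" "\<G> \<subseteq> W ` \<U>" "topspace (orbit_space G M \<rho>) \<subseteq> \<Union>\<G>"
    using comp unfolding compact_space_def compactin_def by (metis (no_types, lifting) imageE)
  obtain \<F> where \<F>: "\<F> \<subseteq> \<U>" "finite \<F>" "\<G> = W ` \<F>"
    using finite_subset_image[OF \<G>(1,2)] by blast
  have "openin (orbit_space G M \<rho>) (orbits G M \<rho>)"
  proof (subst openin_orbit_space[OF act], intro conjI)
    have "\<Union>(orbits G M \<rho>) = M" using orb orbM by blast
    then show "openin (top_of_set M) (\<Union>(orbits G M \<rho>))" by simp
  qed simp
  then have orb_top: "orbits G M \<rho> \<subseteq> topspace (orbit_space G M \<rho>)" by (rule openin_subset)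
  have "M \<subseteq> \<Union>\<F>"
  proof
    fix p assume p: "p \<in> M"
    then have "orbit G \<rho> p \<in> \<Union>\<G>" using orb(1) orb_top \<G>(3) by blast
    then obtain U where "U \<in> \<F>" "orbit G \<rho> p \<in> W U" using \<F>(3) by blast
    then show "p \<in> \<Union>\<F>" using orb(2)[OF p] by (auto simp: W_def)
  qed
  then show ?thesis using that \<F> by blast
qed

text \<open>Without a minimum the sets where \<open>f\<close> exceeds \<open>f q\<close> would be an
  invariant open cover. In a finite subcover, the \<open>q\<close> with the least value is itself
  not covered.\<close>

lemma invariant_function_attains_min:
  fixes f :: "'m::topological_space \<Rightarrow> real"
  assumes act: "group_action G M \<rho>" and comp: "compact_space (orbit_space G M \<rho>)"
    and cont: "continuous_on M f" and inv: "\<And>T p. T \<in> carrier G \<Longrightarrow> p \<in> M \<Longrightarrow> f (\<rho> T p) = f p"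
    and "M \<noteq> {}"
  shows "\<exists>p\<in>M. \<forall>q\<in>M. f p \<le> f q"
proof (rule ccontr)
  assume *: "\<not> (\<exists>p\<in>M. \<forall>q\<in>M. f p \<le> f q)"
  have lt: "\<exists>q\<in>M. f q < f p" if "p \<in> M" for p
    using * that by (auto simp: not_le)
  define U where "U q = {p \<in> M. f q < f p}" for q
  obtain \<F> where \<F>: "finite \<F>" "\<F> \<subseteq> U ` M" "M \<subseteq> \<Union>\<F>"
  proof (rule finite_subcover_if_compact_orbit_space[OF act comp, of "U ` M"])
    show "openin (top_of_set M) W" if WU: "W \<in> U ` M" for W
    proof -
      obtain q where "W = U q" using WU by blast
      also have "U q = M \<inter> f -` {f q<..}" by (auto simp: U_def)
      finally show ?thesis using continuous_openin_preimage_gen[OF cont open_greaterThan] by simp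
    qed
    show "\<rho> T p \<in> W" if WT: "W \<in> U ` M" "T \<in> carrier G" "p \<in> W" for W T p
    proof -
      obtain q where "W = U q" using WT(1) by blast
      moreover have "\<rho> T p \<in> M" if "p \<in> M" for p
        using group_action.element_image[OF act \<open>T \<in> carrier G\<close> that refl] .
      ultimately show ?thesis using WT(3) inv[OF WT(2)] by (simp add: U_def)
    qed
    show "M \<subseteq> \<Union>(U ` M)"
    proof
      fix p assume "p \<in> M"
      from lt[OF this] this show "p \<in> \<Union>(U ` M)" by (auto simp: U_def)
    qed
  qed
  obtain Q where Q: "Q \<subseteq> M" "finite Q" "\<F> = U ` Q" using finite_subset_image[OF \<F>(1,2)] by blast
  have "Q \<noteq> {}" using \<F>(3) Q(3) \<open>M \<noteq> {}\<close> by blast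
  define q where "q = arg_min_on f Q"
  have q: "q \<in> Q" "\<And>q'. q' \<in> Q \<Longrightarrow> f q \<le> f q'"
    unfolding q_def using arg_min_if_finite(1)[OF Q(2) \<open>Q \<noteq> {}\<close>] arg_min_least[OF Q(2) \<open>Q \<noteq> {}\<close>] by auto
  then obtain q' where "q' \<in> Q" "q \<in> U q'" using \<F>(3) Q by blast
  then show False using q(2)[of q'] by (simp add: U_def)
qed

section \<open>Geometry of a sheet of radius r\<close>

definition upper_sheet :: "real \<Rightarrow> 'n::finite minkowski set" where
  "upper_sheet r = {Z. mink Z Z = - r\<^sup>2 \<and> snd Z > 0}"

lemma upper_sheet_iff:
  "Z \<in> upper_sheet r \<longleftrightarrow> snd Z = sqrt (r\<^sup>2 + (norm (fst Z))\<^sup>2) \<and> snd Z > 0"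
proof -
  have "mink Z Z = - r\<^sup>2 \<longleftrightarrow> (snd Z)\<^sup>2 = r\<^sup>2 + (norm (fst Z))\<^sup>2"
    by (auto simp: mink_def dot_square_norm power2_eq_square)
  moreover have "(snd Z)\<^sup>2 = r\<^sup>2 + (norm (fst Z))\<^sup>2 \<longleftrightarrow> snd Z = sqrt (r\<^sup>2 + (norm (fst Z))\<^sup>2)" if "snd Z > 0"
    using that by (metis real_sqrt_pow2 real_sqrt_unique less_imp_le sum_power2_ge_zero)
  ultimately show ?thesis by (auto simp: upper_sheet_def)
qed

text \<open>A timelike vector has spatial part no longer than its time coordinate, so for
  \<open>A\<close> not future directed Cauchy-Schwarz would make \<open>mink A B\<close>
  nonnegative.\<close>

lemma timelike_future_if_mink_neg:
  assumes "mink A A < 0" "mink B B < 0" "snd B > 0" "mink A B < 0"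
  shows "snd A > 0"
proof (rule ccontr)
  assume n: "\<not> snd A > 0"
  have "norm (fst A) \<le> - snd A" using assms(1) n
    by - (rule power2_le_imp_le, auto simp: mink_def dot_square_norm power2_eq_square)
  moreover have "norm (fst B) \<le> snd B" using assms(2,3)
    by - (rule power2_le_imp_le, auto simp: mink_def dot_square_norm power2_eq_square)
  ultimately have "norm (fst A) * norm (fst B) \<le> - snd A * snd B"
    using n by (intro mult_mono) auto
  moreover have "\<bar>fst A \<bullet> fst B\<bar> \<le> norm (fst A) * norm (fst B)" by (rule Cauchy_Schwarz_ineq2)
  ultimately show False using assms(4) by (simp add: mink_def)
qed

text \<open>\<open>O_plus\<close> prescribes the time orientation through the image of
  \<open>time_vec\<close>; comparing the image of \<open>Z\<close> with that image carries it over
  to the sheet.\<close>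

lemma O_plus_upper_sheet:
  assumes T: "T \<in> carrier O_plus" and Z: "Z \<in> upper_sheet r" and r: "r > 0"
  shows "blinfun_apply T Z \<in> upper_sheet r"
proof -
  have iso: "mink (blinfun_apply T Y) (blinfun_apply T W) = mink Y W" for Y W
    using T unfolding O_plus_def partial_object.simps mem_Collect_eq by blast
  have t: "mink (blinfun_apply T time_vec) time_vec < 0" using T by (simp add: O_plus_def)
  have tt: "mink time_vec time_vec = (- 1 :: real)" by (simp add: mink_def time_vec_def)
  have ZZ: "mink Z Z = - r\<^sup>2" "snd Z > 0" using Z by (auto simp: upper_sheet_def)
  have "snd (blinfun_apply T time_vec) > 0" using t by (simp add: mink_def time_vec_def)
  moreover have "mink Z time_vec < 0" using ZZ by (simp add: mink_def time_vec_def)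
  ultimately have "snd (blinfun_apply T Z) > 0"
    using timelike_future_if_mink_neg[of "blinfun_apply T Z" "blinfun_apply T time_vec"] r
    by (simp add: iso ZZ tt)
  then show ?thesis by (simp add: upper_sheet_def iso ZZ)
qed

text \<open>Thus \<open>- mink W Z - r\<^sup>2\<close>, the group-invariant measure of distance on
  the sheet, is half the squared Minkowski length of the chord.\<close>

lemma upper_sheet_mink_diff:
  assumes "W \<in> upper_sheet r" "Z \<in> upper_sheet r"
  shows "mink (Z - W) (Z - W) = 2 * (- mink W Z - r\<^sup>2)"
  using assms by (simp add: upper_sheet_def mink.diff_left mink.diff_right mink_commute[of Z W])

text \<open>The reversed Cauchy-Schwarz inequality: the squares of \<open>snd W * snd Z\<close> and
  \<open>r\<^sup>2 + ?x * ?y\<close> differ by \<open>r\<^sup>2 * (?x - ?y)\<^sup>2\<close>.\<close>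

lemma upper_sheet_mink_ge:
  assumes W: "W \<in> upper_sheet r" and Z: "Z \<in> upper_sheet r"
  shows "- mink W Z \<ge> r\<^sup>2"
proof -
  have a: "(snd W)\<^sup>2 = r\<^sup>2 + (norm (fst W))\<^sup>2" "(snd Z)\<^sup>2 = r\<^sup>2 + (norm (fst Z))\<^sup>2"
    using W Z by (auto simp: upper_sheet_def mink_def dot_square_norm power2_eq_square)
  have pos: "snd W > 0" "snd Z > 0" using W Z by (auto simp: upper_sheet_def)
  let ?x = "norm (fst W)" and ?y = "norm (fst Z)"
  have "(r\<^sup>2 + ?x * ?y)\<^sup>2 \<le> (snd W * snd Z)\<^sup>2"
  proof -
    have "(snd W * snd Z)\<^sup>2 - (r\<^sup>2 + ?x * ?y)\<^sup>2 = r\<^sup>2 * (?x - ?y)\<^sup>2"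
      unfolding power_mult_distrib a by (simp add: power2_eq_square algebra_simps)
    then show ?thesis by (metis diff_ge_0_iff_ge mult_nonneg_nonneg zero_le_power2)
  qed
  then have "r\<^sup>2 + ?x * ?y \<le> snd W * snd Z" using pos by - (rule power2_le_imp_le, auto)
  moreover have "fst W \<bullet> fst Z \<le> ?x * ?y" by (rule norm_cauchy_schwarz)
  ultimately show ?thesis by (simp add: mink_def)
qed

text \<open>The chord is split into a multiple of \<open>W\<close> and a part \<open>w\<close>
  orthogonal to \<open>W\<close>. Orthogonality bounds the time coordinate of \<open>w\<close> by
  its spatial part, so the latter is at most \<open>snd W / r\<close> times the Minkowski length of
  \<open>w\<close>.\<close>

lemma upper_sheet_dist_fst_le:
  assumes r: "r > 0" and W: "W \<in> upper_sheet r" and Z: "Z \<in> upper_sheet r"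
    and \<eta>: "\<eta> = - mink W Z - r\<^sup>2"
  shows "norm (fst Z - fst W) \<le> snd W * (\<eta> / r\<^sup>2) + snd W / r * sqrt (2 * \<eta> + \<eta>\<^sup>2 / r\<^sup>2)"
proof -
  have a: "(snd W)\<^sup>2 = r\<^sup>2 + (norm (fst W))\<^sup>2"
    using W by (auto simp: upper_sheet_def mink_def dot_square_norm power2_eq_square)
  have pos: "snd W > 0" and WW: "mink W W = - r\<^sup>2" using W by (auto simp: upper_sheet_def)
  have \<eta>0: "\<eta> \<ge> 0" using upper_sheet_mink_ge[OF W Z] by (simp add: \<eta>)
  \<comment> \<open>The coefficient makes \<open>w\<close> orthogonal to \<open>W\<close>, since
    \<open>mink (Z - W) W = - \<eta>\<close> and \<open>mink W W = - r\<^sup>2\<close>.\<close>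
  define w where "w = (Z - W) - (\<eta> / r\<^sup>2) *\<^sub>R W"
  have wW: "mink w W = 0"
    using r WW by (simp add: w_def mink.diff_left mink.scaleR_left mink_commute[of Z W] \<eta>)
  have "mink w w = mink w (Z - W)" using wW by (simp add: w_def mink.diff_right mink.scaleR_right)
  also have "\<dots> = mink (Z - W) (Z - W) - \<eta> / r\<^sup>2 * mink W (Z - W)"
    by (simp add: w_def mink.diff_left mink.scaleR_left)
  also have "mink W (Z - W) = - \<eta>" using WW by (simp add: mink.diff_right \<eta>)
  also have "mink (Z - W) (Z - W) = 2 * \<eta>" using upper_sheet_mink_diff[OF W Z] \<eta> by simp
  finally have ww: "mink w w = 2 * \<eta> + \<eta>\<^sup>2 / r\<^sup>2" by (simp add: power2_eq_square)
  let ?a = "norm (fst w)" and ?x = "norm (fst W)"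
  have "snd w * snd W = fst w \<bullet> fst W" using wW by (simp add: mink_def)
  then have "\<bar>snd w * snd W\<bar> \<le> ?a * ?x" by (metis Cauchy_Schwarz_ineq2)
  then have "(snd w * snd W)\<^sup>2 \<le> (?a * ?x)\<^sup>2" by (metis abs_ge_zero power2_abs power_mono)
  then have "(snd w)\<^sup>2 * (snd W)\<^sup>2 \<le> ?a\<^sup>2 * ?x\<^sup>2" by (simp only: power_mult_distrib)
  moreover have "mink w w * (snd W)\<^sup>2 = ?a\<^sup>2 * (snd W)\<^sup>2 - (snd w)\<^sup>2 * (snd W)\<^sup>2"
    by (simp add: mink_def dot_square_norm power2_eq_square algebra_simps)
  ultimately have "?a\<^sup>2 * r\<^sup>2 \<le> mink w w * (snd W)\<^sup>2" by (simp add: a distrib_left)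
  then have "?a\<^sup>2 \<le> (snd W / r)\<^sup>2 * mink w w" using r by (simp add: power_divide field_simps)
  then have "sqrt (?a\<^sup>2) \<le> sqrt ((snd W / r)\<^sup>2 * mink w w)" by (rule real_sqrt_le_mono)
  then have aw: "?a \<le> snd W / r * sqrt (mink w w)" using pos r by (simp add: real_sqrt_mult)
  have "fst Z - fst W = fst w + (\<eta> / r\<^sup>2) *\<^sub>R fst W" by (simp add: w_def)
  then have "norm (fst Z - fst W) \<le> ?a + (\<eta> / r\<^sup>2) * ?x"
    using norm_triangle_ineq[of "fst w" "(\<eta> / r\<^sup>2) *\<^sub>R fst W"] \<eta>0 by simp
  moreover have "?x \<le> snd W" using a pos by - (rule power2_le_imp_le, auto)
  then have "(\<eta> / r\<^sup>2) * ?x \<le> (\<eta> / r\<^sup>2) * snd W" using \<eta>0 by (intro mult_left_mono) auto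
  ultimately show ?thesis using aw ww by (simp add: mult.commute)
qed

text \<open>The bound of \<open>upper_sheet_dist_fst_le\<close> tends to 0 with \<eta> but grows
  with \<open>snd W\<close>; the cap \<open>E\<close> makes it uniform in \<open>W\<close>.\<close>

lemma upper_sheet_neighbourhood:
  assumes r: "r > 0" and "E > 0" "\<delta> > 0"
  obtains \<epsilon> where "\<epsilon> > 0"
    "\<And>W Z. W \<in> upper_sheet r \<Longrightarrow> Z \<in> upper_sheet r \<Longrightarrow> snd W \<le> E \<Longrightarrow> - mink W Z < r\<^sup>2 + \<epsilon>
       \<Longrightarrow> norm (fst Z - fst W) < \<delta>"
proof -
  define b where "b \<eta> = E * (\<eta> / r\<^sup>2) + E / r * sqrt (2 * \<eta> + \<eta>\<^sup>2 / r\<^sup>2)" for \<eta>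
  have "isCont b 0" unfolding b_def by (intro continuous_intros) (use r in auto)
  then obtain d where d: "d > 0" "\<And>\<eta>. \<bar>\<eta>\<bar> < d \<Longrightarrow> \<bar>b \<eta>\<bar> < \<delta>"
    using \<open>\<delta> > 0\<close> unfolding continuous_at_eps_delta by (auto simp: dist_real_def b_def)
  show ?thesis
  proof (rule that[OF d(1)])
    fix W Z assume WZ: "W \<in> upper_sheet r" "Z \<in> upper_sheet r" "snd W \<le> E" "- mink W Z < r\<^sup>2 + d"
    define \<eta> where "\<eta> = - mink W Z - r\<^sup>2"
    have \<eta>: "\<eta> \<ge> 0" "\<eta> < d" using upper_sheet_mink_ge[OF WZ(1,2)] WZ by (auto simp: \<eta>_def)
    have "norm (fst Z - fst W) \<le> snd W * (\<eta> / r\<^sup>2) + snd W / r * sqrt (2 * \<eta> + \<eta>\<^sup>2 / r\<^sup>2)"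
      by (rule upper_sheet_dist_fst_le[OF r WZ(1,2) \<eta>_def])
    also have "\<dots> \<le> b \<eta>" unfolding b_def
      using WZ(3) \<eta>(1) r by (intro add_mono mult_right_mono divide_right_mono) simp_all
    also have "\<dots> < \<delta>" using d(2)[of \<eta>] \<eta> by simp
    finally show "norm (fst Z - fst W) < \<delta>" .
  qed
qed

text \<open>The sheet is connected as a graph over \<real>\<open>\<^sup>n\<close>. It is maximal,
  for a connected set that left it would contain a point with time coordinate 0, where
  \<open>mink\<close> is nonnegative.\<close>

lemma upper_sheet_1_component: "upper_sheet 1 \<in> components (hyperboloid :: 'n::finite minkowski set)"
proof -
  define c where "c x = (x, sqrt (1 + (norm x)\<^sup>2))" for x :: "real ^ 'n"
  have im: "upper_sheet 1 = range c"
  proof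
    show "upper_sheet 1 \<subseteq> range c"
    proof
      fix Z :: "'n minkowski" assume "Z \<in> upper_sheet 1"
      then have "Z = c (fst Z)" by (simp add: upper_sheet_iff c_def prod_eq_iff)
      then show "Z \<in> range c" by blast
    qed
    have "1 + (norm x)\<^sup>2 > 0" for x :: "real ^ 'n" by (simp add: add_pos_nonneg)
    then show "range c \<subseteq> upper_sheet 1" by (auto simp: upper_sheet_iff c_def)
  qed
  have "connected (upper_sheet 1 :: 'n minkowski set)"
    unfolding im c_def by (intro connected_continuous_image continuous_intros connected_UNIV)
  moreover have sub: "upper_sheet 1 \<subseteq> (hyperboloid :: 'n minkowski set)"
    by (auto simp: upper_sheet_def hyperboloid_def)
  moreover have "upper_sheet 1 \<noteq> ({} :: 'n minkowski set)" by (simp add: im)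
  moreover have "C = upper_sheet 1"
    if C: "C \<noteq> {}" "C \<subseteq> hyperboloid" "upper_sheet 1 \<subseteq> C" "connected C" for C :: "'n minkowski set"
  proof -
    have "snd Z > 0" if "Z \<in> C" for Z
    proof (rule ccontr)
      assume "\<not> snd Z > 0"
      have "connected (snd ` C)" using \<open>connected C\<close> by (intro connected_continuous_image continuous_intros)
      moreover have "c 0 \<in> C" using C(3) im by auto
      then have "1 \<in> snd ` C" by (force simp: c_def)
      moreover have "snd Z \<in> snd ` C" using that by blast
      ultimately have "0 \<in> snd ` C" using \<open>\<not> snd Z > 0\<close> by (auto simp: connected_iff_interval)
      then obtain Z' where "Z' \<in> C" "snd Z' = 0" by auto
      then have "mink Z' Z' = - 1" using C(2) by (auto simp: hyperboloid_def)
      then have "fst Z' \<bullet> fst Z' = - 1" using \<open>snd Z' = 0\<close> by (simp add: mink_def)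
      then show False using inner_ge_zero[of "fst Z'"] by simp
    qed
    then have "C \<subseteq> upper_sheet 1" using C(2) by (auto simp: upper_sheet_def hyperboloid_def)
    then show ?thesis using C(3) by blast
  qed
  ultimately show ?thesis unfolding in_components_maximal by blast
qed

lemma scaled_upper_sheet:
  assumes "r > 0"
  shows "(*\<^sub>R) r ` upper_sheet 1 = (upper_sheet r :: 'a::finite minkowski set)"
proof
  show "(*\<^sub>R) r ` upper_sheet 1 \<subseteq> (upper_sheet r :: 'a minkowski set)"
  proof
    fix Z :: "'a minkowski" assume "Z \<in> (*\<^sub>R) r ` upper_sheet 1"
    then obtain Y where Y: "Z = r *\<^sub>R Y" "Y \<in> upper_sheet 1" by blast
    then have "mink Y Y = - 1" "snd Y > 0" by (auto simp: upper_sheet_def)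
    then show "Z \<in> upper_sheet r"
      using assms by (simp add: Y(1) upper_sheet_def mink.scaleR_left mink.scaleR_right power2_eq_square)
  qed
  show "(upper_sheet r :: 'a minkowski set) \<subseteq> (*\<^sub>R) r ` upper_sheet 1"
  proof
    fix Z :: "'a minkowski" assume Z: "Z \<in> upper_sheet r"
    have "(1 / r) *\<^sub>R Z \<in> upper_sheet 1"
      using Z assms by (simp add: upper_sheet_def mink.scaleR_left mink.scaleR_right power2_eq_square)
    moreover have "Z = r *\<^sub>R ((1 / r) *\<^sub>R Z)" using assms by simp
    ultimately show "Z \<in> (*\<^sub>R) r ` upper_sheet 1" by blast
  qed
qed

section \<open>Charts, continuity and local graphs\<close>

lemma local_param_openin:
  assumes "local_param M X V \<phi>" "open B" "B \<subseteq> V"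
  shows "openin (top_of_set M) (\<phi> ` B)"
proof -
  obtain \<psi> where \<psi>: "homeomorphism V (\<phi> ` V) \<phi> \<psi>" and V: "openin (top_of_set M) (\<phi> ` V)"
    using assms(1) by (auto simp: local_param_def)
  have "openin (top_of_set V) B" using assms(2,3) by (simp add: openin_open_eq open_subset)
  then have "openin (top_of_set (\<phi> ` V)) (\<phi> ` B)" by (rule homeomorphism_imp_open_map[OF \<psi>])
  then show ?thesis using V by (rule openin_trans)
qed

lemma local_param_subset:
  assumes "local_param M X V \<phi>"
  shows "\<phi> ` V \<subseteq> M"
proof -
  have "openin (top_of_set M) (\<phi> ` V)" using assms by (simp add: local_param_def)
  then show ?thesis by (rule openin_imp_subset)
qed

lemma hypersurface_chart:
  assumes "hypersurface M X" "p \<in> M"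
  obtains V \<phi> v where "local_param M X V \<phi>" "v \<in> V" "p = \<phi> v"
proof -
  have "\<exists>V \<phi>. local_param M X V \<phi> \<and> p \<in> \<phi> ` V" using assms by (simp add: hypersurface_def)
  then show ?thesis using that by blast
qed

lemma cocompactE:
  assumes "cocompact M X"
  obtains G \<rho> where "subgroup G O_plus" "group_action (O_plus\<lparr>carrier := G\<rparr>) M \<rho>"
    "\<And>T. T \<in> G \<Longrightarrow> continuous_on M (\<rho> T)"
    "\<And>T p. T \<in> G \<Longrightarrow> p \<in> M \<Longrightarrow> X (\<rho> T p) = blinfun_apply T (X p)"
    "compact_space (orbit_space (O_plus\<lparr>carrier := G\<rparr>) M \<rho>)"
proof -
  obtain G \<rho> where "subgroup G O_plus" "group_action (O_plus\<lparr>carrier := G\<rparr>) M \<rho>"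
    "\<forall>T\<in>G. continuous_on M (\<rho> T)" "\<forall>T\<in>G. \<forall>p\<in>M. X (\<rho> T p) = blinfun_apply T (X p)"
    "compact_space (orbit_space (O_plus\<lparr>carrier := G\<rparr>) M \<rho>)"
    using assms unfolding cocompact_def by (elim exE conjE) (rule that)
  then show ?thesis by (intro that[of G \<rho>]) simp_all
qed

text \<open>\<open>hypersurface\<close> does not state continuity of \<open>X\<close>; it follows
  locally by writing \<open>X\<close> as the smooth map \<open>X \<circ> \<phi>\<close> after the
  inverse of the homeomorphism \<open>\<phi>\<close>.\<close>

lemma hypersurface_continuous_on:
  fixes X :: "'m::t2_space \<Rightarrow> 'n::finite minkowski"
  assumes "hypersurface M X"
  shows "continuous_on M X"
proof (subst continuous_on_eq_continuous_within, rule ballI)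
  fix p assume "p \<in> M"
  then obtain V \<phi> v where lp: "local_param M X V \<phi>" and v: "v \<in> V" "p = \<phi> v"
    by (rule hypersurface_chart[OF assms])
  then have p: "p \<in> \<phi> ` V" by blast
  from lp obtain \<psi> where \<psi>: "homeomorphism V (\<phi> ` V) \<phi> \<psi>" and V: "openin (top_of_set M) (\<phi> ` V)"
    and sm: "smooth_on V (X \<circ> \<phi>)" by (auto simp: local_param_def)
  obtain T where T: "open T" "\<phi> ` V = M \<inter> T" using V by (auto simp: openin_open)
  have "continuous_on (\<phi> ` V) ((X \<circ> \<phi>) \<circ> \<psi>)"
    using \<psi> smooth_onD(3)[OF sm] by (intro continuous_on_compose[of _ \<psi>]) (auto simp: homeomorphism_def)
  then have "continuous_on (\<phi> ` V) X"
    by (rule continuous_on_eq) (use \<psi> in \<open>auto simp: homeomorphism_def\<close>)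
  then have "continuous (at p within \<phi> ` V) X" using p unfolding continuous_on_eq_continuous_within by blast
  moreover have "at p within \<phi> ` V = at p within M"
    using p T by (intro at_within_nhd[of p T]) auto
  ultimately show "continuous (at p within M) X" by simp
qed

text \<open>A nonzero tangent vector with vanishing spatial part would have \<open>mink\<close> at
  most 0, so on a spacelike hypersurface the projection to the spatial part has injective
  differential and the inverse function theorem applies in a chart.\<close>

lemma local_graph_section:
  fixes X :: "'m::t2_space \<Rightarrow> 'n::finite minkowski"
  assumes "hypersurface M X" "spacelike M X" "p \<in> M"
  obtains B \<sigma> where "open B" "fst (X p) \<in> B" "continuous_on B \<sigma>" "\<sigma> ` B \<subseteq> M" "openin (top_of_set M) (\<sigma> ` B)"
    "\<And>x. x \<in> B \<Longrightarrow> fst (X (\<sigma> x)) = x" "\<sigma> (fst (X p)) = p"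
proof -
  obtain V \<phi> v where lp: "local_param M X V \<phi>" and v: "v \<in> V" "p = \<phi> v"
    using hypersurface_chart[OF assms(1,3)] by blast
  define Y where "Y = X \<circ> \<phi>"
  obtain \<psi> where \<psi>: "homeomorphism V (\<phi> ` V) \<phi> \<psi>" and V: "open V" and sm: "smooth_on V Y"
    and \<phi>V: "openin (top_of_set M) (\<phi> ` V)"
    using lp by (auto simp: local_param_def Y_def)
  define f' where "f' x = Blinfun (\<lambda>w. fst (tangent_map Y x w))" for x
  have bl: "bounded_linear (\<lambda>w. fst (tangent_map Y x w))" for x
    using linear_compose[OF linear_tangent_map[of Y x] linear_fst] by (simp add: o_def linear_conv_bounded_linear)
  then have f': "blinfun_apply (f' x) = (\<lambda>w. fst (tangent_map Y x w))" for x
    by (simp add: f'_def bounded_linear_Blinfun_apply)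
  have der: "((\<lambda>x. fst (Y x)) has_derivative blinfun_apply (f' x)) (at x)" if "x \<in> V" for x
    unfolding f' using has_derivative_tangent_map[OF smooth_onD(1)[OF sm that]] by (rule has_derivative_fst)
  have cont: "continuous_on V f'"
    by (rule continuous_on_blinfun_componentwise)
      (auto simp: f' tangent_map_def intro!: continuous_intros smooth_onD(4)[OF sm])
  have "inj (blinfun_apply (f' v))"
  proof (subst linear_injective_0)
    show "linear (blinfun_apply (f' v))" by (rule bounded_linear.linear[OF blinfun.bounded_linear_right])
    show "\<forall>w. blinfun_apply (f' v) w = 0 \<longrightarrow> w = 0"
    proof (intro allI impI)
      fix w assume 0: "blinfun_apply (f' v) w = 0"
      show "w = 0"
      proof (rule ccontr)
        assume "w \<noteq> 0"
        then have "w \<bullet> (first_form Y v *v w) > 0"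
          using assms(2) lp v(1) unfolding spacelike_def Y_def by blast
        then have "mink (tangent_map Y v w) (tangent_map Y v w) > 0" by (simp only: first_form_quadratic)
        moreover have "mink (tangent_map Y v w) (tangent_map Y v w) \<le> 0" using 0 by (simp add: mink_def f')
        ultimately show False by simp
      qed
    qed
  qed
  then obtain g where g: "linear g" "g \<circ> blinfun_apply (f' v) = id"
    using linear_injective_left_inverse[OF bounded_linear.linear[OF blinfun.bounded_linear_right]] by blast
  have gf': "Blinfun g o\<^sub>L f' v = id_blinfun"
    using g by (intro blinfun_eqI) (simp add: bounded_linear_Blinfun_apply linear_conv_bounded_linear[symmetric] fun_eq_iff)
  obtain U B h where U: "open U" "U \<subseteq> V" "v \<in> U" and B: "open B" "fst (Y v) \<in> B"
    and h: "homeomorphism U B (\<lambda>x. fst (Y x)) h"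
    by (rule inverse_function_theorem[OF V der cont v(1) gf']) (assumption, rule that)
  have hU: "h ` B = U" and hc: "continuous_on B h" and fh: "\<And>x. x \<in> B \<Longrightarrow> fst (Y (h x)) = x"
    and hf: "\<And>x. x \<in> U \<Longrightarrow> h (fst (Y x)) = x"
    using h by (auto simp: homeomorphism_def)
  have im: "(\<phi> \<circ> h) ` B = \<phi> ` U" using hU by (metis image_comp)
  show ?thesis
  proof (rule that[of B "\<phi> \<circ> h"])
    show "continuous_on B (\<phi> \<circ> h)"
      using hc hU \<psi> U(2) by (intro continuous_on_compose) (auto simp: homeomorphism_def intro: continuous_on_subset)
    show op: "openin (top_of_set M) ((\<phi> \<circ> h) ` B)" unfolding im using lp U by (intro local_param_openin)
    show "(\<phi> \<circ> h) ` B \<subseteq> M" using openin_imp_subset[OF op] .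
    show "fst (X ((\<phi> \<circ> h) x)) = x" if "x \<in> B" for x using fh[OF that] by (simp add: Y_def)
    show "(\<phi> \<circ> h) (fst (X p)) = p" using hf[OF U(3)] v(2) by (simp add: Y_def)
  qed (use B v in \<open>auto simp: Y_def\<close>)
qed

section \<open>From the self-shrinker equation to a sheet\<close>

text \<open>The minimum set is closed by continuity and open by the strong minimum principle, and
  \<open>M\<close> is connected.\<close>

lemma shrinker_norm_constant:
  fixes X :: "'m::t2_space \<Rightarrow> 'n::finite minkowski"
  assumes k: "1 \<le> k" "k \<le> CARD('n)"
    and hyp: "hypersurface M X" and sp: "spacelike M X" "k_convex k M X" "self_shrinker k M X"
    and min: "p \<in> M" "\<And>q. q \<in> M \<Longrightarrow> mink (X p) (X p) \<le> mink (X q) (X q)" and "q \<in> M"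
  shows "mink (X q) (X q) = mink (X p) (X p)"
proof -
  define m where "m = mink (X p) (X p)"
  define S where "S = {q \<in> M. mink (X q) (X q) = m}"
  have contX: "continuous_on M X" using hyp by (rule hypersurface_continuous_on)
  have "closedin (top_of_set M) (M \<inter> (\<lambda>q. mink (X q) (X q)) -` {m})"
    by (intro continuous_closedin_preimage mink.continuous_on contX) auto
  moreover have "M \<inter> (\<lambda>q. mink (X q) (X q)) -` {m} = S" by (auto simp: S_def)
  ultimately have "closedin (top_of_set M) S" by simp
  moreover have "openin (top_of_set M) S"
  proof (subst openin_subopen, rule ballI)
    fix q assume q: "q \<in> S"
    then obtain V \<phi> v where lp: "local_param M X V \<phi>" and v: "v \<in> V" "q = \<phi> v"
      using hypersurface_chart[OF hyp, of q] by (auto simp: S_def)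
    have VM: "\<phi> ` V \<subseteq> M" using lp by (rule local_param_subset)
    have qm: "mink (X (\<phi> v)) (X (\<phi> v)) = m" using q v by (simp add: S_def)
    have "mink (X (\<phi> v)) (X (\<phi> v)) \<le> mink (X (\<phi> x)) (X (\<phi> x))" if "x \<in> V" for x
      unfolding qm unfolding m_def using min(2) VM that by blast
    from half_norm_strong_minimum[OF k sp lp v(1) this]
    obtain \<epsilon> where \<epsilon>: "\<epsilon> > 0" "ball v \<epsilon> \<subseteq> V" "\<And>x. x \<in> ball v \<epsilon> \<Longrightarrow> mink (X (\<phi> x)) (X (\<phi> x)) = m"
      unfolding qm by blast
    have "openin (top_of_set M) (\<phi> ` ball v \<epsilon>)" using lp open_ball \<epsilon>(2) by (rule local_param_openin)
    moreover have "q \<in> \<phi> ` ball v \<epsilon>" using \<epsilon>(1) v by auto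
    moreover have "\<phi> ` ball v \<epsilon> \<subseteq> S" using \<epsilon> VM by (auto simp: S_def)
    ultimately show "\<exists>T. openin (top_of_set M) T \<and> q \<in> T \<and> T \<subseteq> S" by blast
  qed
  moreover have "connected M" using hyp by (simp add: hypersurface_def)
  ultimately have "S = {} \<or> S = M" by (auto simp: connected_clopen)
  moreover have "p \<in> S" using min(1) by (simp add: S_def m_def)
  ultimately show ?thesis using \<open>q \<in> M\<close> by (auto simp: S_def m_def)
qed

text \<open>The sign of \<open>F\<close> selects the sheet: it makes \<open>u\<close> positive in
  \<open>X = u *\<^sub>R \<nu>\<close>, and \<nu> is future directed.\<close>

lemma shrinker_in_upper_sheet:
  fixes X :: "'m::t2_space \<Rightarrow> 'n::finite minkowski"
  assumes k: "1 \<le> k" "k \<le> CARD('n)"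
    and hyp: "hypersurface M X" and sp: "spacelike M X" "k_convex k M X" "self_shrinker k M X"
    and const: "\<And>q. q \<in> M \<Longrightarrow> mink (X q) (X q) = m"
  obtains r where "r > 0" "X ` M \<subseteq> upper_sheet r"
proof -
  have key: "mink (X p) (X p) < 0 \<and> snd (X p) > 0" if p: "p \<in> M" for p
  proof -
    obtain V \<phi> v where lp: "local_param M X V \<phi>" and v: "v \<in> V" "p = \<phi> v"
      using hypersurface_chart[OF hyp p] by blast
    have VM: "\<phi> ` V \<subseteq> M" using lp by (rule local_param_subset)
    define Y where "Y = X \<circ> \<phi>"
    have V: "open V" and Y: "smooth_on V Y" using lp by (auto simp: local_param_def Y_def)
    note C = smooth_onD[OF Y]
    have pos: "w \<bullet> (first_form Y v *v w) > 0" if "w \<noteq> 0" for w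
      using sp(1) lp v that by (auto simp: spacelike_def Y_def)
    have conv: "principal_curvatures Y v \<in> Gamma_cone k"
      using sp(2) lp v by (auto simp: k_convex_def Y_def)
    have shr: "F_curv k (principal_curvatures Y v) = - 1 / mink (Y v) (unit_normal Y v)"
      using sp(3) lp v by (auto simp: self_shrinker_def Y_def)
    obtain e :: "'n \<Rightarrow> real ^ 'n" where e: "inj e" "independent (range e)"
      and on: "\<And>i j. e i \<bullet> (first_form Y v *v e j) = (if i = j then 1 else 0)"
      by (rule laplacian_half_norm_le[OF k pos partial_derivs_commute[OF V v(1) C(6)] conv shr]) blast+
    have onT: "mink (tangent_map Y v (e i)) (tangent_map Y v (e j)) = (if i = j then 1 else 0)" for i j
      using on[of i j] by (simp add: first_form_quadratic)
    note N = unit_normal_properties[OF e onT]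
    have d: "(Y has_derivative tangent_map Y v) (at v)" using C(1)[OF v(1)] by (rule has_derivative_tangent_map)
    have d1: "((\<lambda>x. mink (Y x) (Y x)) has_derivative (\<lambda>w. mink (Y v) (tangent_map Y v w) + mink (tangent_map Y v w) (Y v))) (at v)"
      by (rule mink.FDERIV[OF d d])
    have d2: "((\<lambda>x. mink (Y x) (Y x)) has_derivative (\<lambda>w. 0)) (at v)"
    proof (rule has_derivative_transform_within_open[OF has_derivative_const V v(1)])
      show "m = mink (Y x) (Y x)" if "x \<in> V" for x using const[of "\<phi> x"] VM that by (auto simp: Y_def)
    qed
    have "mink (Y v) (tangent_map Y v w) + mink (tangent_map Y v w) (Y v) = 0" for w
      using fun_cong[OF has_derivative_unique[OF d1 d2], of w] .
    then have orth: "mink (Y v) (tangent_map Y v w) = 0" for w by (metis mink_commute double_zero_sym)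
    have "Y v = (\<Sum>i\<in>UNIV. mink (Y v) (tangent_map Y v (e i)) *\<^sub>R tangent_map Y v (e i)) - mink (Y v) (unit_normal Y v) *\<^sub>R unit_normal Y v"
      by (rule orthonormal_frame_expansion) (use onT N in auto)
    then have Yv: "Y v = (- mink (Y v) (unit_normal Y v)) *\<^sub>R unit_normal Y v" by (simp add: orth)
    have "F_curv k (principal_curvatures Y v) > 0"
      using maclaurin_Gamma_cone(1)[OF k conv] k by (simp add: F_curv_def)
    then have neg: "mink (Y v) (unit_normal Y v) < 0" by (simp add: shr zero_less_divide_iff)
    define u where "u = - mink (Y v) (unit_normal Y v)"
    have u: "u > 0" "Y v = u *\<^sub>R unit_normal Y v" using neg Yv by (auto simp: u_def)
    have "mink (Y v) (Y v) = - (u * u)" by (subst (1 2) u(2)) (simp add: mink.scaleR_left mink.scaleR_right N)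
    moreover have "snd (Y v) > 0" using N(2) u(1) by (subst u(2)) (simp add: future_directed_iff)
    moreover have "Y v = X p" using v by (simp add: Y_def)
    ultimately show ?thesis using u(1) by simp
  qed
  obtain p where "p \<in> M" using hyp by (auto simp: hypersurface_def)
  then have "m < 0" using key const by force
  then have "X ` M \<subseteq> upper_sheet (sqrt (- m))" using key const by (auto simp: upper_sheet_def)
  then show ?thesis using that \<open>m < 0\<close> by (metis neg_0_less_iff_less real_sqrt_gt_zero)
qed

section \<open>Local inverses of uniform radius and bijectivity\<close>

text \<open>For \<open>r > 0\<close> the number \<open>- mink W Z\<close> on the sheet is an
  increasing function of the hyperbolic distance, \<open>r\<^sup>2\<close> at \<open>W = Z\<close>,
  so the domain is a hyperbolic ball about \<open>X p\<close>. Describing it by \<open>mink\<close>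
  makes it invariant under the group.\<close>

definition sheet_section ::
  "'m::t2_space set \<Rightarrow> ('m \<Rightarrow> 'n::finite minkowski) \<Rightarrow> real \<Rightarrow> real \<Rightarrow> 'm \<Rightarrow> ('n minkowski \<Rightarrow> 'm) \<Rightarrow> bool" where
  "sheet_section M X r \<epsilon> p \<tau> \<longleftrightarrow>
     continuous_on {Z \<in> upper_sheet r. - mink (X p) Z < r\<^sup>2 + \<epsilon>} \<tau> \<and>
     (\<forall>Z\<in>upper_sheet r. - mink (X p) Z < r\<^sup>2 + \<epsilon> \<longrightarrow> \<tau> Z \<in> M \<and> X (\<tau> Z) = Z) \<and> \<tau> (X p) = p"

lemma sheet_section_mono:
  assumes "sheet_section M X r \<epsilon> p \<tau>" "\<epsilon>' \<le> \<epsilon>"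
  shows "sheet_section M X r \<epsilon>' p \<tau>"
  using assms unfolding sheet_section_def
  by (auto elim!: continuous_on_subset)

text \<open>One \<epsilon> has to serve all \<open>q\<close> near \<open>p\<close>, so that the
  points admitting a given radius contain open sets. The section at \<open>q\<close> is the graph
  section found at \<open>p\<close>.\<close>

lemma local_sheet_section:
  fixes X :: "'m::t2_space \<Rightarrow> 'n::finite minkowski"
  assumes hyp: "hypersurface M X" "spacelike M X" and r: "r > 0" and sheet: "X ` M \<subseteq> upper_sheet r" and p: "p \<in> M"
  obtains U \<epsilon> where "openin (top_of_set M) U" "p \<in> U" "\<epsilon> > 0" "\<And>q. q \<in> U \<Longrightarrow> \<exists>\<tau>. sheet_section M X r \<epsilon> q \<tau>"
proof -
  obtain B \<sigma> where B: "open B" "fst (X p) \<in> B" and \<sigma>: "continuous_on B \<sigma>" "\<sigma> ` B \<subseteq> M"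
    "openin (top_of_set M) (\<sigma> ` B)" "\<And>x. x \<in> B \<Longrightarrow> fst (X (\<sigma> x)) = x" "\<sigma> (fst (X p)) = p"
    using local_graph_section[OF hyp p] by blast
  obtain \<delta> where \<delta>: "\<delta> > 0" "ball (fst (X p)) \<delta> \<subseteq> B" using B openE by blast
  have "snd (X p) > 0" using sheet p by (auto simp: upper_sheet_def)
  then obtain \<epsilon> where \<epsilon>: "\<epsilon> > 0"
    "\<And>W Z. W \<in> upper_sheet r \<Longrightarrow> Z \<in> upper_sheet r \<Longrightarrow> snd W \<le> snd (X p) + 1 \<Longrightarrow> - mink W Z < r\<^sup>2 + \<epsilon>
       \<Longrightarrow> norm (fst Z - fst (W :: 'n minkowski)) < \<delta> / 2"
    using upper_sheet_neighbourhood[OF r, of "snd (X p) + 1" "\<delta> / 2"] \<delta>(1) by (auto simp: add_pos_pos)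
  \<comment> \<open>Distance below 1 caps \<open>snd (X q)\<close> as the choice of \<epsilon>
    demands; distance below \<open>\<delta> / 2\<close> leaves the other half of \<delta> for the
    invariant ball about \<open>X q\<close>.\<close>
  define U where "U = \<sigma> ` B \<inter> (M \<inter> X -` ball (X p) (min 1 (\<delta> / 2)))"
  show ?thesis
  proof (rule that[of U \<epsilon>])
    show "openin (top_of_set M) U" unfolding U_def
      by (intro openin_Int \<sigma>(3) continuous_openin_preimage_gen hypersurface_continuous_on hyp open_ball)
    show "p \<in> U" using p \<delta>(1) \<sigma>(5) B(2) by (force simp: U_def)
    fix q assume q: "q \<in> U"
    then have qM: "q \<in> M" and near: "dist (X p) (X q) < 1" "dist (X p) (X q) < \<delta> / 2" by (auto simp: U_def)
    obtain x where x: "x \<in> B" "q = \<sigma> x" using q by (auto simp: U_def)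
    have Xq: "X q \<in> upper_sheet r" using sheet qM by blast
    have "\<bar>snd (X p) - snd (X q)\<bar> \<le> dist (X p) (X q)" using dist_snd_le[of "X p" "X q"] by (simp add: dist_real_def)
    then have sq: "snd (X q) \<le> snd (X p) + 1" using near by linarith
    have inB: "fst Z \<in> B" if Z: "Z \<in> upper_sheet r" "- mink (X q) Z < r\<^sup>2 + \<epsilon>" for Z
    proof -
      have "dist (fst (X q)) (fst Z) < \<delta> / 2"
        using \<epsilon>(2)[OF Xq Z(1) sq Z(2)] by (simp add: dist_norm norm_minus_commute)
      moreover have "dist (fst (X p)) (fst (X q)) < \<delta> / 2" using dist_fst_le[of "X p" "X q"] near by linarith
      ultimately have "dist (fst (X p)) (fst Z) < \<delta>" using dist_triangle[of "fst (X p)" "fst Z" "fst (X q)"] by linarith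
      then show ?thesis using \<delta>(2) by auto
    qed
    have "sheet_section M X r \<epsilon> q (\<lambda>Z. \<sigma> (fst Z))"
      unfolding sheet_section_def
    proof (intro conjI ballI impI)
      show "continuous_on {Z \<in> upper_sheet r. - mink (X q) Z < r\<^sup>2 + \<epsilon>} (\<lambda>Z. \<sigma> (fst Z))"
        by (rule continuous_on_compose2[OF \<sigma>(1) continuous_on_fst[OF continuous_on_id]]) (use inB in auto)
      fix Z assume Z: "Z \<in> upper_sheet r" "- mink (X q) Z < r\<^sup>2 + \<epsilon>"
      show "\<sigma> (fst Z) \<in> M" using \<sigma>(2) inB[OF Z] by blast
      then have "X (\<sigma> (fst Z)) \<in> upper_sheet r" using sheet by blast
      moreover have "fst (X (\<sigma> (fst Z))) = fst Z" using \<sigma>(4)[OF inB[OF Z]] .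
      ultimately show "X (\<sigma> (fst Z)) = Z" using Z(1) by (simp add: upper_sheet_iff prod_eq_iff)
    next
      show "\<sigma> (fst (X q)) = q" using \<sigma>(4)[OF x(1)] x(2) by simp
    qed
    then show "\<exists>\<tau>. sheet_section M X r \<epsilon> q \<tau>" by blast
  qed (use \<epsilon> in auto)
qed

text \<open>Pull \<open>Z\<close> back by \<open>T'\<close>, lift it near \<open>p\<close> and push
  forward by the action. The domains match because \<open>T\<close> preserves \<open>mink\<close>
  and \<open>T'\<close> preserves the sheet.\<close>

lemma sheet_section_equivariant:
  fixes X :: "'m::t2_space \<Rightarrow> 'n::finite minkowski"
  assumes T: "T \<in> carrier O_plus" "T' \<in> carrier O_plus" "T' o\<^sub>L T = id_blinfun" "T o\<^sub>L T' = id_blinfun"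
    and \<rho>: "continuous_on M a" "a ` M \<subseteq> M" "\<And>q. q \<in> M \<Longrightarrow> X (a q) = blinfun_apply T (X q)"
    and p: "p \<in> M" and r: "r > 0" and sec: "sheet_section M X r \<epsilon> p \<tau>"
  shows "sheet_section M X r \<epsilon> (a p) (\<lambda>Z. a (\<tau> (blinfun_apply T' Z)))"
proof -
  have T'T: "blinfun_apply T' (blinfun_apply T Z) = Z" and TT': "blinfun_apply T (blinfun_apply T' Z) = Z" for Z
    using T(3,4) by (metis blinfun_apply_blinfun_compose id_blinfun.rep_eq)+
  have iso: "mink (blinfun_apply T Y) (blinfun_apply T W) = mink Y W" for Y W
    using T(1) unfolding O_plus_def partial_object.simps mem_Collect_eq by blast
  let ?D = "\<lambda>q. {Z \<in> upper_sheet r. - mink (X q) Z < r\<^sup>2 + \<epsilon>}"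
  have \<tau>: "continuous_on (?D p) \<tau>" "\<And>Z. Z \<in> ?D p \<Longrightarrow> \<tau> Z \<in> M \<and> X (\<tau> Z) = Z" "\<tau> (X p) = p"
    using sec by (auto simp: sheet_section_def)
  have D: "blinfun_apply T' Z \<in> ?D p" if "Z \<in> ?D (a p)" for Z
  proof -
    have "mink (X (a p)) Z = mink (X p) (blinfun_apply T' Z)"
      using iso[of "X p" "blinfun_apply T' Z"] by (simp add: TT' \<rho>(3)[OF p])
    then show ?thesis using that O_plus_upper_sheet[OF T(2) _ r] by auto
  qed
  have c1: "continuous_on (?D (a p)) (\<lambda>Z. \<tau> (blinfun_apply T' Z))"
    by (rule continuous_on_compose2[OF \<tau>(1)]) (use D in \<open>auto intro!: continuous_intros\<close>)
  have c2: "continuous_on (?D (a p)) (\<lambda>Z. a (\<tau> (blinfun_apply T' Z)))"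
    by (rule continuous_on_compose2[OF \<rho>(1) c1]) (use D \<tau>(2) in blast)
  have "a (\<tau> (blinfun_apply T' Z)) \<in> M \<and> X (a (\<tau> (blinfun_apply T' Z))) = Z" if "Z \<in> ?D (a p)" for Z
    using \<tau>(2)[OF D[OF that]] \<rho>(2,3) TT' by auto
  moreover have "a (\<tau> (blinfun_apply T' (X (a p)))) = a p" using \<rho>(3)[OF p] T'T \<tau>(3) by simp
  ultimately show ?thesis using c2 unfolding sheet_section_def by blast
qed

text \<open>The sets of points with local inverses of a common radius nearby are open and invariant
  and cover \<open>M\<close>; finitely many radii suffice, and the least of them works
  everywhere.\<close>

lemma uniform_sheet_section:
  fixes X :: "'m::t2_space \<Rightarrow> 'n::finite minkowski"
  assumes hyp: "hypersurface M X" "spacelike M X" and coc: "cocompact M X"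
    and r: "r > 0" and sheet: "X ` M \<subseteq> upper_sheet r"
  obtains \<epsilon> where "\<epsilon> > 0" "\<And>p. p \<in> M \<Longrightarrow> \<exists>\<tau>. sheet_section M X r \<epsilon> p \<tau>"
proof -
  obtain G \<rho> where sub: "subgroup G O_plus" and act: "group_action (O_plus\<lparr>carrier := G\<rparr>) M \<rho>"
    and cont: "\<And>T. T \<in> G \<Longrightarrow> continuous_on M (\<rho> T)"
    and equi: "\<And>T p. T \<in> G \<Longrightarrow> p \<in> M \<Longrightarrow> X (\<rho> T p) = blinfun_apply T (X p)"
    and comp: "compact_space (orbit_space (O_plus\<lparr>carrier := G\<rparr>) M \<rho>)"
    by (rule cocompactE[OF coc]) (rule that)
  let ?G = "O_plus\<lparr>carrier := G\<rparr> :: ('n minkowski \<Rightarrow>\<^sub>L 'n minkowski) monoid"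
  have carrier: "carrier ?G = G" "mult ?G = (o\<^sub>L)" "one ?G = id_blinfun" by (simp_all add: O_plus_def)
  have GO: "G \<subseteq> carrier O_plus" using sub by (rule subgroup.subset)
  have grp: "group ?G" using group_action.group_hom[OF act] by (simp add: group_hom_def)
  have closed: "\<rho> T p \<in> M" if "T \<in> G" "p \<in> M" for T p
    using group_action.element_image[OF act _ that(2) refl] that(1) carrier by simp
  have inverse: "\<exists>T'\<in>G. T' o\<^sub>L T = id_blinfun \<and> T o\<^sub>L T' = id_blinfun \<and>
      (\<forall>p\<in>M. \<rho> T' (\<rho> T p) = p \<and> \<rho> T (\<rho> T' p) = p)" if T: "T \<in> G" for T
  proof -
    let ?T' = "inv\<^bsub>?G\<^esub> T"
    have T': "?T' \<in> G" using group.inv_closed[OF grp, of T] T carrier by simp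
    have l: "?T' o\<^sub>L T = id_blinfun" "T o\<^sub>L ?T' = id_blinfun"
      using group.l_inv[OF grp, of T] group.r_inv[OF grp, of T] T carrier by simp_all
    have one: "\<rho> id_blinfun p = p" if "p \<in> M" for p
      using group_action.id_eq_one[OF act] that carrier(3) by (metis restrict_apply')
    have "\<rho> ?T' (\<rho> T p) = p" "\<rho> T (\<rho> ?T' p) = p" if p: "p \<in> M" for p
      using group_action.composition_rule[OF act p, of ?T' T] group_action.composition_rule[OF act p, of T ?T']
        T T' l one[OF p] carrier by simp_all
    then show ?thesis using T' l by blast
  qed
  define P where "P \<epsilon> p \<longleftrightarrow> (\<exists>\<tau>. sheet_section M X r \<epsilon> p \<tau>)" for \<epsilon> p
  have P_inv: "P \<epsilon> (\<rho> T p)" if pi: "P \<epsilon> p" "T \<in> G" "p \<in> M" for \<epsilon> T p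
  proof -
    obtain T' where "T' \<in> G" "T' o\<^sub>L T = id_blinfun" "T o\<^sub>L T' = id_blinfun" using inverse[OF pi(2)] by blast
    moreover obtain \<tau> where "sheet_section M X r \<epsilon> p \<tau>" using pi(1) by (auto simp: P_def)
    ultimately have "sheet_section M X r \<epsilon> (\<rho> T p) (\<lambda>Z. \<rho> T (\<tau> (blinfun_apply T' Z)))"
      using GO pi(2,3) r by (intro sheet_section_equivariant[where T = T] cont equi) (auto intro: closed)
    then show ?thesis by (auto simp: P_def)
  qed
  \<comment> \<open>Requiring radius \<epsilon> on a whole neighbourhood makes
    \<open>A \<epsilon>\<close> open by construction.\<close>
  define A where "A \<epsilon> = {p \<in> M. \<exists>U. openin (top_of_set M) U \<and> p \<in> U \<and> (\<forall>q\<in>U. P \<epsilon> q)}" for \<epsilon>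
  have A_open: "openin (top_of_set M) (A \<epsilon>)" for \<epsilon>
  proof (subst openin_subopen, rule ballI)
    fix p assume "p \<in> A \<epsilon>"
    then obtain U where U: "openin (top_of_set M) U" "p \<in> U" "\<forall>q\<in>U. P \<epsilon> q" by (auto simp: A_def)
    moreover have "U \<subseteq> A \<epsilon>" using U openin_imp_subset[OF U(1)] by (auto simp: A_def)
    ultimately show "\<exists>T. openin (top_of_set M) T \<and> p \<in> T \<and> T \<subseteq> A \<epsilon>" by blast
  qed
  have A_inv: "\<rho> T p \<in> A \<epsilon>" if ai: "T \<in> G" "p \<in> A \<epsilon>" for T p \<epsilon>
  proof -
    obtain U where U: "openin (top_of_set M) U" "p \<in> U" "\<forall>q\<in>U. P \<epsilon> q" and p: "p \<in> M"
      using ai(2) by (auto simp: A_def)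
    obtain T' where T': "T' \<in> G" "\<And>p. p \<in> M \<Longrightarrow> \<rho> T' (\<rho> T p) = p" "\<And>p. p \<in> M \<Longrightarrow> \<rho> T (\<rho> T' p) = p"
      using inverse[OF ai(1)] by blast
    have "openin (top_of_set M) (M \<inter> \<rho> T' -` U)"
      by (rule continuous_openin_preimage[OF cont[OF T'(1)] _ U(1)]) (use closed[OF T'(1)] in auto)
    moreover have "\<rho> T p \<in> M \<inter> \<rho> T' -` U" using closed[OF ai(1) p] T'(2)[OF p] U(2) by simp
    moreover have "P \<epsilon> q" if "q \<in> M \<inter> \<rho> T' -` U" for q
    proof -
      have q: "q \<in> M" "\<rho> T' q \<in> U" using that by auto
      have "P \<epsilon> (\<rho> T (\<rho> T' q))"
        using U(3) q \<open>T \<in> G\<close> closed[OF T'(1) q(1)] by - (rule P_inv, auto)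
      then show ?thesis using T'(3)[OF q(1)] by simp
    qed
    ultimately show ?thesis unfolding A_def using closed[OF ai(1) p] by blast
  qed
  obtain \<F> where \<F>: "finite \<F>" "\<F> \<subseteq> A ` {0<..}" "M \<subseteq> \<Union>\<F>"
  proof (rule finite_subcover_if_compact_orbit_space[OF act comp, of "A ` {0<..}"])
    show "openin (top_of_set M) U" if "U \<in> A ` {0<..}" for U using that A_open by blast
    show "\<rho> T p \<in> U" if "U \<in> A ` {0<..}" "T \<in> carrier ?G" "p \<in> U" for U T p
      using that A_inv carrier(1) by auto
    show "M \<subseteq> \<Union>(A ` {0<..})"
    proof
      fix p assume p: "p \<in> M"
      obtain U \<epsilon> where "openin (top_of_set M) U" "p \<in> U" "\<epsilon> > 0" "\<And>q. q \<in> U \<Longrightarrow> \<exists>\<tau>. sheet_section M X r \<epsilon> q \<tau>"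
        using local_sheet_section[OF hyp r sheet p] by blast
      then have "p \<in> A \<epsilon>" "\<epsilon> > 0" using p by (auto simp: A_def P_def)
      then show "p \<in> \<Union>(A ` {0<..})" by blast
    qed
  qed
  obtain E where E: "E \<subseteq> {0<..}" "finite E" "\<F> = A ` E" using finite_subset_image[OF \<F>(1,2)] by blast
  have "M \<noteq> {}" using hyp by (simp add: hypersurface_def)
  then have "E \<noteq> {}" using E(3) \<F>(3) by blast
  show ?thesis
  proof (rule that)
    show "Min E > 0" using E \<open>E \<noteq> {}\<close> by auto
    fix p assume "p \<in> M"
    then obtain \<epsilon> where "\<epsilon> \<in> E" "p \<in> A \<epsilon>" using \<F>(3) E(3) by blast
    then obtain \<tau> where "sheet_section M X r \<epsilon> p \<tau>" by (auto simp: A_def P_def)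
    moreover have "Min E \<le> \<epsilon>" using E \<open>\<epsilon> \<in> E\<close> by simp
    ultimately show "\<exists>\<tau>. sheet_section M X r (Min E) p \<tau>" by (blast intro: sheet_section_mono)
  qed
qed

text \<open>The covering argument is applied to the spatial part of \<open>X\<close>, whose target
  is a Euclidean space; on the sheet the spatial part determines the point, so bijectivity passes to
  \<open>X\<close>.\<close>

lemma bij_betw_upper_sheet:
  fixes X :: "'m::t2_space \<Rightarrow> 'n::finite minkowski"
  assumes hyp: "hypersurface M X" "spacelike M X" and coc: "cocompact M X"
    and r: "r > 0" and sheet: "X ` M \<subseteq> upper_sheet r"
  shows "bij_betw X M (upper_sheet r)"
proof -
  obtain \<epsilon> where \<epsilon>: "\<epsilon> > 0" "\<And>p. p \<in> M \<Longrightarrow> \<exists>\<tau>. sheet_section M X r \<epsilon> p \<tau>"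
    using uniform_sheet_section[OF hyp coc r sheet] by blast
  have contX: "continuous_on M X" using hyp(1) by (rule hypersurface_continuous_on)
  define lift where "lift x = (x, sqrt (r\<^sup>2 + (norm x)\<^sup>2))" for x :: "real ^ 'n"
  have rx: "r\<^sup>2 + (norm x)\<^sup>2 > 0" for x :: "real ^ 'n" using r by (simp add: add_pos_nonneg)
  have lift: "lift x \<in> upper_sheet r" for x using rx[of x] by (simp add: upper_sheet_iff lift_def)
  have lift_eq: "Z = lift (fst Z)" if "Z \<in> upper_sheet r" for Z
    using that by (simp add: upper_sheet_iff lift_def prod_eq_iff)
  have "bij_betw (\<lambda>p. fst (X p)) M UNIV"
  \<comment> \<open>Half the squared chord is at most half the squared spatial distance, so spatial
    distance below \<open>sqrt (2 * \<epsilon>)\<close> stays inside the invariant ball of size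
    \<epsilon>.\<close>
  proof (rule bij_betw_if_uniform_local_sections[where \<delta> = "sqrt (2 * \<epsilon>)"])
    show "connected M" "M \<noteq> {}" using hyp(1) by (auto simp: hypersurface_def)
    show "continuous_on M (\<lambda>p. fst (X p))" using contX by (rule continuous_on_fst)
    show "sqrt (2 * \<epsilon>) > 0" using \<epsilon>(1) by simp
    show "\<exists>U. openin (top_of_set M) U \<and> p \<in> U \<and> inj_on (\<lambda>p. fst (X p)) U" if p: "p \<in> M" for p
    proof -
      obtain B \<sigma> where B: "fst (X p) \<in> B" "openin (top_of_set M) (\<sigma> ` B)"
        "\<And>x. x \<in> B \<Longrightarrow> fst (X (\<sigma> x)) = x" "\<sigma> (fst (X p)) = p"
        by (rule local_graph_section[OF hyp p]) (rule that)
      have "inj_on (\<lambda>p. fst (X p)) (\<sigma> ` B)" using B(3) by (auto intro!: inj_onI)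
      moreover have "p \<in> \<sigma> ` B" using B(1,4) by force
      ultimately show ?thesis using B(2) by blast
    qed
    fix p assume p: "p \<in> M"
    then obtain \<tau> where \<tau>: "continuous_on {Z \<in> upper_sheet r. - mink (X p) Z < r\<^sup>2 + \<epsilon>} \<tau>"
      "\<And>Z. Z \<in> upper_sheet r \<Longrightarrow> - mink (X p) Z < r\<^sup>2 + \<epsilon> \<Longrightarrow> \<tau> Z \<in> M \<and> X (\<tau> Z) = Z" "\<tau> (X p) = p"
      using \<epsilon>(2)[OF p] by (auto simp: sheet_section_def)
    have Xp: "X p \<in> upper_sheet r" using sheet p by blast
    have near: "- mink (X p) (lift x) < r\<^sup>2 + \<epsilon>" if "x \<in> ball (fst (X p)) (sqrt (2 * \<epsilon>))" for x
    proof -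
      have "2 * (- mink (X p) (lift x) - r\<^sup>2) = mink (lift x - X p) (lift x - X p)"
        using upper_sheet_mink_diff[OF Xp lift] by simp
      also have "\<dots> \<le> (norm (x - fst (X p)))\<^sup>2" by (simp add: mink_def dot_square_norm lift_def)
      also have "\<dots> < (sqrt (2 * \<epsilon>))\<^sup>2"
        using that by (intro power_strict_mono) (auto simp: dist_norm norm_minus_commute)
      finally show ?thesis using \<epsilon>(1) by simp
    qed
    show "\<exists>\<tau>. continuous_on (ball (fst (X p)) (sqrt (2 * \<epsilon>))) \<tau> \<and> \<tau> ` ball (fst (X p)) (sqrt (2 * \<epsilon>)) \<subseteq> M \<and>
      (\<forall>x\<in>ball (fst (X p)) (sqrt (2 * \<epsilon>)). fst (X (\<tau> x)) = x) \<and> \<tau> (fst (X p)) = p"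
    proof (intro exI[of _ "\<lambda>x. \<tau> (lift x)"] conjI ballI)
      show "continuous_on (ball (fst (X p)) (sqrt (2 * \<epsilon>))) (\<lambda>x. \<tau> (lift x))"
      proof (rule continuous_on_compose2[OF \<tau>(1)])
        show "continuous_on (ball (fst (X p)) (sqrt (2 * \<epsilon>))) lift" unfolding lift_def by (intro continuous_intros)
      qed (use near lift in blast)
      show "(\<lambda>x. \<tau> (lift x)) ` ball (fst (X p)) (sqrt (2 * \<epsilon>)) \<subseteq> M" using \<tau>(2)[OF lift near] by blast
      show "fst (X (\<tau> (lift x))) = x" if "x \<in> ball (fst (X p)) (sqrt (2 * \<epsilon>))" for x
        using \<tau>(2)[OF lift near[OF that]] by (simp add: lift_def)
      show "\<tau> (lift (fst (X p))) = p" unfolding lift_eq[OF Xp, symmetric] by (rule \<tau>(3))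
    qed
  qed
  then have inj: "inj_on (\<lambda>p. fst (X p)) M" and surj: "(\<lambda>p. fst (X p)) ` M = UNIV"
    by (auto simp: bij_betw_def)
  show ?thesis
    unfolding bij_betw_def
  proof
    show "inj_on X M" using inj by (auto simp: inj_on_def)
    have "Z \<in> X ` M" if Z: "Z \<in> upper_sheet r" for Z
    proof -
      have "fst Z \<in> (\<lambda>p. fst (X p)) ` M" unfolding surj by simp
      then obtain p where p: "p \<in> M" "fst (X p) = fst Z" by (elim imageE) (rule that, simp_all)
      have Xp: "X p \<in> upper_sheet r" using p(1) sheet by blast
      have "X p = lift (fst Z)" using lift_eq[OF Xp] unfolding p(2) .
      from this lift_eq[OF Z, symmetric] have "X p = Z" by (rule trans)
      then show ?thesis using p(1) by blast
    qed
    then show "X ` M = upper_sheet r" using sheet by blast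
  qed
qed

theorem theorem1p4:
  fixes M :: "'m::{t2_space, second_countable_topology} set"
    and X :: "'m \<Rightarrow> 'n::finite minkowski"
    and k :: nat
  assumes "1 \<le> k" and "k \<le> CARD('n)"
    and "hypersurface M X"
    and "spacelike M X"
    and "k_convex k M X"
    and "cocompact M X"
    and "self_shrinker k M X"
  shows "\<exists>r>0. \<exists>B \<in> components hyperboloid. bij_betw X M ((*\<^sub>R) r ` B)"
proof -
  obtain G \<rho> where sub: "subgroup G O_plus" and act: "group_action (O_plus\<lparr>carrier := G\<rparr>) M \<rho>"
    and "\<And>T. T \<in> G \<Longrightarrow> continuous_on M (\<rho> T)"
    and equi: "\<And>T p. T \<in> G \<Longrightarrow> p \<in> M \<Longrightarrow> X (\<rho> T p) = blinfun_apply T (X p)"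
    and comp: "compact_space (orbit_space (O_plus\<lparr>carrier := G\<rparr>) M \<rho>)"
    by (rule cocompactE[OF assms(6)]) (rule that)
  have contX: "continuous_on M X" using assms(3) by (rule hypersurface_continuous_on)
  \<comment> \<open>The group preserves \<open>mink\<close>, so this function is invariant and
    attains its minimum although \<open>M\<close> itself is not assumed compact.\<close>
  have "\<exists>p\<in>M. \<forall>q\<in>M. mink (X p) (X p) \<le> mink (X q) (X q)"
  proof (rule invariant_function_attains_min[OF act comp])
    show "continuous_on M (\<lambda>p. mink (X p) (X p))" by (intro mink.continuous_on contX)
    show "M \<noteq> {}" using assms(3) by (simp add: hypersurface_def)
    fix T p assume T: "T \<in> carrier (O_plus\<lparr>carrier := G\<rparr>)" and "p \<in> M"
    then have "T \<in> carrier O_plus" using subgroup.subset[OF sub] by auto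
    then have "mink (blinfun_apply T (X p)) (blinfun_apply T (X p)) = mink (X p) (X p)"
      unfolding O_plus_def partial_object.simps mem_Collect_eq by blast
    then show "mink (X (\<rho> T p)) (X (\<rho> T p)) = mink (X p) (X p)" using equi T \<open>p \<in> M\<close> by simp
  qed
  then obtain p where p: "p \<in> M" "\<And>q. q \<in> M \<Longrightarrow> mink (X p) (X p) \<le> mink (X q) (X q)" by blast
  have const: "mink (X q) (X q) = mink (X p) (X p)" if "q \<in> M" for q
    by (rule shrinker_norm_constant[OF assms(1-5,7) p that])
  obtain r where r: "r > 0" "X ` M \<subseteq> upper_sheet r"
    using shrinker_in_upper_sheet[OF assms(1-5,7) const] by blast
  have "bij_betw X M ((*\<^sub>R) r ` upper_sheet 1)"
    unfolding scaled_upper_sheet[OF r(1)] by (rule bij_betw_upper_sheet[OF assms(3,4,6) r])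
  then show ?thesis using r(1) upper_sheet_1_component by blast
qed

end
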